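(* The dual space $Su(T^* )^*$ does not contain any symmetric basic sequence.
   Context: Basic sequences $(x_j)$ and $(y_j)$ are equivalent if, for all scalars $(a_j)$, $\sum_j a_jx_j$ converges if and only if $\sum_j a_jy_j$ converges. A basic sequence $(x_j)_{j=1}^\infty$ is symmetric if $(x_{\pi(j)})_{j=1}^\infty$ is equivalent to $(x_j)_{j=1}^\infty$ for every permutation $\pi$ of $\mathbb N$. The Tsirelson space $T$ (Figiel–Johnson construction) is the completion of $c_{00}$, with unit vectors $(t_n)$, under the unique norm satisfying, for $x=\sum_n a_nt_n$, $$\|x\| = \max\Big\{ \max_n |a_n|,\ \tfrac12 \sup \sum_{j=1}^k \|E_jx\|\Big\},$$ where the supremum is over all $k\in\mathbb N$ and finite sets $E_1<E_2<\dots<E_k$ of natural numbers with $k\le \min E_1$; here $E<F$ means $\max E<\min F$, and $Ex=\sum_{n\in E}a_nt_n$. $T^*$ denotes the dual of $T$ and $(t_n^* )$ the biorthogonal functionals of $(t_n)$, which form a basis of $T^*$. The subsymmetrization $Su(T^* )$ is the completion of the space of finitely supported sequences under the norm $$\Big\|\sum_n a_nt_n^*\Big\|=\sup\Big\{\Big\|\sum_i a_{n_i}t^*_i\Big\|_{T^*} : n_1<n_2<\cdots \Big\},$$ and its unit vector basis is again denoted $(t_n^* )$. $Su(T^* )^*$ is its dual Banach space. *)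

theory Defs
  imports "HOL-Analysis.Analysis" "HOL-Analysis.Finite_Function_Topology"
begin

section \<open>Symmetric basic sequences\<close>

definition basic_sequence :: "(nat \<Rightarrow> 'a::real_normed_vector) \<Rightarrow> bool" where
  "basic_sequence x \<longleftrightarrow>
     (\<forall>y \<in> closure (span (range x)). \<exists>!a :: nat \<Rightarrow> real. (\<lambda>j. a j *\<^sub>R x j) sums y)"

definition equivalent_basic_sequences ::
    "(nat \<Rightarrow> 'a::real_normed_vector) \<Rightarrow> (nat \<Rightarrow> 'b::real_normed_vector) \<Rightarrow> bool" where
  "equivalent_basic_sequences x y \<longleftrightarrow>
     basic_sequence x \<and> basic_sequence y \<and>
     (\<forall>a :: nat \<Rightarrow> real. summable (\<lambda>j. a j *\<^sub>R x j) \<longleftrightarrow> summable (\<lambda>j. a j *\<^sub>R y j))"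

definition symmetric_basic_sequence :: "(nat \<Rightarrow> 'a::real_normed_vector) \<Rightarrow> bool" where
  "symmetric_basic_sequence x \<longleftrightarrow>
     basic_sequence x \<and> (\<forall>p. bij p \<longrightarrow> equivalent_basic_sequences (\<lambda>j. x (p j)) x)"


section \<open>The completion of a normed space\<close>

text \<open>Equivalence classes of Cauchy sequences modulo null sequences.\<close>

definition cauchy_rel :: "(nat \<Rightarrow> 'a::real_normed_vector) \<Rightarrow> (nat \<Rightarrow> 'a) \<Rightarrow> bool" where
  "cauchy_rel X Y \<longleftrightarrow> Cauchy X \<and> Cauchy Y \<and> (\<lambda>n. X n - Y n) \<longlonglongrightarrow> 0"

lemma Cauchy_norm_seq: "Cauchy X \<Longrightarrow> Cauchy (\<lambda>n. norm (X n))"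
  for X :: "nat \<Rightarrow> 'a::real_normed_vector"
  unfolding Cauchy_iff real_norm_def by (meson le_less_trans norm_triangle_ineq3)

lemma Cauchy_const: "Cauchy (\<lambda>_. x :: 'a::real_normed_vector)"
  by (simp add: convergent_Cauchy convergent_const)

lemma Cauchy_add:
  fixes X Y :: "nat \<Rightarrow> 'a::real_normed_vector"
  assumes "Cauchy X" "Cauchy Y"
  shows "Cauchy (\<lambda>n. X n + Y n)"
proof (rule CauchyI)
  fix e :: real assume "e > 0"
  then obtain M N where M: "\<And>m n. m \<ge> M \<Longrightarrow> n \<ge> M \<Longrightarrow> norm (X m - X n) < e / 2"
    and N: "\<And>m n. m \<ge> N \<Longrightarrow> n \<ge> N \<Longrightarrow> norm (Y m - Y n) < e / 2"
    using assms unfolding Cauchy_iff by (meson half_gt_zero)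
  have "norm (X m + Y m - (X n + Y n)) < e" if "m \<ge> max M N" "n \<ge> max M N" for m n
    using norm_diff_triangle_ineq[of "X m" "Y m" "X n" "Y n"] M[of m n] N[of m n] that by simp
  then show "\<exists>M. \<forall>m\<ge>M. \<forall>n\<ge>M. norm (X m + Y m - (X n + Y n)) < e" by blast
qed

lemma Cauchy_minus: "Cauchy X \<Longrightarrow> Cauchy (\<lambda>n. - X n)"
  for X :: "nat \<Rightarrow> 'a::real_normed_vector"
  by (rule bounded_linear.Cauchy[OF bounded_linear_minus[OF bounded_linear_ident]])

lemma Cauchy_diff: "Cauchy X \<Longrightarrow> Cauchy Y \<Longrightarrow> Cauchy (\<lambda>n. X n - Y n)"
  for X Y :: "nat \<Rightarrow> 'a::real_normed_vector"
  using Cauchy_add[OF _ Cauchy_minus] by force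

lemma part_equivp_cauchy_rel: "part_equivp cauchy_rel"
proof (rule part_equivpI)
  show "\<exists>X. cauchy_rel X (X :: nat \<Rightarrow> 'a)"
    by (rule exI[of _ "\<lambda>_. 0"]) (simp add: cauchy_rel_def Cauchy_const)
  show "symp (cauchy_rel :: (nat \<Rightarrow> 'a) \<Rightarrow> _)"
  proof (rule sympI)
    fix X Y :: "nat \<Rightarrow> 'a" assume "cauchy_rel X Y"
    then show "cauchy_rel Y X"
      using tendsto_minus[of "\<lambda>n. X n - Y n" 0 sequentially] by (simp add: cauchy_rel_def)
  qed
  show "transp (cauchy_rel :: (nat \<Rightarrow> 'a) \<Rightarrow> _)"
  proof (rule transpI)
    fix X Y Z :: "nat \<Rightarrow> 'a" assume "cauchy_rel X Y" "cauchy_rel Y Z"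
    then show "cauchy_rel X Z"
      using tendsto_add[of "\<lambda>n. X n - Y n" 0 sequentially "\<lambda>n. Y n - Z n" 0]
      by (simp add: cauchy_rel_def)
  qed
qed

quotient_type (overloaded) 'a completion = "nat \<Rightarrow> 'a::real_normed_vector" / partial: cauchy_rel
  by (rule part_equivp_cauchy_rel)

lemma norm_seq_LIMSEQ: "Cauchy X \<Longrightarrow> (\<lambda>n. norm (X n)) \<longlonglongrightarrow> lim (\<lambda>n. norm (X n))"
  for X :: "nat \<Rightarrow> 'a::real_normed_vector"
  using Cauchy_norm_seq[of X] by (simp add: Cauchy_convergent_iff convergent_LIMSEQ_iff)

instantiation completion :: (real_normed_vector) real_normed_vector
begin

lift_definition zero_completion :: "'a completion" is "\<lambda>_. 0"
  by (simp add: cauchy_rel_def Cauchy_const)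

lift_definition plus_completion :: "'a completion \<Rightarrow> 'a completion \<Rightarrow> 'a completion"
  is "\<lambda>X Y n. X n + Y n"
proof -
  fix X X' Y Y' :: "nat \<Rightarrow> 'a" assume "cauchy_rel X X'" "cauchy_rel Y Y'"
  then show "cauchy_rel (\<lambda>n. X n + Y n) (\<lambda>n. X' n + Y' n)"
    using tendsto_add[of "\<lambda>n. X n - X' n" 0 sequentially "\<lambda>n. Y n - Y' n" 0]
    by (simp add: cauchy_rel_def Cauchy_add algebra_simps)
qed

lift_definition minus_completion :: "'a completion \<Rightarrow> 'a completion \<Rightarrow> 'a completion"
  is "\<lambda>X Y n. X n - Y n"
proof -
  fix X X' Y Y' :: "nat \<Rightarrow> 'a" assume "cauchy_rel X X'" "cauchy_rel Y Y'"
  then show "cauchy_rel (\<lambda>n. X n - Y n) (\<lambda>n. X' n - Y' n)"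
    using tendsto_diff[of "\<lambda>n. X n - X' n" 0 sequentially "\<lambda>n. Y n - Y' n" 0]
    by (simp add: cauchy_rel_def Cauchy_diff algebra_simps)
qed

lift_definition uminus_completion :: "'a completion \<Rightarrow> 'a completion" is "\<lambda>X n. - X n"
proof -
  fix X X' :: "nat \<Rightarrow> 'a" assume "cauchy_rel X X'"
  then show "cauchy_rel (\<lambda>n. - X n) (\<lambda>n. - X' n)"
    using tendsto_minus[of "\<lambda>n. X n - X' n" 0 sequentially]
    by (simp add: cauchy_rel_def Cauchy_minus algebra_simps)
qed

lift_definition scaleR_completion :: "real \<Rightarrow> 'a completion \<Rightarrow> 'a completion"
  is "\<lambda>c X n. c *\<^sub>R X n"
proof -
  fix c and X X' :: "nat \<Rightarrow> 'a" assume "cauchy_rel X X'"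
  then show "cauchy_rel (\<lambda>n. c *\<^sub>R X n) (\<lambda>n. c *\<^sub>R X' n)"
    using tendsto_scaleR[OF tendsto_const[of c], of "\<lambda>n. X n - X' n" 0 sequentially]
    by (simp add: cauchy_rel_def bounded_linear.Cauchy[OF bounded_linear_scaleR_right]
        scaleR_diff_right)
qed

lift_definition norm_completion :: "'a completion \<Rightarrow> real" is "\<lambda>X. lim (\<lambda>n. norm (X n))"
proof -
  fix X X' :: "nat \<Rightarrow> 'a" assume r: "cauchy_rel X X'"
  have "(\<lambda>n. norm (X n) - norm (X' n)) \<longlonglongrightarrow> 0"
  proof (rule tendsto_norm_zero_cancel, rule tendsto_sandwich[OF _ _ tendsto_const])
    show "(\<lambda>n. norm (X n - X' n)) \<longlonglongrightarrow> 0"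
      using r by (simp add: cauchy_rel_def tendsto_norm_zero)
  qed (auto simp: norm_triangle_ineq3)
  moreover have "(\<lambda>n. norm (X n) - norm (X' n)) \<longlonglongrightarrow> lim (\<lambda>n. norm (X n)) - lim (\<lambda>n. norm (X' n))"
    using r by (intro tendsto_diff norm_seq_LIMSEQ) (auto simp: cauchy_rel_def)
  ultimately show "lim (\<lambda>n. norm (X n)) = lim (\<lambda>n. norm (X' n))"
    using LIMSEQ_unique by fastforce
qed

definition sgn_completion :: "'a completion \<Rightarrow> 'a completion" where
  "sgn_completion x = scaleR (inverse (norm x)) x"

definition dist_completion :: "'a completion \<Rightarrow> 'a completion \<Rightarrow> real" where
  "dist_completion x y = norm (x - y)"

definition uniformity_completion :: "('a completion \<times> 'a completion) filter" where
  "uniformity_completion = (INF e\<in>{0<..}. principal {(x, y). dist x y < e})"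

definition open_completion :: "'a completion set \<Rightarrow> bool" where
  "open_completion U \<longleftrightarrow> (\<forall>x\<in>U. \<forall>\<^sub>F (x', y) in uniformity. x' = x \<longrightarrow> y \<in> U)"

instance
proof
  fix x y z :: "'a completion" and a b :: real
  show "x + y + z = x + (y + z)"
    by transfer (auto simp: cauchy_rel_def Cauchy_add add.assoc)
  show "x + y = y + x"
    by transfer (auto simp: cauchy_rel_def Cauchy_add add.commute)
  show "0 + x = x"
    by transfer (auto simp: cauchy_rel_def)
  show "- x + x = 0"
    by transfer (auto simp: cauchy_rel_def Cauchy_const)
  show "x - y = x + - y"
    by transfer (auto simp: cauchy_rel_def Cauchy_diff)
  show "a *\<^sub>R (x + y) = a *\<^sub>R x + a *\<^sub>R y"
    by transfer (auto simp: cauchy_rel_def scaleR_add_right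
        intro!: Cauchy_add bounded_linear.Cauchy[OF bounded_linear_scaleR_right])
  show "(a + b) *\<^sub>R x = a *\<^sub>R x + b *\<^sub>R x"
    by transfer (auto simp: cauchy_rel_def Cauchy_add scaleR_add_left
        intro!: Cauchy_add bounded_linear.Cauchy[OF bounded_linear_scaleR_right])
  show "a *\<^sub>R b *\<^sub>R x = (a * b) *\<^sub>R x"
    by transfer (auto simp: cauchy_rel_def
        intro!: bounded_linear.Cauchy[OF bounded_linear_scaleR_right])
  show "1 *\<^sub>R x = x"
    by transfer (auto simp: cauchy_rel_def)
  show "dist x y = norm (x - y)" by (rule dist_completion_def)
  show "sgn x = scaleR (inverse (norm x)) x" by (rule sgn_completion_def)
  show "uniformity = (INF e\<in>{0<..}. principal {(x, y::'a completion). dist x y < e})"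
    by (rule uniformity_completion_def)
  show "open U \<longleftrightarrow> (\<forall>x\<in>U. \<forall>\<^sub>F (x', y) in uniformity. x' = x \<longrightarrow> y \<in> U)" 
    for U :: "'a completion set"
    by (rule open_completion_def)
  show "norm x = 0 \<longleftrightarrow> x = 0"
  proof (transfer)
    fix X :: "nat \<Rightarrow> 'a" assume "cauchy_rel X X"
    then have c: "Cauchy X" by (simp add: cauchy_rel_def)
    have "lim (\<lambda>n. norm (X n)) = 0 \<longleftrightarrow> (\<lambda>n. norm (X n)) \<longlonglongrightarrow> 0"
      using norm_seq_LIMSEQ[OF c] LIMSEQ_unique by metis
    then show "(lim (\<lambda>n. norm (X n)) = 0) = cauchy_rel X (\<lambda>_. 0)"
      using c by (simp add: cauchy_rel_def Cauchy_const tendsto_norm_zero_iff)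
  qed
  show "norm (x + y) \<le> norm x + norm y"
  proof (transfer)
    fix X Y :: "nat \<Rightarrow> 'a" assume "cauchy_rel X X" "cauchy_rel Y Y"
    then have c: "Cauchy X" "Cauchy Y" by (auto simp: cauchy_rel_def)
    show "lim (\<lambda>n. norm (X n + Y n)) \<le> lim (\<lambda>n. norm (X n)) + lim (\<lambda>n. norm (Y n))"
      by (rule LIMSEQ_le[OF norm_seq_LIMSEQ[OF Cauchy_add[OF c]]
            tendsto_add[OF norm_seq_LIMSEQ norm_seq_LIMSEQ]])
        (use c in \<open>auto intro: norm_triangle_ineq\<close>)
  qed
  show "norm (a *\<^sub>R x) = \<bar>a\<bar> * norm x"
  proof (transfer)
    fix a and X :: "nat \<Rightarrow> 'a" assume "cauchy_rel X X"
    then have "Cauchy X" by (auto simp: cauchy_rel_def)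
    then show "lim (\<lambda>n. norm (a *\<^sub>R X n)) = \<bar>a\<bar> * lim (\<lambda>n. norm (X n))"
      using tendsto_mult_left[OF norm_seq_LIMSEQ] by (intro limI) auto
  qed
qed

end

lift_definition completion_of :: "'a::real_normed_vector \<Rightarrow> 'a completion" is "\<lambda>x _. x"
  by (simp add: cauchy_rel_def Cauchy_const)

lemma linear_completion_of: "linear completion_of"
  by (rule linearI) (transfer, simp add: cauchy_rel_def Cauchy_const)+

lemma norm_completion_of [simp]: "norm (completion_of x) = norm x"
  by transfer simp

lemma dist_completion_of [simp]: "dist (completion_of x) (completion_of y) = dist x y"
  by (simp add: dist_norm flip: linear_diff[OF linear_completion_of])

lemma completion_of_LIMSEQ_abs:
  assumes "Cauchy X"
  shows "(\<lambda>m. completion_of (X m)) \<longlonglongrightarrow> abs_completion X"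
proof (rule LIMSEQ_I)
  fix e :: real assume "e > 0"
  then obtain M where M: "\<And>m n. m \<ge> M \<Longrightarrow> n \<ge> M \<Longrightarrow> norm (X m - X n) < e / 2"
    using assms unfolding Cauchy_iff by (meson half_gt_zero)
  have r: "cauchy_rel X X" using assms by (simp add: cauchy_rel_def)
  show "\<exists>no. \<forall>m\<ge>no. norm (completion_of (X m) - abs_completion X) < e"
  proof (intro exI allI impI)
    fix m assume m: "m \<ge> M"
    have c: "Cauchy (\<lambda>n. X m - X n)"
      by (intro Cauchy_diff assms) (simp add: Cauchy_const)
    have r': "cauchy_rel (\<lambda>_. X m) (\<lambda>_. X m)"
      by (simp add: cauchy_rel_def Cauchy_const)
    have r'': "cauchy_rel (\<lambda>n. X m - X n) (\<lambda>n. X m - X n)"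
      using c by (simp add: cauchy_rel_def)
    have eq: "completion_of (X m) - abs_completion X = abs_completion (\<lambda>n. X m - X n)"
      using minus_completion.abs_eq[of "\<lambda>_. X m" X] r r' by (simp add: completion_of.abs_eq)
    have "norm (abs_completion (\<lambda>n. X m - X n)) = lim (\<lambda>n. norm (X m - X n))"
      using norm_completion.abs_eq[OF r''] .
    also have "\<dots> \<le> e / 2"
      by (rule LIMSEQ_le_const2[OF norm_seq_LIMSEQ[OF c]]) (use M m in \<open>auto intro!: less_imp_le\<close>)
    also have "\<dots> < e" using \<open>e > 0\<close> by simp
    finally show "norm (completion_of (X m) - abs_completion X) < e"
      by (simp add: eq)
  qed
qed

lemma completion_limit_ex:
  "\<exists>X. Cauchy X \<and> c = abs_completion X \<and> (\<lambda>m. completion_of (X m)) \<longlonglongrightarrow> c"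
proof (induction c rule: completion.abs_induct)
  case (1 y)
  then show ?case using completion_of_LIMSEQ_abs by (auto simp: cauchy_rel_def)
qed

lemma closure_range_completion_of: "closure (range completion_of) = UNIV"
proof -
  have "c \<in> closure (range completion_of)" for c :: "'a completion"
    using completion_limit_ex[of c] unfolding closure_sequential by (metis rangeI)
  then show ?thesis by blast
qed

instance completion :: (real_normed_vector) banach
proof
  fix X :: "nat \<Rightarrow> 'a completion" assume X: "Cauchy X"
  have "\<exists>y. dist (completion_of y) (X n) < inverse (real (Suc n))" for n
  proof -
    have "X n \<in> closure (range completion_of)" by (simp add: closure_range_completion_of)
    then show ?thesis
      unfolding closure_approachable by (metis (no_types, lifting) imageE inverse_positive_iff_positive of_nat_0_less_iff zero_less_Suc)
  qed
  then obtain Y where Y: "\<And>n. dist (completion_of (Y n)) (X n) < inverse (real (Suc n))"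
    by metis
  have "(\<lambda>n. norm (completion_of (Y n) - X n)) \<longlonglongrightarrow> 0"
    by (rule tendsto_sandwich[OF _ _ tendsto_const LIMSEQ_inverse_real_of_nat])
      (use Y in \<open>auto simp: dist_norm intro!: always_eventually less_imp_le\<close>)
  then have lim0: "(\<lambda>n. completion_of (Y n) - X n) \<longlonglongrightarrow> 0"
    by (simp add: tendsto_norm_zero_iff)
  have "Cauchy (\<lambda>n. completion_of (Y n))"
    using Cauchy_add[OF LIMSEQ_imp_Cauchy[OF lim0] X] by simp
  then have "Cauchy Y" by (simp add: Cauchy_def)
  from tendsto_diff[OF completion_of_LIMSEQ_abs[OF this] lim0]
  show "convergent X" by (auto simp: convergent_def)
qed

lemma bounded_linear_completion_extension:
  fixes f :: "'a::real_normed_vector \<Rightarrow> 'b::banach"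
  assumes f: "linear f" and b: "\<And>x. norm (f x) \<le> K * norm x"
  shows "\<exists>g :: 'a completion \<Rightarrow>\<^sub>L 'b. (\<forall>x. blinfun_apply g (completion_of x) = f x) \<and>
           (\<forall>c. norm (blinfun_apply g c) \<le> K * norm c)"
proof -
  interpret f: bounded_linear f
    using f b by (metis bounded_linear.intro bounded_linear_axioms.intro mult.commute)
  have "\<exists>l. \<forall>X. Cauchy X \<and> c = abs_completion X \<longrightarrow> (\<lambda>n. f (X n)) \<longlonglongrightarrow> l" for c :: "'a completion"
  proof -
    obtain X where X: "Cauchy X" "c = abs_completion X" using completion_limit_ex by blast
    obtain l where l: "(\<lambda>n. f (X n)) \<longlonglongrightarrow> l"
      using f.Cauchy[OF X(1)] by (auto simp: Cauchy_convergent_iff convergent_def)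
    have "(\<lambda>n. f (Y n)) \<longlonglongrightarrow> l" if Y: "Cauchy Y" "c = abs_completion Y" for Y
    proof -
      have "cauchy_rel Y X"
        using Quotient3_rel[OF Quotient3_completion, of Y X] X Y by (auto simp: cauchy_rel_def)
      then have "(\<lambda>n. f (Y n - X n)) \<longlonglongrightarrow> f 0"
        by (intro f.tendsto) (simp add: cauchy_rel_def)
      from tendsto_add[OF this l] show ?thesis by (simp add: f.diff f.zero)
    qed
    then show ?thesis by blast
  qed
  then obtain g where g: "\<And>c X. Cauchy X \<Longrightarrow> c = abs_completion X \<Longrightarrow> (\<lambda>n. f (X n)) \<longlonglongrightarrow> g c"
    by metis
  have gn: "norm (g c) \<le> K * norm c" for c
  proof -
    obtain X where X: "Cauchy X" "c = abs_completion X" "(\<lambda>m. completion_of (X m)) \<longlonglongrightarrow> c"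
      using completion_limit_ex by blast
    have "(\<lambda>n. K * norm (X n)) \<longlonglongrightarrow> K * norm c"
      using tendsto_mult_left[OF tendsto_norm[OF X(3)]] by simp
    then show ?thesis
      by (rule LIMSEQ_le[OF tendsto_norm[OF g[OF X(1,2)]]]) (use b in auto)
  qed
  have "bounded_linear g"
  proof (rule bounded_linear_intro)
    fix c d :: "'a completion" and r :: real
    obtain X where X: "Cauchy X" "c = abs_completion X" using completion_limit_ex by blast
    obtain Y where Y: "Cauchy Y" "d = abs_completion Y" using completion_limit_ex by blast
    have "c + d = abs_completion (\<lambda>n. X n + Y n)"
      using X Y plus_completion.abs_eq[of X Y] by (simp add: cauchy_rel_def)
    then have "(\<lambda>n. f (X n + Y n)) \<longlonglongrightarrow> g (c + d)"
      using g[OF Cauchy_add[OF X(1) Y(1)]] by blast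
    moreover have "(\<lambda>n. f (X n + Y n)) \<longlonglongrightarrow> g c + g d"
      using tendsto_add[OF g[OF X] g[OF Y]] by (simp add: f.add)
    ultimately show "g (c + d) = g c + g d" by (rule LIMSEQ_unique)
    have "r *\<^sub>R c = abs_completion (\<lambda>n. r *\<^sub>R X n)"
      using X scaleR_completion.abs_eq[of X r] by (simp add: cauchy_rel_def)
    then have "(\<lambda>n. f (r *\<^sub>R X n)) \<longlonglongrightarrow> g (r *\<^sub>R c)"
      using g[OF bounded_linear.Cauchy[OF bounded_linear_scaleR_right X(1)]] by blast
    moreover have "(\<lambda>n. f (r *\<^sub>R X n)) \<longlonglongrightarrow> r *\<^sub>R g c"
      using tendsto_scaleR[OF tendsto_const g[OF X]] by (simp add: f.scaleR)
    ultimately show "g (r *\<^sub>R c) = r *\<^sub>R g c" by (rule LIMSEQ_unique)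
    show "norm (g c) \<le> norm c * K" using gn[of c] by (simp add: mult.commute)
  qed
  moreover have "g (completion_of x) = f x" for x
  proof -
    have c: "Cauchy (\<lambda>_::nat. x)" by (simp add: Cauchy_const)
    have "(\<lambda>_::nat. f x) \<longlonglongrightarrow> g (completion_of x)"
      using g[OF c] by (simp add: completion_of.abs_eq)
    then show ?thesis using LIMSEQ_unique[OF _ tendsto_const] by blast
  qed
  ultimately show ?thesis using gn by (intro exI[of _ "Blinfun g"]) (simp add: bounded_linear_Blinfun_apply)
qed

lemma blinfun_completion_eqI:
  fixes f g :: "'a::real_normed_vector completion \<Rightarrow>\<^sub>L 'b::real_normed_vector"
  assumes "\<And>x. blinfun_apply f (completion_of x) = blinfun_apply g (completion_of x)"
  shows "f = g"
proof (rule blinfun_eqI)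
  fix c :: "'a completion"
  obtain X where X: "(\<lambda>m. completion_of (X m)) \<longlonglongrightarrow> c"
    using completion_limit_ex by blast
  have "(\<lambda>m. f (completion_of (X m))) \<longlonglongrightarrow> f c" "(\<lambda>m. f (completion_of (X m))) \<longlonglongrightarrow> g c"
    using blinfun.tendsto[OF tendsto_const X, of f] blinfun.tendsto[OF tendsto_const X, of g] assms
    by auto
  then show "blinfun_apply f c = blinfun_apply g c" by (rule LIMSEQ_unique)
qed


section \<open>The Tsirelson space\<close>

text \<open>
  The space $c_{00}$ is the type \<^typ>\<open>nat \<Rightarrow>\<^sub>0 real\<close>.  Indices start at 0: the coordinate with index
  \<open>n\<close> is the coordinate at the natural number \<open>n + 1\<close>.  (The norm which the library puts on
  this type is the norm of $\ell_1$; it occurs below in proofs only.)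
\<close>

lift_definition restrict_c00 :: "nat set \<Rightarrow> (nat \<Rightarrow>\<^sub>0 real) \<Rightarrow> (nat \<Rightarrow>\<^sub>0 real)" is
  "\<lambda>E x n. if n \<in> E then x n else 0"
  by (erule rev_finite_subset) auto

text \<open>
  The families \<open>E\<^sub>1 < \<dots> < E\<^sub>k\<close> with \<open>k \<le> min E\<^sub>1\<close>.  The \<^const>\<open>Suc\<close> accounts for the shift of indices.
\<close>

definition admissible :: "nat set list \<Rightarrow> bool" where
  "admissible Es \<longleftrightarrow>
     Es \<noteq> [] \<and> (\<forall>E \<in> set Es. finite E \<and> E \<noteq> {}) \<and>
     sorted_wrt (\<lambda>E F. Max E < Min F) Es \<and>
     length Es \<le> Suc (Min (hd Es))"

definition is_norm :: "('a::real_vector \<Rightarrow> real) \<Rightarrow> bool" where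
  "is_norm N \<longleftrightarrow>
     (\<forall>x. N x = 0 \<longleftrightarrow> x = 0) \<and>
     (\<forall>x y. N (x + y) \<le> N x + N y) \<and>
     (\<forall>c x. N (c *\<^sub>R x) = \<bar>c\<bar> * N x)"

text \<open>
  The supremum is taken over a bounded set of reals whenever \<open>N\<close> is a norm; see
  \<open>is_norm_bdd_above\<close> below.
\<close>

definition is_tsirelson_norm :: "((nat \<Rightarrow>\<^sub>0 real) \<Rightarrow> real) \<Rightarrow> bool" where
  "is_tsirelson_norm N \<longleftrightarrow>
     is_norm N \<and>
     (\<forall>x. N x = max (MAX n. \<bar>Poly_Mapping.lookup x n\<bar>)
                    (1/2 * (SUP Es \<in> Collect admissible. \<Sum>E\<leftarrow>Es. N (restrict_c00 E x))))"

definition tsirelson_norm :: "(nat \<Rightarrow>\<^sub>0 real) \<Rightarrow> real" where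
  "tsirelson_norm = (THE N. is_tsirelson_norm N)"


subsection \<open>Existence and uniqueness of the norm\<close>

lemma lookup_restrict_c00:
  "Poly_Mapping.lookup (restrict_c00 E x) n = (if n \<in> E then Poly_Mapping.lookup x n else 0)"
  by transfer simp

lemma lookup_scaleR_c00: "Poly_Mapping.lookup (c *\<^sub>R x) n = c * Poly_Mapping.lookup x n"
  for x :: "nat \<Rightarrow>\<^sub>0 real"
proof -
  have "finite {i. c * Poly_Mapping.lookup x i \<noteq> 0}"
    by (rule finite_subset[OF _ finite_lookup[of x]]) auto
  then show ?thesis by (simp add: scaleR_poly_mapping_def Abs_poly_mapping_inverse)
qed

lemma norm_c00: "norm x = (\<Sum>n\<in>Poly_Mapping.keys x. \<bar>Poly_Mapping.lookup x n\<bar>)"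
  for x :: "nat \<Rightarrow>\<^sub>0 real"
  by (simp add: norm_poly_mapping_def dist_poly_mapping_def)

lemma c00_expansion:
  "x = (\<Sum>n\<in>Poly_Mapping.keys x. Poly_Mapping.lookup x n *\<^sub>R Poly_Mapping.single n 1)"
  for x :: "nat \<Rightarrow>\<^sub>0 real"
  by (rule poly_mapping_eqI)
    (simp add: lookup_sum lookup_scaleR_c00 lookup_single when_def if_distrib in_keys_iff cong: if_cong)

lemma restrict_c00_add: "restrict_c00 E (x + y) = restrict_c00 E x + restrict_c00 E y"
  by (rule poly_mapping_eqI) (simp add: lookup_restrict_c00 lookup_add)

lemma restrict_c00_scaleR: "restrict_c00 E (c *\<^sub>R x) = c *\<^sub>R restrict_c00 E x"
  by (rule poly_mapping_eqI) (simp add: lookup_restrict_c00 lookup_scaleR_c00)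

lemma keys_restrict_c00: "Poly_Mapping.keys (restrict_c00 E x) = Poly_Mapping.keys x \<inter> E"
  by (auto simp: in_keys_iff lookup_restrict_c00 split: if_splits)

lemma restrict_c00_empty: "Poly_Mapping.keys x \<inter> E = {} \<Longrightarrow> restrict_c00 E x = 0"
  by (rule poly_mapping_eqI) (auto simp: lookup_restrict_c00 in_keys_iff)

lemma restrict_c00_id: "Poly_Mapping.keys x \<subseteq> E \<Longrightarrow> restrict_c00 E x = x"
  by (rule poly_mapping_eqI) (auto simp: lookup_restrict_c00 in_keys_iff)

lemma finite_range_c00: "finite (range (\<lambda>n. \<bar>Poly_Mapping.lookup x n\<bar>))" for x :: "nat \<Rightarrow>\<^sub>0 real"
proof (rule finite_subset)
  let ?f = "\<lambda>n. \<bar>Poly_Mapping.lookup x n\<bar>"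
  show "range ?f \<subseteq> insert 0 (?f ` Poly_Mapping.keys x)"
  proof (rule image_subsetI)
    fix n
    show "?f n \<in> insert 0 (?f ` Poly_Mapping.keys x)"
      by (cases "n \<in> Poly_Mapping.keys x") (simp_all add: in_keys_iff)
  qed
qed simp

lemma admissible_singleton: "admissible [{n}]"
  by (simp add: admissible_def)

lemma admissible_disjoint:
  assumes "admissible Es"
  shows "sorted_wrt (\<lambda>E F. E \<inter> F = {}) Es"
proof (rule sorted_wrt_mono_rel)
  show "sorted_wrt (\<lambda>E F. Max E < Min F) Es" using assms by (simp add: admissible_def)
  fix E F assume EF: "E \<in> set Es" "F \<in> set Es" "Max E < Min F"
  then have fin: "finite E" "finite F" using assms by (auto simp: admissible_def)
  show "E \<inter> F = {}"
  proof (rule ccontr)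
    assume "E \<inter> F \<noteq> {}"
    then obtain n where "n \<in> E" "n \<in> F" by blast
    then have "n \<le> Max E" "Min F \<le> n" using fin by auto
    then show False using EF by simp
  qed
qed

lemma sum_list_disjoint:
  fixes w :: "nat \<Rightarrow> real"
  assumes "sorted_wrt (\<lambda>E F. E \<inter> F = {}) Es" "finite A"
  shows "(\<Sum>E\<leftarrow>Es. sum w (A \<inter> E)) = sum w (A \<inter> \<Union>(set Es))"
  using assms(1)
proof (induction Es)
  case (Cons E Es)
  have "sum w (A \<inter> \<Union>(set (E # Es))) = sum w ((A \<inter> E) \<union> (A \<inter> \<Union>(set Es)))"
    by (rule arg_cong[of _ _ "sum w"]) auto
  also have "\<dots> = sum w (A \<inter> E) + sum w (A \<inter> \<Union>(set Es))"
    using Cons.prems assms(2) by (intro sum.union_disjoint) auto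
  finally show ?case using Cons by simp
qed simp

lemma sum_list_admissible_le:
  fixes w :: "nat \<Rightarrow> real"
  assumes "admissible Es" and "\<And>n. w n \<ge> 0"
    and "\<And>E. N (restrict_c00 E x) \<le> sum w (Poly_Mapping.keys x \<inter> E)"
  shows "(\<Sum>E\<leftarrow>Es. N (restrict_c00 E x)) \<le> sum w (Poly_Mapping.keys x)"
proof -
  have "(\<Sum>E\<leftarrow>Es. N (restrict_c00 E x)) \<le> (\<Sum>E\<leftarrow>Es. sum w (Poly_Mapping.keys x \<inter> E))"
    using assms(3) by (intro sum_list_mono) auto
  also have "\<dots> = sum w (Poly_Mapping.keys x \<inter> \<Union>(set Es))"
    by (intro sum_list_disjoint admissible_disjoint assms) auto
  also have "\<dots> \<le> sum w (Poly_Mapping.keys x)"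
    using assms(2) by (intro sum_mono2) auto
  finally show ?thesis .
qed

lemma is_norm_nonneg: "is_norm N \<Longrightarrow> 0 \<le> N x"
proof -
  assume N: "is_norm N"
  have "N (x + (-1) *\<^sub>R x) \<le> N x + N ((-1) *\<^sub>R x)"
    using N unfolding is_norm_def by blast
  moreover have "N ((-1) *\<^sub>R x) = \<bar>-1\<bar> * N x"
    using N unfolding is_norm_def by blast
  moreover have "N (x + (-1) *\<^sub>R x) = 0"
    using N unfolding is_norm_def by simp
  ultimately show "0 \<le> N x" by simp
qed

lemma is_norm_0: "is_norm N \<Longrightarrow> N 0 = 0"
  unfolding is_norm_def by blast

lemma is_norm_sum: "is_norm N \<Longrightarrow> N (sum f A) \<le> (\<Sum>i\<in>A. N (f i))"
proof (induction A rule: infinite_finite_induct)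
  case (insert a A)
  have "N (f a + sum f A) \<le> N (f a) + N (sum f A)"
    using insert.prems unfolding is_norm_def by blast
  then show ?case using insert by simp
qed (simp_all add: is_norm_0[of N])

lemma is_norm_bdd_above:
  assumes N: "is_norm N"
  shows "bdd_above ((\<lambda>Es. \<Sum>E\<leftarrow>Es. N (restrict_c00 E x)) ` Collect admissible)"
proof -
  define w where "w n = \<bar>Poly_Mapping.lookup x n\<bar> * N (Poly_Mapping.single n 1)" for n
  have w: "w n \<ge> 0" for n using is_norm_nonneg[OF N] by (simp add: w_def)
  have "N (restrict_c00 E x) \<le> sum w (Poly_Mapping.keys x \<inter> E)" for E
  proof -
    have "N (restrict_c00 E x) = N (\<Sum>n\<in>Poly_Mapping.keys x \<inter> E. 
        Poly_Mapping.lookup (restrict_c00 E x) n *\<^sub>R Poly_Mapping.single n 1)"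
      using c00_expansion[of "restrict_c00 E x"] by (simp only: keys_restrict_c00)
    also have "\<dots> \<le> (\<Sum>n\<in>Poly_Mapping.keys x \<inter> E. 
        N (Poly_Mapping.lookup (restrict_c00 E x) n *\<^sub>R Poly_Mapping.single n 1))"
      by (rule is_norm_sum[OF N])
    also have "\<dots> = sum w (Poly_Mapping.keys x \<inter> E)"
      using N by (intro sum.cong) (auto simp: w_def is_norm_def lookup_restrict_c00)
    finally show ?thesis .
  qed
  then show ?thesis
    using sum_list_admissible_le[of _ w N x] w
    by (intro bdd_aboveI[of _ "sum w (Poly_Mapping.keys x)"]) auto
qed

lemma is_tsirelson_norm_le:
  assumes N: "is_tsirelson_norm N" and M: "is_tsirelson_norm M"
  shows "N x \<le> M x"
proof (induction "card (Poly_Mapping.keys x)" arbitrary: x rule: less_induct)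
  case less
  have n: "is_norm N" "is_norm M" using N M by (auto simp: is_tsirelson_norm_def)
  have Nx: "N x = max (MAX n. \<bar>Poly_Mapping.lookup x n\<bar>)
                    (1/2 * (SUP Es \<in> Collect admissible. \<Sum>E\<leftarrow>Es. N (restrict_c00 E x)))"
    using N unfolding is_tsirelson_norm_def by blast
  have Mx: "M x = max (MAX n. \<bar>Poly_Mapping.lookup x n\<bar>)
                    (1/2 * (SUP Es \<in> Collect admissible. \<Sum>E\<leftarrow>Es. M (restrict_c00 E x)))"
    using M unfolding is_tsirelson_norm_def by blast
  have "(\<Sum>E\<leftarrow>Es. N (restrict_c00 E x)) \<le> max (N x) (2 * M x)" if Es: "admissible Es" for Es
  proof (cases "\<exists>E\<in>set Es. Poly_Mapping.keys x \<subseteq> E")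
    case True
    then obtain E where E: "E \<in> set Es" "Poly_Mapping.keys x \<subseteq> E" by blast
    then obtain As Bs where Es_eq: "Es = As @ E # Bs" by (meson split_list)
    have "F \<inter> E = {}" if "F \<in> set As \<union> set Bs" for F
      using admissible_disjoint[OF Es] that unfolding Es_eq by (auto simp: sorted_wrt_append)
    then have "Poly_Mapping.keys x \<inter> F = {}" if "F \<in> set As \<union> set Bs" for F
      using that E(2) by blast
    then have "N (restrict_c00 F x) = 0" if "F \<in> set As \<union> set Bs" for F
      using that by (simp add: restrict_c00_empty is_norm_0[OF n(1)])
    then have "(\<Sum>F\<leftarrow>As. N (restrict_c00 F x)) = 0" "(\<Sum>F\<leftarrow>Bs. N (restrict_c00 F x)) = 0"
      by (simp_all cong: map_cong)
    then show ?thesis using E(2) by (simp add: Es_eq restrict_c00_id)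
  next
    case False
    have "(\<Sum>E\<leftarrow>Es. N (restrict_c00 E x)) \<le> (\<Sum>E\<leftarrow>Es. M (restrict_c00 E x))"
    proof (rule sum_list_mono)
      fix E assume "E \<in> set Es"
      then have "Poly_Mapping.keys (restrict_c00 E x) \<subset> Poly_Mapping.keys x"
        using False by (auto simp: keys_restrict_c00)
      then have "card (Poly_Mapping.keys (restrict_c00 E x)) < card (Poly_Mapping.keys x)"
        by (intro psubset_card_mono) auto
      then show "N (restrict_c00 E x) \<le> M (restrict_c00 E x)" by (rule less)
    qed
    also have "\<dots> \<le> (SUP Es \<in> Collect admissible. \<Sum>E\<leftarrow>Es. M (restrict_c00 E x))"
      using Es by (intro cSUP_upper is_norm_bdd_above n) auto
    also have "\<dots> \<le> 2 * M x" by (subst Mx) linarith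
    finally show ?thesis by simp
  qed
  then have "(SUP Es \<in> Collect admissible. \<Sum>E\<leftarrow>Es. N (restrict_c00 E x)) \<le> max (N x) (2 * M x)"
    using admissible_singleton by (intro cSUP_least) blast+
  moreover have "N x = (MAX n. \<bar>Poly_Mapping.lookup x n\<bar>) \<or>
      N x = 1/2 * (SUP Es \<in> Collect admissible. \<Sum>E\<leftarrow>Es. N (restrict_c00 E x))"
    using Nx by (metis max_def)
  moreover have "(MAX n. \<bar>Poly_Mapping.lookup x n\<bar>) \<le> M x"
    by (subst Mx) (rule max.cobounded1)
  moreover have "0 \<le> M x" by (rule is_norm_nonneg[OF n(2)])
  moreover have "s \<le> max a (2 * b) \<Longrightarrow> a = c \<or> a = 1/2 * s \<Longrightarrow> c \<le> b \<Longrightarrow> 0 \<le> b \<Longrightarrow> a \<le> b"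
    for a b c s :: real
    by linarith
  ultimately show ?case by blast
qed

text \<open>Existence: iterate the defining equation, starting from the supremum norm.\<close>

definition max_c00 :: "(nat \<Rightarrow>\<^sub>0 real) \<Rightarrow> real" where
  "max_c00 x = (MAX n. \<bar>Poly_Mapping.lookup x n\<bar>)"

definition sup_admissible :: "((nat \<Rightarrow>\<^sub>0 real) \<Rightarrow> real) \<Rightarrow> (nat \<Rightarrow>\<^sub>0 real) \<Rightarrow> real" where
  "sup_admissible N x = (SUP Es \<in> Collect admissible. \<Sum>E\<leftarrow>Es. N (restrict_c00 E x))"

fun tsirelson_iterate :: "nat \<Rightarrow> (nat \<Rightarrow>\<^sub>0 real) \<Rightarrow> real" where
  "tsirelson_iterate 0 x = max_c00 x"
| "tsirelson_iterate (Suc m) x = max (max_c00 x) (1/2 * sup_admissible (tsirelson_iterate m) x)"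

lemma lookup_le_max_c00: "\<bar>Poly_Mapping.lookup x n\<bar> \<le> max_c00 x"
  unfolding max_c00_def by (intro Max_ge finite_range_c00) auto

lemma max_c00_leI: "(\<And>n. \<bar>Poly_Mapping.lookup x n\<bar> \<le> c) \<Longrightarrow> max_c00 x \<le> c"
  unfolding max_c00_def by (subst Max_le_iff) (auto intro: finite_range_c00)

lemma lookup_le_norm_c00: "\<bar>Poly_Mapping.lookup x n\<bar> \<le> norm x" for x :: "nat \<Rightarrow>\<^sub>0 real"
proof (cases "n \<in> Poly_Mapping.keys x")
  case True
  then show ?thesis unfolding norm_c00
    by (intro member_le_sum[where f = "\<lambda>n. \<bar>Poly_Mapping.lookup x n\<bar>"]) auto
qed (simp add: in_keys_iff)

lemma is_norm_max_c00: "is_norm max_c00"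
  unfolding is_norm_def
proof (intro conjI allI)
  fix x y :: "nat \<Rightarrow>\<^sub>0 real" and c :: real
  show "max_c00 x = 0 \<longleftrightarrow> x = 0"
  proof
    assume "max_c00 x = 0"
    then show "x = 0" using lookup_le_max_c00[of x] by (intro poly_mapping_eqI) simp
  qed (simp add: max_c00_def)
  show "max_c00 (x + y) \<le> max_c00 x + max_c00 y"
  proof (rule max_c00_leI)
    fix n
    show "\<bar>Poly_Mapping.lookup (x + y) n\<bar> \<le> max_c00 x + max_c00 y"
      using lookup_le_max_c00[of x n] lookup_le_max_c00[of y n] by (simp add: lookup_add)
  qed
  have le: "max_c00 (c *\<^sub>R x) \<le> \<bar>c\<bar> * max_c00 x" for c and x :: "nat \<Rightarrow>\<^sub>0 real"
    by (rule max_c00_leI) (simp add: lookup_scaleR_c00 abs_mult mult_left_mono lookup_le_max_c00)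
  show "max_c00 (c *\<^sub>R x) = \<bar>c\<bar> * max_c00 x"
  proof (cases "c = 0")
    case True
    then show ?thesis by (simp add: max_c00_def)
  next
    case False
    then show ?thesis using le[of c x] le[of "inverse c" "c *\<^sub>R x"] 
      by (simp add: field_simps)
  qed
qed

lemma norm_restrict_c00:
  "norm (restrict_c00 E x) = (\<Sum>n\<in>Poly_Mapping.keys x \<inter> E. \<bar>Poly_Mapping.lookup x n\<bar>)"
  by (simp add: norm_c00 keys_restrict_c00 lookup_restrict_c00)

lemma sum_list_admissible_le_norm:
  assumes "admissible Es" "\<And>x. N x \<le> norm x"
  shows "(\<Sum>E\<leftarrow>Es. N (restrict_c00 E x)) \<le> norm x"
  using sum_list_admissible_le[of Es "\<lambda>n. \<bar>Poly_Mapping.lookup x n\<bar>" N x] assms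
  by (metis abs_ge_zero norm_c00 norm_restrict_c00)

lemma sup_admissible_upper:
  assumes "is_norm N" "admissible Es"
  shows "(\<Sum>E\<leftarrow>Es. N (restrict_c00 E x)) \<le> sup_admissible N x"
  unfolding sup_admissible_def by (rule cSUP_upper[OF _ is_norm_bdd_above]) (use assms in auto)

lemma sup_admissible_least:
  assumes "\<And>Es. admissible Es \<Longrightarrow> (\<Sum>E\<leftarrow>Es. N (restrict_c00 E x)) \<le> c"
  shows "sup_admissible N x \<le> c"
  unfolding sup_admissible_def using assms admissible_singleton by (intro cSUP_least) auto

lemma sup_admissible_nonneg: "is_norm N \<Longrightarrow> 0 \<le> sup_admissible N x"
  using sup_admissible_upper[of N "[{0}]" x] admissible_singleton is_norm_nonneg[of N "restrict_c00 {0} x"]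
  by simp

lemma is_norm_step:
  assumes N: "is_norm N"
  shows "is_norm (\<lambda>x. max (max_c00 x) (1/2 * sup_admissible N x))"
  unfolding is_norm_def
proof (intro conjI allI)
  fix x y :: "nat \<Rightarrow>\<^sub>0 real" and c :: real
  have r0: "restrict_c00 E 0 = 0" for E by (simp add: restrict_c00_empty)
  have N0: "N 0 = 0" using N by (simp add: is_norm_def)
  have s0: "sup_admissible N 0 = 0"
    using sup_admissible_nonneg[OF N, of 0]
    by (intro antisym sup_admissible_least) (simp_all add: r0 N0)
  have m0: "max_c00 0 = 0" using is_norm_max_c00 by (simp add: is_norm_def)
  show "max (max_c00 x) (1/2 * sup_admissible N x) = 0 \<longleftrightarrow> x = 0"
  proof
    assume "max (max_c00 x) (1/2 * sup_admissible N x) = 0"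
    then have "max_c00 x = 0" using is_norm_nonneg[OF is_norm_max_c00, of x] by linarith
    then show "x = 0" using is_norm_max_c00 by (simp add: is_norm_def)
  qed (simp add: s0 m0)
  have "sup_admissible N (x + y) \<le> sup_admissible N x + sup_admissible N y"
  proof (rule sup_admissible_least)
    fix Es assume Es: "admissible Es"
    have "(\<Sum>E\<leftarrow>Es. N (restrict_c00 E (x + y)))
        \<le> (\<Sum>E\<leftarrow>Es. N (restrict_c00 E x) + N (restrict_c00 E y))"
      using N by (intro sum_list_mono) (simp add: restrict_c00_add is_norm_def)
    also have "\<dots> \<le> sup_admissible N x + sup_admissible N y"
      using sup_admissible_upper[OF N Es, of x] sup_admissible_upper[OF N Es, of y]
      by (simp add: sum_list_addf)
    finally show "(\<Sum>E\<leftarrow>Es. N (restrict_c00 E (x + y))) \<le> sup_admissible N x + sup_admissible N y" .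
  qed
  moreover have "max_c00 (x + y) \<le> max_c00 x + max_c00 y"
    using is_norm_max_c00 unfolding is_norm_def by blast
  ultimately show "max (max_c00 (x + y)) (1/2 * sup_admissible N (x + y))
      \<le> max (max_c00 x) (1/2 * sup_admissible N x) + max (max_c00 y) (1/2 * sup_admissible N y)"
    by linarith
  have le: "sup_admissible N (c *\<^sub>R x) \<le> \<bar>c\<bar> * sup_admissible N x" for c x
  proof (rule sup_admissible_least)
    fix Es assume Es: "admissible Es"
    have "N (c *\<^sub>R z) = \<bar>c\<bar> * N z" for z using N unfolding is_norm_def by blast
    then have "(\<Sum>E\<leftarrow>Es. N (restrict_c00 E (c *\<^sub>R x))) = \<bar>c\<bar> * (\<Sum>E\<leftarrow>Es. N (restrict_c00 E x))"
      by (simp add: restrict_c00_scaleR sum_list_const_mult)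
    also have "\<dots> \<le> \<bar>c\<bar> * sup_admissible N x"
      by (intro mult_left_mono sup_admissible_upper N Es) auto
    finally show "(\<Sum>E\<leftarrow>Es. N (restrict_c00 E (c *\<^sub>R x))) \<le> \<bar>c\<bar> * sup_admissible N x" .
  qed
  have "sup_admissible N (c *\<^sub>R x) = \<bar>c\<bar> * sup_admissible N x"
  proof (cases "c = 0")
    case True
    then show ?thesis by (simp add: s0)
  next
    case False
    then show ?thesis using le[of c x] le[of "inverse c" "c *\<^sub>R x"] 
      by (simp add: field_simps)
  qed
  moreover have "max_c00 (c *\<^sub>R x) = \<bar>c\<bar> * max_c00 x"
    using is_norm_max_c00 unfolding is_norm_def by blast
  ultimately show "max (max_c00 (c *\<^sub>R x)) (1/2 * sup_admissible N (c *\<^sub>R x)) =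
      \<bar>c\<bar> * max (max_c00 x) (1/2 * sup_admissible N x)"
    by (simp add: max_mult_distrib_left)
qed

lemma is_norm_tsirelson_iterate: "is_norm (tsirelson_iterate m)"
proof (induction m)
  case 0
  have "tsirelson_iterate 0 = max_c00" by (rule ext) simp
  then show ?case by (simp add: is_norm_max_c00)
next
  case (Suc m)
  have "tsirelson_iterate (Suc m) = (\<lambda>x. max (max_c00 x) (1/2 * sup_admissible (tsirelson_iterate m) x))"
    by (rule ext) simp
  then show ?case using is_norm_step[OF Suc] by simp
qed

lemma max_c00_le_norm: "max_c00 x \<le> norm x"
  by (rule max_c00_leI) (rule lookup_le_norm_c00)

lemma tsirelson_iterate_le_norm: "tsirelson_iterate m x \<le> norm x"
proof (induction m arbitrary: x)
  case (Suc m)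
  have "sup_admissible (tsirelson_iterate m) x \<le> norm x"
    by (intro sup_admissible_least sum_list_admissible_le_norm Suc)
  then show ?case using max_c00_le_norm[of x] norm_ge_zero[of x] unfolding tsirelson_iterate.simps
    by linarith
qed (simp add: max_c00_le_norm)

lemma sup_admissible_mono:
  assumes "is_norm M" "\<And>x. N x \<le> M x"
  shows "sup_admissible N x \<le> sup_admissible M x"
proof (rule sup_admissible_least)
  fix Es assume Es: "admissible Es"
  have "(\<Sum>E\<leftarrow>Es. N (restrict_c00 E x)) \<le> (\<Sum>E\<leftarrow>Es. M (restrict_c00 E x))"
    using assms by (intro sum_list_mono) auto
  also have "\<dots> \<le> sup_admissible M x" by (rule sup_admissible_upper[OF assms(1) Es])
  finally show "(\<Sum>E\<leftarrow>Es. N (restrict_c00 E x)) \<le> sup_admissible M x" .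
qed

lemma tsirelson_iterate_mono: "tsirelson_iterate m x \<le> tsirelson_iterate (Suc m) x"
proof (induction m arbitrary: x)
  case (Suc m)
  have "sup_admissible (tsirelson_iterate m) x \<le> sup_admissible (tsirelson_iterate (Suc m)) x"
    by (rule sup_admissible_mono[OF is_norm_tsirelson_iterate Suc])
  then show ?case by (subst (1 2) tsirelson_iterate.simps(2)) linarith
qed simp

lemma is_tsirelson_norm_ex: "\<exists>N. is_tsirelson_norm N \<and> (\<forall>x. N x \<le> norm x)"
proof -
  define N where "N x = (SUP m. tsirelson_iterate m x)" for x
  have bdd: "bdd_above (range (\<lambda>m. tsirelson_iterate m x))" for x
    by (rule bdd_aboveI[of _ "norm x"]) (auto intro: tsirelson_iterate_le_norm)
  have inc: "incseq (\<lambda>m. tsirelson_iterate m x)" for x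
    by (rule incseq_SucI) (rule tsirelson_iterate_mono)
  have lim: "(\<lambda>m. tsirelson_iterate m x) \<longlonglongrightarrow> N x" for x
    unfolding N_def by (rule LIMSEQ_incseq_SUP[OF bdd inc])
  have le: "tsirelson_iterate m x \<le> N x" for m x
    unfolding N_def by (rule cSUP_upper[OF _ bdd]) simp
  have it: "tsirelson_iterate m (x + y) \<le> tsirelson_iterate m x + tsirelson_iterate m y"
    "tsirelson_iterate m (c *\<^sub>R x) = \<bar>c\<bar> * tsirelson_iterate m x"
    "tsirelson_iterate m 0 = 0" for m x y c
    using is_norm_tsirelson_iterate[of m] unfolding is_norm_def by blast+
  have N: "is_norm N"
    unfolding is_norm_def
  proof (intro conjI allI)
    fix x y :: "nat \<Rightarrow>\<^sub>0 real" and c :: real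
    show "N x = 0 \<longleftrightarrow> x = 0"
    proof
      assume "N x = 0"
      then have "max_c00 x = 0"
        using le[of 0 x] is_norm_nonneg[OF is_norm_max_c00, of x] by simp
      then show "x = 0" using is_norm_max_c00 by (simp add: is_norm_def)
    qed (simp add: N_def it)
    show "N (x + y) \<le> N x + N y"
      by (rule LIMSEQ_le[OF lim tendsto_add[OF lim lim]]) (auto intro: it)
    show "N (c *\<^sub>R x) = \<bar>c\<bar> * N x"
      using LIMSEQ_unique[OF lim[of "c *\<^sub>R x"]] tendsto_mult_left[OF lim[of x], of "\<bar>c\<bar>"]
      by (simp add: it)
  qed
  have "N x = max (max_c00 x) (1/2 * sup_admissible N x)" for x
  proof (rule antisym)
    show "N x \<le> max (max_c00 x) (1/2 * sup_admissible N x)"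
    proof (rule LIMSEQ_le_const2[OF LIMSEQ_Suc[OF lim]], intro exI allI impI)
      fix m
      have "sup_admissible (tsirelson_iterate m) x \<le> sup_admissible N x"
        by (rule sup_admissible_mono[OF N le])
      then show "tsirelson_iterate (Suc m) x \<le> max (max_c00 x) (1/2 * sup_admissible N x)"
        unfolding tsirelson_iterate.simps by linarith
    qed
    have "sup_admissible N x \<le> 2 * N x"
    proof (rule sup_admissible_least)
      fix Es assume Es: "admissible Es"
      have "(\<lambda>m. \<Sum>E\<leftarrow>Fs. tsirelson_iterate m (restrict_c00 E x)) \<longlonglongrightarrow> (\<Sum>E\<leftarrow>Fs. N (restrict_c00 E x))" for Fs
        by (induction Fs) (auto intro: tendsto_add lim)
      then show "(\<Sum>E\<leftarrow>Es. N (restrict_c00 E x)) \<le> 2 * N x"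
      proof (rule LIMSEQ_le_const2, intro exI allI impI)
        fix m
        have "(\<Sum>E\<leftarrow>Es. tsirelson_iterate m (restrict_c00 E x)) \<le> sup_admissible (tsirelson_iterate m) x"
          by (rule sup_admissible_upper[OF is_norm_tsirelson_iterate Es])
        then show "(\<Sum>E\<leftarrow>Es. tsirelson_iterate m (restrict_c00 E x)) \<le> 2 * N x"
          using le[of "Suc m" x] unfolding tsirelson_iterate.simps by linarith
      qed
    qed
    then show "max (max_c00 x) (1/2 * sup_admissible N x) \<le> N x"
      using le[of 0 x] by simp
  qed
  with N have "is_tsirelson_norm N"
    unfolding is_tsirelson_norm_def max_c00_def sup_admissible_def by blast
  moreover have "N x \<le> norm x" for x
    unfolding N_def by (rule cSUP_least) (auto intro: tsirelson_iterate_le_norm)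
  ultimately show ?thesis by blast
qed

lemma is_tsirelson_norm_ex1: "\<exists>!N. is_tsirelson_norm N"
proof (rule ex_ex1I)
  show "\<exists>N. is_tsirelson_norm N" using is_tsirelson_norm_ex by blast
  fix N M assume "is_tsirelson_norm N" "is_tsirelson_norm M"
  then show "N = M" by (intro ext antisym is_tsirelson_norm_le)
qed

lemma is_tsirelson_norm: "is_tsirelson_norm tsirelson_norm"
  unfolding tsirelson_norm_def by (rule theI'[OF is_tsirelson_norm_ex1])

lemma is_norm_tsirelson: "is_norm tsirelson_norm"
  using is_tsirelson_norm by (simp add: is_tsirelson_norm_def)

lemma tsirelson_norm_eq:
  "tsirelson_norm x = max (MAX n. \<bar>Poly_Mapping.lookup x n\<bar>)
     (1/2 * (SUP Es \<in> Collect admissible. \<Sum>E\<leftarrow>Es. tsirelson_norm (restrict_c00 E x)))"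
  using is_tsirelson_norm unfolding is_tsirelson_norm_def by blast

lemma lookup_le_tsirelson_norm: "\<bar>Poly_Mapping.lookup x n\<bar> \<le> tsirelson_norm x"
  using lookup_le_max_c00[of x n] unfolding max_c00_def
  by (subst tsirelson_norm_eq) (rule max.coboundedI1)


lemma tsirelson_norm_single_le: "tsirelson_norm (Poly_Mapping.single n 1) \<le> 1"
proof -
  obtain N where N: "is_tsirelson_norm N" "\<And>x. N x \<le> norm x"
    using is_tsirelson_norm_ex by blast
  then have "tsirelson_norm (Poly_Mapping.single n 1) \<le> norm (Poly_Mapping.single n (1::real))"
    using is_tsirelson_norm_le[OF is_tsirelson_norm] by (meson order_trans)
  then show ?thesis by (simp add: norm_c00)
qed


subsection \<open>The space and its dual\<close>

text \<open>A copy of $c_{00}$ that carries the Tsirelson norm.\<close>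

typedef tsirelson_c00 = "UNIV :: (nat \<Rightarrow>\<^sub>0 real) set" ..

setup_lifting type_definition_tsirelson_c00

instantiation tsirelson_c00 :: real_normed_vector
begin

lift_definition zero_tsirelson_c00 :: tsirelson_c00 is 0 .
lift_definition plus_tsirelson_c00 :: "tsirelson_c00 \<Rightarrow> tsirelson_c00 \<Rightarrow> tsirelson_c00" is "(+)" .
lift_definition minus_tsirelson_c00 :: "tsirelson_c00 \<Rightarrow> tsirelson_c00 \<Rightarrow> tsirelson_c00" is "(-)" .
lift_definition uminus_tsirelson_c00 :: "tsirelson_c00 \<Rightarrow> tsirelson_c00" is uminus .
lift_definition scaleR_tsirelson_c00 :: "real \<Rightarrow> tsirelson_c00 \<Rightarrow> tsirelson_c00" is scaleR .
lift_definition norm_tsirelson_c00 :: "tsirelson_c00 \<Rightarrow> real" is tsirelson_norm .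

definition sgn_tsirelson_c00 :: "tsirelson_c00 \<Rightarrow> tsirelson_c00" where
  "sgn_tsirelson_c00 x = scaleR (inverse (norm x)) x"

definition dist_tsirelson_c00 :: "tsirelson_c00 \<Rightarrow> tsirelson_c00 \<Rightarrow> real" where
  "dist_tsirelson_c00 x y = norm (x - y)"

definition uniformity_tsirelson_c00 :: "(tsirelson_c00 \<times> tsirelson_c00) filter" where
  "uniformity_tsirelson_c00 = (INF e\<in>{0<..}. principal {(x, y). dist x y < e})"

definition open_tsirelson_c00 :: "tsirelson_c00 set \<Rightarrow> bool" where
  "open_tsirelson_c00 U \<longleftrightarrow> (\<forall>x\<in>U. \<forall>\<^sub>F (x', y) in uniformity. x' = x \<longrightarrow> y \<in> U)"

instance
proof
  fix x y z :: tsirelson_c00 and a b :: real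
  show "x + y + z = x + (y + z)" by transfer (rule add.assoc)
  show "x + y = y + x" by transfer (rule add.commute)
  show "0 + x = x" by transfer simp
  show "- x + x = 0" by transfer simp
  show "x - y = x + - y" by transfer simp
  show "a *\<^sub>R (x + y) = a *\<^sub>R x + a *\<^sub>R y" by transfer (rule scaleR_add_right)
  show "(a + b) *\<^sub>R x = a *\<^sub>R x + b *\<^sub>R x" by transfer (rule scaleR_add_left)
  show "a *\<^sub>R b *\<^sub>R x = (a * b) *\<^sub>R x" by transfer simp
  show "1 *\<^sub>R x = x" by transfer simp
  show "dist x y = norm (x - y)" by (rule dist_tsirelson_c00_def)
  show "sgn x = scaleR (inverse (norm x)) x" by (rule sgn_tsirelson_c00_def)
  show "uniformity = (INF e\<in>{0<..}. principal {(x, y::tsirelson_c00). dist x y < e})"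
    by (rule uniformity_tsirelson_c00_def)
  show "open U \<longleftrightarrow> (\<forall>x\<in>U. \<forall>\<^sub>F (x', y) in uniformity. x' = x \<longrightarrow> y \<in> U)"
    for U :: "tsirelson_c00 set"
    by (rule open_tsirelson_c00_def)
  show "norm x = 0 \<longleftrightarrow> x = 0"
    by transfer (use is_norm_tsirelson in \<open>simp add: is_norm_def\<close>)
  show "norm (x + y) \<le> norm x + norm y"
    by transfer (use is_norm_tsirelson in \<open>simp add: is_norm_def\<close>)
  show "norm (a *\<^sub>R x) = \<bar>a\<bar> * norm x"
    by transfer (use is_norm_tsirelson in \<open>simp add: is_norm_def\<close>)
qed

end

type_synonym tsirelson = "tsirelson_c00 completion"

type_synonym tsirelson_dual = "tsirelson \<Rightarrow>\<^sub>L real"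

definition tsirelson_unit :: "nat \<Rightarrow> tsirelson" where
  "tsirelson_unit n = completion_of (Abs_tsirelson_c00 (Poly_Mapping.single n 1))"

definition tsirelson_coord :: "nat \<Rightarrow> tsirelson_dual" where
  "tsirelson_coord n =
     (THE f. \<forall>m. blinfun_apply f (tsirelson_unit m) = (if m = n then 1 else 0))"

lemma completion_of_Abs_tsirelson_c00:
  "completion_of (Abs_tsirelson_c00 x) =
     (\<Sum>n\<in>Poly_Mapping.keys x. Poly_Mapping.lookup x n *\<^sub>R tsirelson_unit n)"
proof -
  have lin: "linear Abs_tsirelson_c00"
    by (rule linearI) (simp_all add: plus_tsirelson_c00.abs_eq scaleR_tsirelson_c00.abs_eq)
  show ?thesis
    by (subst c00_expansion)
      (simp add: linear_sum[OF lin] linear_scale[OF lin] linear_sum[OF linear_completion_of]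
        linear_scale[OF linear_completion_of] tsirelson_unit_def)
qed

lemma tsirelson_coord_ex:
  "\<exists>f :: tsirelson_dual. norm f \<le> 1 \<and> (\<forall>x. blinfun_apply f (completion_of x) = Poly_Mapping.lookup (Rep_tsirelson_c00 x) n)"
proof -
  have lin: "linear (\<lambda>x. Poly_Mapping.lookup (Rep_tsirelson_c00 x) n)"
    by (rule linearI) (simp_all add: plus_tsirelson_c00.rep_eq scaleR_tsirelson_c00.rep_eq
        lookup_add lookup_scaleR_c00)
  have bd: "norm (Poly_Mapping.lookup (Rep_tsirelson_c00 x) n) \<le> 1 * norm x" for x
    by (simp add: norm_tsirelson_c00.rep_eq lookup_le_tsirelson_norm)
  obtain f :: tsirelson_dual where
    f: "\<And>x. blinfun_apply f (completion_of x) = Poly_Mapping.lookup (Rep_tsirelson_c00 x) n"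
      "\<And>c. norm (blinfun_apply f c) \<le> 1 * norm c"
    using bounded_linear_completion_extension[OF lin bd] by blast
  have "norm f \<le> 1" by (rule norm_blinfun_bound) (use f(2) in auto)
  then show ?thesis using f(1) by blast
qed

lemma tsirelson_coord:
  "blinfun_apply (tsirelson_coord n) (completion_of x) = Poly_Mapping.lookup (Rep_tsirelson_c00 x) n"
  "norm (tsirelson_coord n) \<le> 1"
proof -
  obtain f :: tsirelson_dual where f: "norm f \<le> 1"
      "\<And>x. blinfun_apply f (completion_of x) = Poly_Mapping.lookup (Rep_tsirelson_c00 x) n"
    using tsirelson_coord_ex by blast
  have fu: "\<forall>m. blinfun_apply f (tsirelson_unit m) = (if m = n then 1 else 0)"
    by (simp add: tsirelson_unit_def f(2) Abs_tsirelson_c00_inverse lookup_single when_def)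
  have "tsirelson_coord n = f"
    unfolding tsirelson_coord_def
  proof (rule the_equality[where P = "\<lambda>f. \<forall>m. blinfun_apply f (tsirelson_unit m) = (if m = n then 1 else 0)", OF fu])
    fix g :: tsirelson_dual
    assume g: "\<forall>m. blinfun_apply g (tsirelson_unit m) = (if m = n then 1 else 0)"
    show "g = f"
    proof (rule blinfun_completion_eqI)
      fix x :: tsirelson_c00
      obtain y where "x = Abs_tsirelson_c00 y" by (metis Rep_tsirelson_c00_inverse)
      then show "blinfun_apply g (completion_of x) = blinfun_apply f (completion_of x)"
        using fu g by (simp add: completion_of_Abs_tsirelson_c00 blinfun.sum_right blinfun.scaleR_right)
    qed
  qed
  then show "blinfun_apply (tsirelson_coord n) (completion_of x) = Poly_Mapping.lookup (Rep_tsirelson_c00 x) n"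
    "norm (tsirelson_coord n) \<le> 1"
    using f by auto
qed

lemma tsirelson_coord_unit: "blinfun_apply (tsirelson_coord n) (tsirelson_unit m) = (if m = n then 1 else 0)"
  by (simp add: tsirelson_unit_def tsirelson_coord Abs_tsirelson_c00_inverse lookup_single when_def)


section \<open>The subsymmetrization of the dual of the Tsirelson space\<close>

definition su_norm :: "(nat \<Rightarrow>\<^sub>0 real) \<Rightarrow> real" where
  "su_norm a =
     (SUP s \<in> {s :: nat \<Rightarrow> nat. strict_mono s}.
        norm (\<Sum>i\<in>{i. s i \<in> Poly_Mapping.keys a}. Poly_Mapping.lookup a (s i) *\<^sub>R tsirelson_coord i))"

lemma finite_vimage_keys:
  fixes a :: "nat \<Rightarrow>\<^sub>0 real" and s :: "nat \<Rightarrow> nat"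
  shows "strict_mono s \<Longrightarrow> finite {i. s i \<in> Poly_Mapping.keys a}"
  using finite_vimageI[of "Poly_Mapping.keys a" s] strict_mono_imp_inj_on[of s] by (simp add: vimage_def)

lemma su_sum_superset:
  fixes a :: "nat \<Rightarrow>\<^sub>0 real" and s :: "nat \<Rightarrow> nat"
  assumes "finite A" "{i. s i \<in> Poly_Mapping.keys a} \<subseteq> A"
  shows "(\<Sum>i\<in>{i. s i \<in> Poly_Mapping.keys a}. Poly_Mapping.lookup a (s i) *\<^sub>R tsirelson_coord i) =
    (\<Sum>i\<in>A. Poly_Mapping.lookup a (s i) *\<^sub>R tsirelson_coord i)"
  using assms by (intro sum.mono_neutral_left) (auto simp: in_keys_iff)

lemma su_sum_le_norm:
  fixes a :: "nat \<Rightarrow>\<^sub>0 real" and s :: "nat \<Rightarrow> nat"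
  assumes "strict_mono s"
  shows "norm (\<Sum>i\<in>{i. s i \<in> Poly_Mapping.keys a}. Poly_Mapping.lookup a (s i) *\<^sub>R tsirelson_coord i) \<le> norm a"
proof -
  have inj: "inj_on s {i. s i \<in> Poly_Mapping.keys a}"
    using assms strict_mono_imp_inj_on inj_on_subset by blast
  have "norm (\<Sum>i\<in>{i. s i \<in> Poly_Mapping.keys a}. Poly_Mapping.lookup a (s i) *\<^sub>R tsirelson_coord i)
      \<le> (\<Sum>i\<in>{i. s i \<in> Poly_Mapping.keys a}. \<bar>Poly_Mapping.lookup a (s i)\<bar>)"
    by (rule sum_norm_le) (simp add: mult_left_le tsirelson_coord(2))
  also have "\<dots> = (\<Sum>n\<in>s ` {i. s i \<in> Poly_Mapping.keys a}. \<bar>Poly_Mapping.lookup a n\<bar>)"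
    by (simp add: sum.reindex[OF inj])
  also have "\<dots> \<le> norm a"
    unfolding norm_c00 by (rule sum_mono2) auto
  finally show ?thesis .
qed

lemma su_sum_le_su_norm:
  fixes a :: "nat \<Rightarrow>\<^sub>0 real" and s :: "nat \<Rightarrow> nat"
  assumes "strict_mono s"
  shows "norm (\<Sum>i\<in>{i. s i \<in> Poly_Mapping.keys a}. Poly_Mapping.lookup a (s i) *\<^sub>R tsirelson_coord i) \<le> su_norm a"
  unfolding su_norm_def
proof (rule cSUP_upper)
  show "s \<in> {s. strict_mono s}" using assms by simp
  show "bdd_above ((\<lambda>s. norm (\<Sum>i\<in>{i. s i \<in> Poly_Mapping.keys a}. Poly_Mapping.lookup a (s i) *\<^sub>R tsirelson_coord i))
      ` {s :: nat \<Rightarrow> nat. strict_mono s})"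
    by (rule bdd_aboveI[of _ "norm a"]) (use su_sum_le_norm in blast)
qed

lemma su_norm_least:
  assumes "\<And>s :: nat \<Rightarrow> nat. strict_mono s \<Longrightarrow>
    norm (\<Sum>i\<in>{i. s i \<in> Poly_Mapping.keys a}. Poly_Mapping.lookup a (s i) *\<^sub>R tsirelson_coord i) \<le> c"
  shows "su_norm a \<le> c"
  unfolding su_norm_def
proof (rule cSUP_least)
  have "strict_mono (\<lambda>n :: nat. n)" by (simp add: strict_mono_def)
  then show "{s :: nat \<Rightarrow> nat. strict_mono s} \<noteq> {}" by blast
qed (use assms in blast)

lemma lookup_le_su_norm: "\<bar>Poly_Mapping.lookup a n\<bar> \<le> su_norm a"
proof (cases "n \<in> Poly_Mapping.keys a")
  case True
  define s :: "nat \<Rightarrow> nat" where "s i = n + i" for i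
  define S where "S = {i. s i \<in> Poly_Mapping.keys a}"
  define f where "f = (\<Sum>i\<in>S. Poly_Mapping.lookup a (s i) *\<^sub>R tsirelson_coord i)"
  have s: "strict_mono s" by (simp add: s_def strict_mono_def)
  have S: "finite S" "0 \<in> S" using finite_vimage_keys[OF s] True by (auto simp: S_def s_def)
  have "norm (tsirelson_unit 0) \<le> 1"
  proof -
    have "tsirelson_norm (Poly_Mapping.single 0 1) \<le> 1"
      using tsirelson_norm_single_le .
    then show ?thesis
      by (simp add: tsirelson_unit_def norm_tsirelson_c00.rep_eq Abs_tsirelson_c00_inverse)
  qed
  then have "norm (blinfun_apply f (tsirelson_unit 0)) \<le> norm f"
    using norm_blinfun[of f "tsirelson_unit 0"] mult_left_mono[of "norm (tsirelson_unit 0)" 1 "norm f"]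
    by simp
  moreover have "blinfun_apply f (tsirelson_unit 0) = Poly_Mapping.lookup a n"
    using S by (simp add: f_def blinfun.sum_left blinfun.scaleR_left tsirelson_coord_unit s_def
        if_distrib sum.delta cong: if_cong)
  moreover have "norm f \<le> su_norm a"
    using su_sum_le_su_norm[OF s, of a] by (simp add: f_def S_def)
  ultimately show ?thesis by simp
next
  case False
  have "strict_mono (\<lambda>n :: nat. n)" by (simp add: strict_mono_def)
  from order_trans[OF norm_ge_zero su_sum_le_su_norm[OF this]] False
  show ?thesis by (simp add: in_keys_iff)
qed

lemma is_norm_su_norm: "is_norm su_norm"
  unfolding is_norm_def
proof (intro conjI allI)
  fix a b :: "nat \<Rightarrow>\<^sub>0 real" and c :: real
  let ?f = "\<lambda>s a. \<Sum>i\<in>{i. s i \<in> Poly_Mapping.keys a}. Poly_Mapping.lookup a (s i) *\<^sub>R tsirelson_coord i"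
  have zero: "su_norm 0 = 0"
    using lookup_le_su_norm[of 0 0] by (intro antisym su_norm_least) simp_all
  show "su_norm a = 0 \<longleftrightarrow> a = 0"
  proof
    assume "su_norm a = 0"
    then show "a = 0" using lookup_le_su_norm[of a] by (intro poly_mapping_eqI) simp
  qed (simp add: zero)
  show "su_norm (a + b) \<le> su_norm a + su_norm b"
  proof (rule su_norm_least)
    fix s :: "nat \<Rightarrow> nat" assume s: "strict_mono s"
    define A where "A = {i. s i \<in> Poly_Mapping.keys a} \<union> {i. s i \<in> Poly_Mapping.keys b}"
    have A: "finite A"
      using finite_vimage_keys[OF s, of a] finite_vimage_keys[OF s, of b] by (simp add: A_def)
    have sub: "{i. s i \<in> Poly_Mapping.keys a} \<subseteq> A" "{i. s i \<in> Poly_Mapping.keys b} \<subseteq> A"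
      "{i. s i \<in> Poly_Mapping.keys (a + b)} \<subseteq> A"
      using Poly_Mapping.keys_add[of a b] by (auto simp: A_def)
    have "?f s (a + b) = ?f s a + ?f s b"
      unfolding su_sum_superset[where s = s, OF A sub(1)] su_sum_superset[where s = s, OF A sub(2)]
        su_sum_superset[where s = s, OF A sub(3)]
      by (simp add: lookup_add scaleR_add_left sum.distrib)
    then have "norm (?f s (a + b)) \<le> norm (?f s a) + norm (?f s b)"
      by (simp add: norm_triangle_ineq)
    also have "\<dots> \<le> su_norm a + su_norm b"
      by (intro add_mono su_sum_le_su_norm s)
    finally show "norm (?f s (a + b)) \<le> su_norm a + su_norm b" .
  qed
  have le: "su_norm (c *\<^sub>R a) \<le> \<bar>c\<bar> * su_norm a" for c a
  proof (rule su_norm_least)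
    fix s :: "nat \<Rightarrow> nat" assume s: "strict_mono s"
    have sub: "{i. s i \<in> Poly_Mapping.keys (c *\<^sub>R a)} \<subseteq> {i. s i \<in> Poly_Mapping.keys a}"
      by (auto simp: in_keys_iff lookup_scaleR_c00)
    have "?f s (c *\<^sub>R a) = c *\<^sub>R ?f s a"
      unfolding su_sum_superset[where s = s, OF finite_vimage_keys[OF s] sub]
      by (simp add: lookup_scaleR_c00 scaleR_sum_right)
    then have "norm (?f s (c *\<^sub>R a)) = \<bar>c\<bar> * norm (?f s a)" by simp
    also have "\<dots> \<le> \<bar>c\<bar> * su_norm a"
      by (intro mult_left_mono su_sum_le_su_norm s) simp
    finally show "norm (?f s (c *\<^sub>R a)) \<le> \<bar>c\<bar> * su_norm a" .
  qed
  show "su_norm (c *\<^sub>R a) = \<bar>c\<bar> * su_norm a"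
  proof (cases "c = 0")
    case True
    then show ?thesis by (simp add: zero)
  next
    case False
    then show ?thesis using le[of c a] le[of "inverse c" "c *\<^sub>R a"]
      by (simp add: field_simps)
  qed
qed

text \<open>A copy of $c_{00}$ that carries this norm.\<close>

typedef su_tsirelson_dual_c00 = "UNIV :: (nat \<Rightarrow>\<^sub>0 real) set" ..

setup_lifting type_definition_su_tsirelson_dual_c00

instantiation su_tsirelson_dual_c00 :: real_normed_vector
begin

lift_definition zero_su_tsirelson_dual_c00 :: su_tsirelson_dual_c00 is 0 .
lift_definition plus_su_tsirelson_dual_c00 :: "su_tsirelson_dual_c00 \<Rightarrow> su_tsirelson_dual_c00 \<Rightarrow> su_tsirelson_dual_c00" is "(+)" .
lift_definition minus_su_tsirelson_dual_c00 :: "su_tsirelson_dual_c00 \<Rightarrow> su_tsirelson_dual_c00 \<Rightarrow> su_tsirelson_dual_c00" is "(-)" .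
lift_definition uminus_su_tsirelson_dual_c00 :: "su_tsirelson_dual_c00 \<Rightarrow> su_tsirelson_dual_c00" is uminus .
lift_definition scaleR_su_tsirelson_dual_c00 :: "real \<Rightarrow> su_tsirelson_dual_c00 \<Rightarrow> su_tsirelson_dual_c00" is scaleR .
lift_definition norm_su_tsirelson_dual_c00 :: "su_tsirelson_dual_c00 \<Rightarrow> real" is su_norm .

definition sgn_su_tsirelson_dual_c00 :: "su_tsirelson_dual_c00 \<Rightarrow> su_tsirelson_dual_c00" where
  "sgn_su_tsirelson_dual_c00 x = scaleR (inverse (norm x)) x"

definition dist_su_tsirelson_dual_c00 :: "su_tsirelson_dual_c00 \<Rightarrow> su_tsirelson_dual_c00 \<Rightarrow> real" where
  "dist_su_tsirelson_dual_c00 x y = norm (x - y)"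

definition uniformity_su_tsirelson_dual_c00 :: "(su_tsirelson_dual_c00 \<times> su_tsirelson_dual_c00) filter" where
  "uniformity_su_tsirelson_dual_c00 = (INF e\<in>{0<..}. principal {(x, y). dist x y < e})"

definition open_su_tsirelson_dual_c00 :: "su_tsirelson_dual_c00 set \<Rightarrow> bool" where
  "open_su_tsirelson_dual_c00 U \<longleftrightarrow> (\<forall>x\<in>U. \<forall>\<^sub>F (x', y) in uniformity. x' = x \<longrightarrow> y \<in> U)"

instance
proof
  fix x y z :: su_tsirelson_dual_c00 and a b :: real
  show "x + y + z = x + (y + z)" by transfer (rule add.assoc)
  show "x + y = y + x" by transfer (rule add.commute)
  show "0 + x = x" by transfer simp
  show "- x + x = 0" by transfer simp
  show "x - y = x + - y" by transfer simp
  show "a *\<^sub>R (x + y) = a *\<^sub>R x + a *\<^sub>R y" by transfer (rule scaleR_add_right)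
  show "(a + b) *\<^sub>R x = a *\<^sub>R x + b *\<^sub>R x" by transfer (rule scaleR_add_left)
  show "a *\<^sub>R b *\<^sub>R x = (a * b) *\<^sub>R x" by transfer simp
  show "1 *\<^sub>R x = x" by transfer simp
  show "dist x y = norm (x - y)" by (rule dist_su_tsirelson_dual_c00_def)
  show "sgn x = scaleR (inverse (norm x)) x" by (rule sgn_su_tsirelson_dual_c00_def)
  show "uniformity = (INF e\<in>{0<..}. principal {(x, y::su_tsirelson_dual_c00). dist x y < e})"
    by (rule uniformity_su_tsirelson_dual_c00_def)
  show "open U \<longleftrightarrow> (\<forall>x\<in>U. \<forall>\<^sub>F (x', y) in uniformity. x' = x \<longrightarrow> y \<in> U)"
    for U :: "su_tsirelson_dual_c00 set"
    by (rule open_su_tsirelson_dual_c00_def)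
  show "norm x = 0 \<longleftrightarrow> x = 0"
    by transfer (use is_norm_su_norm in \<open>simp add: is_norm_def\<close>)
  show "norm (x + y) \<le> norm x + norm y"
    by transfer (use is_norm_su_norm in \<open>simp add: is_norm_def\<close>)
  show "norm (a *\<^sub>R x) = \<bar>a\<bar> * norm x"
    by transfer (use is_norm_su_norm in \<open>simp add: is_norm_def\<close>)
qed

end

text \<open>This is $Su(T^*)$, not the dual of a space $Su(T)$.\<close>

type_synonym su_tsirelson_dual = "su_tsirelson_dual_c00 completion"

end

theory Submission
  imports Defs "HOL-Library.Diagonal_Subsequence"
begin

text \<open>
  Write $X = Su(T^*)$.  The norm of $X$ looks at the order of the coordinates, and this is what a
  symmetric sequence in $X^*$ cannot survive.  Two estimates pull in opposite directions.

  The first one is of $c_0$ type.  In $T^*$, a sum of $n$ successive vectors of norm at most 1 that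
  live to the right of $n$ has norm at most 2.  The norm of $X$ first moves a vector to the left,
  dropping coordinates, and then measures it in $T^*$.  Let $z_1 < \dots < z_n$ be vectors of norm at
  most 1 in $X$ which are flat, the flattest first.  If few coordinates of $z_i$ survive the move, then
  what is left of $z_i$ is negligible; if many survive, they push all later vectors far to the right.
  Hence $\|z_1 + \dots + z_n\| \le 4$ for every $n$ (\<open>su_norm_flat_sum_le\<close>).  By duality, flat
  functionals in $X^*$, the flattest first, satisfy a lower $\ell_1$ estimate that does not
  depend on their number.

  The second one holds when the flattest comes last.  If $w_1 < w_2 < \dots$ are functionals and each
  is much flatter than the support of its predecessors is long, then the part of a vector that is
  normed by $w_k$ can be moved to the left without leaving the $k$-th interval, so that moves for the
  different $k$ fit together.  Thus combinations of the $w_k$ are controlled by combinations of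
  successive blocks in $T$, and $T$ has no block sequence like the basis of $\ell_1$: there are convex
  weights that make every weighted sum of blocks in given intervals small
  (\<open>tsirelson_blocks_average_small\<close>).

  Now let $(u_j)$ be successive functionals in $X^*$, bounded below, that are symmetric with
  constant $K$.  Normalized sums of more and more of the $u_j$ are such functionals $w_k$, because the
  norms of these sums tend to infinity (\<open>block_sums_unbounded\<close>).  Reversing the order of the
  $u_j$ costs a factor $K$ and puts the flattest first instead of last, so $(w_k)$ satisfies a
  lower $\ell_1$ estimate (\<open>lower_l1_estimate\<close>), against the second estimate
  (\<open>no_symmetric_blocks\<close>).

  It remains to find such $(u_j)$ from a symmetric basic sequence.  A gliding hump makes the
  equivalence with all permutations uniform (\<open>symmetric_basic_sequence_uniform\<close>); differences of a
  subsequence tend to 0 in every coordinate; and tails of functionals on $X$ are small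
  (\<open>functional_tail_small\<close>), so a subsequence of the differences is close to a sequence of blocks.
\<close>


section \<open>The basis constant\<close>

text \<open>
  Baire's theorem inside a complete subset of a metric space.
\<close>

lemma complete_nat_cover_somewhere_dense:
  fixes Z :: "'a::metric_space set"
  assumes Z: "complete Z" "Z \<noteq> {}" and cover: "Z \<subseteq> (\<Union>m::nat. A m)"
  shows "\<exists>m y r. y \<in> Z \<and> r > 0 \<and> Z \<inter> ball y r \<subseteq> closure (A m)"
proof (rule ccontr)
  assume neg: "\<not> ?thesis"
  interpret S: Submetric UNIV dist Z
    by (simp add: Met_TC.Metric_space_axioms Submetric.intro Submetric_axioms.intro)
  have top: "S.sub.mtopology = top_of_set Z"
    by (simp add: S.mtopology_submetric)
  have "S.sub.mcomplete"
    unfolding S.sub.mcomplete_def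
  proof (intro allI impI)
    fix X assume "S.sub.MCauchy X"
    then have "Cauchy X" "\<And>n. X n \<in> Z"
      by (auto simp: S.sub.MCauchy_def Cauchy_def image_subset_iff)
    then obtain l where "l \<in> Z" "X \<longlonglongrightarrow> l" using Z(1) unfolding complete_def by blast
    then show "\<exists>l. limitin S.sub.mtopology X l sequentially"
      using \<open>\<And>n. X n \<in> Z\<close> by (auto simp: top limitin_subtopology)
  qed
  moreover have "closedin S.sub.mtopology T \<and> S.sub.mtopology interior_of T = {}"
    if "T \<in> range (\<lambda>m. Z \<inter> closure (A m))" for T
  proof -
    obtain m where m: "T = Z \<inter> closure (A m)" using \<open>T \<in> _\<close> by blast
    have "S.sub.mtopology interior_of T = {}"
    proof (rule ccontr)
      assume "S.sub.mtopology interior_of T \<noteq> {}"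
      then obtain y where y: "y \<in> S.sub.mtopology interior_of T" by blast
      then obtain r where r: "r > 0" "S.sub.mball y r \<subseteq> S.sub.mtopology interior_of T"
        using S.sub.openin_mtopology openin_interior_of by metis
      have "y \<in> Z" using y interior_of_subset[of S.sub.mtopology T] m by blast
      moreover have "Z \<inter> ball y r \<subseteq> closure (A m)"
      proof
        fix z assume "z \<in> Z \<inter> ball y r"
        then have "z \<in> S.sub.mball y r" using \<open>y \<in> Z\<close> by (simp add: S.sub.mball_def)
        then show "z \<in> closure (A m)"
          using r(2) interior_of_subset[of S.sub.mtopology T] m by blast
      qed
      ultimately show False using neg r(1) by blast
    qed
    then show ?thesis using m by (simp add: top closedin_closed_Int)
  qed
  ultimately have "S.sub.mtopology interior_of \<Union>(range (\<lambda>m. Z \<inter> closure (A m))) = {}"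
    by (intro S.sub.metric_Baire_category_alt) auto
  moreover have "\<Union>(range (\<lambda>m. Z \<inter> closure (A m))) = Z"
  proof
    show "Z \<subseteq> \<Union>(range (\<lambda>m. Z \<inter> closure (A m)))"
    proof
      fix z assume z: "z \<in> Z"
      then obtain m where "z \<in> A m" using cover by blast
      then have "z \<in> closure (A m)" using closure_subset by blast
      then show "z \<in> \<Union>(range (\<lambda>m. Z \<inter> closure (A m)))" using z by blast
    qed
  qed blast
  ultimately have "S.sub.mtopology interior_of Z = {}" by simp
  then show False using Z(2) by (metis interior_of_topspace S.sub.topspace_mtopology)
qed

text \<open>
  With a basic sequence \<open>x\<close> the expansion is unique, and the least such \<open>B\<close> is the supremum of the norms of
  the partial sums of the expansion of \<open>y\<close>: the norm that makes the coordinates continuous.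
\<close>

definition expansion_bound :: "(nat \<Rightarrow> 'a::real_normed_vector) \<Rightarrow> 'a \<Rightarrow> real \<Rightarrow> bool" where
  "expansion_bound x y B \<longleftrightarrow>
     (\<exists>a. (\<lambda>j. a j *\<^sub>R x j) sums y \<and> (\<forall>n. norm (\<Sum>j<n. a j *\<^sub>R x j) \<le> B))"

lemma expansion_bound_add:
  assumes "expansion_bound x y B" "expansion_bound x z C"
  shows "expansion_bound x (y + z) (B + C)"
proof -
  obtain a b where ab: "(\<lambda>j. a j *\<^sub>R x j) sums y" "(\<lambda>j. b j *\<^sub>R x j) sums z"
    "\<And>n. norm (\<Sum>j<n. a j *\<^sub>R x j) \<le> B" "\<And>n. norm (\<Sum>j<n. b j *\<^sub>R x j) \<le> C"
    using assms unfolding expansion_bound_def by blast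
  have "(\<lambda>j. (a j + b j) *\<^sub>R x j) sums (y + z)"
    using sums_add[OF ab(1,2)] by (simp add: scaleR_add_left)
  moreover have "norm (\<Sum>j<n. (a j + b j) *\<^sub>R x j) \<le> B + C" for n
    using ab(3)[of n] ab(4)[of n] norm_triangle_ineq[of "\<Sum>j<n. a j *\<^sub>R x j" "\<Sum>j<n. b j *\<^sub>R x j"]
    by (simp add: scaleR_add_left sum.distrib)
  ultimately show ?thesis unfolding expansion_bound_def by (intro exI[of _ "\<lambda>j. a j + b j"]) blast
qed

lemma expansion_bound_scaleR:
  assumes "expansion_bound x y B"
  shows "expansion_bound x (c *\<^sub>R y) (\<bar>c\<bar> * B)"
proof -
  obtain a where a: "(\<lambda>j. a j *\<^sub>R x j) sums y" "\<And>n. norm (\<Sum>j<n. a j *\<^sub>R x j) \<le> B"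
    using assms unfolding expansion_bound_def by blast
  have eq: "(\<Sum>j<n. (c * a j) *\<^sub>R x j) = c *\<^sub>R (\<Sum>j<n. a j *\<^sub>R x j)" for n
    by (simp add: scaleR_sum_right)
  have "(\<lambda>j. (c * a j) *\<^sub>R x j) sums (c *\<^sub>R y)"
    using sums_scaleR_right[OF a(1)] by (simp)
  moreover have "norm (\<Sum>j<n. (c * a j) *\<^sub>R x j) \<le> \<bar>c\<bar> * B" for n
    unfolding eq using a(2)[of n] by (simp add: mult_left_mono)
  ultimately show ?thesis unfolding expansion_bound_def by (intro exI[of _ "\<lambda>j. c * a j"]) blast
qed

text \<open>
  The geometric bounds make the coefficients of \<open>y k\<close> summable over \<open>k\<close>, and the partial sums of the
  resulting expansion converge uniformly, which is what lets the two limits be exchanged.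
\<close>

lemma expansion_bound_suminf:
  fixes x :: "nat \<Rightarrow> 'a::banach"
  assumes nz: "\<And>j. x j \<noteq> 0"
    and y: "\<And>k. expansion_bound x (y k) (B * (1/2) ^ k)" and z: "y sums z"
  shows "expansion_bound x z (2 * B)"
proof -
  obtain a where a: "\<And>k. (\<lambda>j. a k j *\<^sub>R x j) sums y k"
      "\<And>k n. norm (\<Sum>j<n. a k j *\<^sub>R x j) \<le> B * (1/2) ^ k"
    using y unfolding expansion_bound_def by metis
  define P where "P k n = (\<Sum>j<n. a k j *\<^sub>R x j)" for k n
  have P: "norm (P k n) \<le> B * (1/2) ^ k" "P k \<longlonglongrightarrow> y k" for k n
    using a(2) a(1)[unfolded sums_def] by (auto simp: P_def[abs_def])
  have geo: "(\<lambda>k. B * (1/2) ^ k) sums (2 * B)"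
    using sums_mult[OF geometric_sums[of "1/2::real"], of B] by (simp add: mult.commute)
  have sP: "summable (\<lambda>k. P k n)" for n
    by (rule summable_comparison_test'[OF sums_summable[OF geo]]) (use P(1) in auto)
  have sa: "summable (\<lambda>k. a k j)" for j
  proof -
    have "a k j *\<^sub>R x j = P k (Suc j) - P k j" for k by (simp add: P_def)
    then have "norm (a k j *\<^sub>R x j) \<le> 2 * (B * (1/2) ^ k)" for k
      using P(1)[of k "Suc j"] P(1)[of k j] norm_triangle_ineq4[of "P k (Suc j)" "P k j"] by auto
    then have "\<bar>a k j\<bar> * norm (x j) \<le> 2 * (B * (1/2) ^ k)" for k by simp
    then have "norm (a k j) \<le> 2 / norm (x j) * (B * (1/2) ^ k)" for k
      using nz[of j] by (simp add: field_simps)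
    then show ?thesis
      by (intro summable_comparison_test'[OF summable_mult[OF sums_summable[OF geo],
              of "2 / norm (x j)"], of 0])
  qed
  have eq: "(\<Sum>j<n. (suminf (\<lambda>k. a k j)) *\<^sub>R x j) = (suminf (\<lambda>k. P k n))" for n
  proof -
    have "(\<Sum>j<n. (suminf (\<lambda>k. a k j)) *\<^sub>R x j) = (\<Sum>j<n. suminf (\<lambda>k. a k j *\<^sub>R x j))"
      by (intro sum.cong refl suminf_scaleR_left sa)
    also have "\<dots> = (suminf (\<lambda>k. \<Sum>j<n. a k j *\<^sub>R x j))"
      by (rule suminf_sum[symmetric]) (rule summable_scaleR_left[OF sa])
    finally show ?thesis by (simp add: P_def)
  qed
  have le: "norm (suminf (\<lambda>k. P k n)) \<le> 2 * B" for n
  proof -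
    have "norm (suminf (\<lambda>k. P k n)) \<le> suminf (\<lambda>k. B * (1/2) ^ k)"
      by (rule norm_suminf_le[OF P(1) sums_summable[OF geo]])
    then show ?thesis using sums_unique[OF geo] by simp
  qed
  have lim: "(\<lambda>n. suminf (\<lambda>k. P k n)) \<longlonglongrightarrow> (suminf (\<lambda>k. y k))"
  proof (rule swap_uniform_limit'[where F = sequentially and f = "\<lambda>K n. \<Sum>k<K. P k n" and g = "\<lambda>K. \<Sum>k<K. y k" and S = UNIV])
    show "\<forall>\<^sub>F K in sequentially. (\<lambda>n. \<Sum>k<K. P k n) \<longlonglongrightarrow> (\<Sum>k<K. y k)"
      by (intro always_eventually allI tendsto_sum P)
    show "(\<lambda>K. \<Sum>k<K. y k) \<longlonglongrightarrow> (suminf (\<lambda>k. y k))"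
      using z sums_unique[OF z] by (simp add: sums_def)
    show "uniform_limit UNIV (\<lambda>K n. \<Sum>k<K. P k n) (\<lambda>n. suminf (\<lambda>k. P k n)) sequentially"
      by (rule Weierstrass_m_test[OF P(1) sums_summable[OF geo]])
  qed auto
  have "(\<lambda>j. (suminf (\<lambda>k. a k j)) *\<^sub>R x j) sums z"
    using lim sums_unique[OF z] by (simp add: sums_def eq)
  then show ?thesis unfolding expansion_bound_def
    by (intro exI[of _ "\<lambda>j. suminf (\<lambda>k. a k j)"]) (simp add: eq le)
qed

lemma subspace_closure:
  fixes S :: "'a::real_normed_vector set"
  assumes S: "subspace S"
  shows "subspace (closure S)"
  unfolding subspace_def
proof (intro conjI ballI allI)
  show "0 \<in> closure S" using closure_subset subspace_0[OF S] by blast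
  fix x assume "x \<in> closure S"
  then obtain X where X: "\<And>n. X n \<in> S" "X \<longlonglongrightarrow> x" unfolding closure_sequential by blast
  show "c *\<^sub>R x \<in> closure S" for c
    unfolding closure_sequential
    by (intro exI[of _ "\<lambda>n. c *\<^sub>R X n"] conjI allI subspace_scale S X tendsto_intros)
  fix y assume "y \<in> closure S"
  then obtain Y where Y: "\<And>n. Y n \<in> S" "Y \<longlonglongrightarrow> y" unfolding closure_sequential by blast
  show "x + y \<in> closure S"
    unfolding closure_sequential
    by (intro exI[of _ "\<lambda>n. X n + Y n"] conjI allI subspace_add S X Y tendsto_intros)
qed

lemma expansion_bound_mono: "expansion_bound x y B \<Longrightarrow> B \<le> C \<Longrightarrow> expansion_bound x y C"
  unfolding expansion_bound_def by (meson order_trans)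

lemma expansion_in_closed_span:
  fixes x :: "nat \<Rightarrow> 'a::real_normed_vector"
  assumes "(\<lambda>j. a j *\<^sub>R x j) sums y"
  shows "y \<in> closure (span (range x))"
proof -
  have "(\<Sum>j<n. a j *\<^sub>R x j) \<in> span (range x)" for n
    by (intro span_sum span_scale span_base) auto
  then show ?thesis using assms unfolding sums_def closure_sequential
    by (intro exI[of _ "\<lambda>n. \<Sum>j<n. a j *\<^sub>R x j"]) simp
qed

text \<open>
  The open mapping argument: the vectors with an expansion bounded by \<open>m\<close> form symmetric convex sets
  that exhaust the closed span, so one of them is dense in a ball, after translation in a ball
  around 0.  Every vector is then approximated up to half its norm by one whose expansion is bounded by a
  multiple of that norm, and iterating this sums to the vector itself.
\<close>

lemma basic_sequence_expansions_bounded: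
  fixes x :: "nat \<Rightarrow> 'a::banach"
  assumes x: "basic_sequence x" and nz: "\<And>j. x j \<noteq> 0"
  shows "\<exists>L. \<forall>z \<in> closure (span (range x)). expansion_bound x z (L * norm z)"
proof -
  define Z where "Z = closure (span (range x))"
  define A where "A m = {y. expansion_bound x y (real m)}" for m :: nat
  have Zsub: "subspace Z" unfolding Z_def by (intro subspace_closure subspace_span)
  have cover: "Z \<subseteq> (\<Union>m. A m)"
  proof
    fix y assume "y \<in> Z"
    then obtain a where a: "(\<lambda>j. a j *\<^sub>R x j) sums y"
      using x unfolding basic_sequence_def Z_def by blast
    then have "Bseq (\<lambda>n. \<Sum>j<n. a j *\<^sub>R x j)"
      unfolding sums_def by (meson convergentI convergent_imp_Bseq)
    then obtain K where "\<And>n. norm (\<Sum>j<n. a j *\<^sub>R x j) \<le> K" unfolding Bseq_def by blast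
    moreover obtain m :: nat where "K \<le> real m" using real_arch_simple by blast
    ultimately have "y \<in> A m"
      using a unfolding A_def expansion_bound_def by (auto intro: order_trans)
    then show "y \<in> (\<Union>m. A m)" by blast
  qed
  have "complete Z" "Z \<noteq> {}"
    using subspace_0[OF Zsub] by (auto simp: Z_def complete_eq_closed)
  then obtain m y0 r where m: "y0 \<in> Z" "r > 0" "Z \<inter> ball y0 r \<subseteq> closure (A m)"
    using complete_nat_cover_somewhere_dense[OF _ _ cover] by metis
  define L where "L = 2 * real m / r"
  have approx: "\<exists>y. expansion_bound x y (L * norm z) \<and> norm (z - y) \<le> norm z / 2" if z: "z \<in> Z" for z
  proof (cases "z = 0")
    case True
    have "expansion_bound x 0 0" unfolding expansion_bound_def by (intro exI[of _ "\<lambda>_. 0"]) simp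
    then show ?thesis using True by (intro exI[of _ 0]) simp
  next
    case False
    \<comment> \<open>\<open>t *\<^sub>R z\<close> has norm \<open>r / 2\<close>, so \<open>y0 + t *\<^sub>R z\<close> and \<open>y0 - t *\<^sub>R z\<close> lie in the ball; half of their difference recovers \<open>t *\<^sub>R z\<close>.\<close>
    define t where "t = r / (2 * norm z)"
    have t: "t > 0" using False m(2) by (simp add: t_def)
    have tz: "norm (t *\<^sub>R z) = r / 2" using False t m(2) by (simp add: t_def)
    have in_Z: "y0 + t *\<^sub>R z \<in> Z" "y0 - t *\<^sub>R z \<in> Z"
      using m(1) z Zsub by (auto intro!: subspace_add subspace_diff subspace_scale)
    have cl: "y0 + t *\<^sub>R z \<in> closure (A m)" "y0 - t *\<^sub>R z \<in> closure (A m)"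
      using in_Z m(3) tz m(2) by (auto simp: dist_norm subset_iff)
    have e: "r / 4 > 0" using m(2) by simp
    obtain u where u: "u \<in> A m" "norm (u - (y0 + t *\<^sub>R z)) < r / 4"
      using closure_approachableD[OF cl(1) e] by (metis dist_norm dist_commute)
    obtain v where v: "v \<in> A m" "norm (v - (y0 - t *\<^sub>R z)) < r / 4"
      using closure_approachableD[OF cl(2) e] by (metis dist_norm dist_commute)
    define y where "y = (1 / (2 * t)) *\<^sub>R (u + (- 1) *\<^sub>R v)"
    have "expansion_bound x (u + (- 1) *\<^sub>R v) (real m + \<bar>- 1\<bar> * real m)"
      using u(1) v(1) unfolding A_def by (intro expansion_bound_add expansion_bound_scaleR) auto
    then have "expansion_bound x y (\<bar>1 / (2 * t)\<bar> * (real m + \<bar>- 1\<bar> * real m))"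
      unfolding y_def by (rule expansion_bound_scaleR)
    moreover have "\<bar>1 / (2 * t)\<bar> * (real m + \<bar>- 1\<bar> * real m) = L * norm z"
      using t False m(2) by (simp add: t_def L_def field_simps)
    moreover have "norm (z - y) \<le> norm z / 2"
    proof -
      have "(2 * t) *\<^sub>R (z - y) = (v - (y0 - t *\<^sub>R z)) - (u - (y0 + t *\<^sub>R z))"
        using t by (simp add: y_def algebra_simps) (simp add: scaleR_2[symmetric])
      then have "norm ((2 * t) *\<^sub>R (z - y)) \<le> r / 2"
        using norm_triangle_ineq4[of "v - (y0 - t *\<^sub>R z)" "u - (y0 + t *\<^sub>R z)"] u(2) v(2) by simp
      then have "2 * t * norm (z - y) \<le> r / 2" using t by simp
      then show ?thesis using t False m(2) by (simp add: t_def field_simps)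
    qed
    ultimately show ?thesis by auto
  qed
  then obtain f where f: "\<And>z. z \<in> Z \<Longrightarrow> expansion_bound x (f z) (L * norm z)"
      "\<And>z. z \<in> Z \<Longrightarrow> norm (z - f z) \<le> norm z / 2"
    by metis
  have fZ: "f z \<in> Z" if "z \<in> Z" for z
    using f(1)[OF that] expansion_in_closed_span unfolding expansion_bound_def Z_def by blast
  have "L \<ge> 0" using m(2) by (simp add: L_def)
  have "expansion_bound x z (2 * (L * norm z))" if z: "z \<in> Z" for z
  proof (rule expansion_bound_suminf[OF nz])
    \<comment> \<open>The remainder after \<open>k\<close> approximations; the terms \<open>f (R k)\<close> telescope to \<open>z\<close>.\<close>
    define R where "R k = ((\<lambda>z. z - f z) ^^ k) z" for k
    have RZ: "R k \<in> Z" for k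
      by (induction k) (use z fZ Zsub in \<open>auto simp: R_def intro: subspace_diff\<close>)
    have Rn: "norm (R k) \<le> norm z * (1/2) ^ k" for k
    proof (induction k)
      case (Suc k)
      have "R (Suc k) = R k - f (R k)" by (simp add: R_def)
      then show ?case using f(2)[OF RZ[of k]] Suc by simp
    qed (simp add: R_def)
    show "expansion_bound x (f (R k)) (L * norm z * (1/2) ^ k)" for k
      by (rule expansion_bound_mono[OF f(1)[OF RZ]])
        (use mult_left_mono[OF Rn[of k] \<open>L \<ge> 0\<close>] in \<open>simp add: mult.assoc\<close>)
    have "(\<lambda>k. norm z * (1/2) ^ k) \<longlonglongrightarrow> norm z * 0"
      by (intro tendsto_mult tendsto_const LIMSEQ_power_zero) simp
    then have "(\<lambda>k. norm z * (1/2) ^ k) \<longlonglongrightarrow> 0" by (simp only: mult_zero_right)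
    then have "R \<longlonglongrightarrow> 0"
      by (rule Lim_null_comparison[OF always_eventually[OF allI[OF Rn]]])
    then have "(\<lambda>k. R k - R (Suc k)) sums (R 0 - 0)" by (rule telescope_sums')
    moreover have "R k - R (Suc k) = f (R k)" "R 0 = z" for k by (simp_all add: R_def)
    ultimately show "(\<lambda>k. f (R k)) sums z" by simp
  qed
  then show ?thesis unfolding Z_def by (intro exI[of _ "2 * L"]) (simp add: mult.assoc)
qed

lemma basic_sequence_expansion_unique:
  fixes x :: "nat \<Rightarrow> 'a::real_normed_vector"
  assumes "basic_sequence x" "(\<lambda>j. a j *\<^sub>R x j) sums y" "(\<lambda>j. b j *\<^sub>R x j) sums y"
  shows "a = b"
proof -
  define Q where "Q a \<longleftrightarrow> (\<lambda>j. a j *\<^sub>R x j) sums y" for a :: "nat \<Rightarrow> real"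
  have "\<exists>!a. Q a"
    using assms(1) expansion_in_closed_span[OF assms(2)] unfolding basic_sequence_def Q_def by simp
  moreover have "Q a" "Q b" using assms(2,3) by (simp_all add: Q_def)
  ultimately show ?thesis by blast
qed

lemma basic_sequence_nonzero:
  fixes x :: "nat \<Rightarrow> 'a::real_normed_vector"
  assumes "basic_sequence x"
  shows "x j \<noteq> 0"
proof
  assume j: "x j = 0"
  have "(\<lambda>i. (if i = j then 1 else 0) *\<^sub>R x i) = (\<lambda>_. 0)" using j by auto
  then have "(\<lambda>i. (if i = j then 1 else 0) *\<^sub>R x i) sums 0" by simp
  moreover have "(\<lambda>i. (0::real) *\<^sub>R x i) sums 0" by simp
  ultimately have "(\<lambda>i. if i = j then 1 else 0 :: real) = (\<lambda>i. 0)"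
    by (rule basic_sequence_expansion_unique[OF assms])
  then show False by (metis zero_neq_one)
qed

text \<open>
  Banach's theorem that a basis has a finite basis constant.
\<close>

theorem basic_sequence_basis_constant:
  fixes x :: "nat \<Rightarrow> 'a::banach"
  assumes x: "basic_sequence x"
  shows "\<exists>C. \<forall>a m n. m \<le> n \<longrightarrow> norm (\<Sum>j<m. a j *\<^sub>R x j) \<le> C * norm (\<Sum>j<n. a j *\<^sub>R x j)"
proof -
  obtain L where L: "\<And>z. z \<in> closure (span (range x)) \<Longrightarrow> expansion_bound x z (L * norm z)"
    using basic_sequence_expansions_bounded[OF x basic_sequence_nonzero[OF x]] by blast
  have "norm (\<Sum>j<m. a j *\<^sub>R x j) \<le> L * norm (\<Sum>j<n. a j *\<^sub>R x j)" if "m \<le> n" for a m n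
  proof -
    define z where "z = (\<Sum>j<n. a j *\<^sub>R x j)"
    have "(\<lambda>j. (if j < n then a j else 0) *\<^sub>R x j) sums (\<Sum>j<n. (if j < n then a j else 0) *\<^sub>R x j)"
      by (rule sums_finite) auto
    then have s: "(\<lambda>j. (if j < n then a j else 0) *\<^sub>R x j) sums z"
      by (simp add: z_def)
    have zZ: "z \<in> closure (span (range x))" by (rule expansion_in_closed_span[OF s])
    obtain b where b: "(\<lambda>j. b j *\<^sub>R x j) sums z" "\<And>k. norm (\<Sum>j<k. b j *\<^sub>R x j) \<le> L * norm z"
      using L[OF zZ] unfolding expansion_bound_def by blast
    have "b = (\<lambda>j. if j < n then a j else 0)"
      by (rule basic_sequence_expansion_unique[OF x b(1) s])
    then have "(\<Sum>j<m. b j *\<^sub>R x j) = (\<Sum>j<m. a j *\<^sub>R x j)"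
      using that by (intro sum.cong) auto
    then show ?thesis using b(2)[of m] by (simp add: z_def)
  qed
  then show ?thesis by blast
qed

section \<open>Uniform estimates for symmetric basic sequences\<close>

lemma strict_mono_block_unique:
  fixes M :: "nat \<Rightarrow> nat"
  assumes M: "strict_mono M" and k: "M k \<le> i" "i < M (Suc k)" and l: "M l \<le> i" "i < M (Suc l)"
  shows "k = l"
proof -
  have "M k < M (Suc l)" "M l < M (Suc k)" using k l by linarith+
  then have "k < Suc l" "l < Suc k" using strict_mono_less[OF M] by blast+
  then show "k = l" by simp
qed

lemma strict_mono_block_ex1:
  fixes M :: "nat \<Rightarrow> nat"
  assumes M: "strict_mono M" "M 0 = 0"
  shows "\<exists>!k. M k \<le> i \<and> i < M (Suc k)"
proof (rule ex_ex1I)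
  have "i \<le> M i" using M(1) by (rule strict_mono_imp_increasing)
  then have ex: "\<exists>k. i < M (Suc k)"
    using strict_monoD[OF M(1), of i "Suc i"] by (intro exI[of _ i]) simp
  define k where "k = (LEAST k. i < M (Suc k))"
  have "i < M (Suc k)" unfolding k_def by (rule LeastI_ex[OF ex])
  moreover have "M k \<le> i"
  proof (cases k)
    case (Suc j)
    then show ?thesis using not_less_Least[of j "\<lambda>k. i < M (Suc k)"] by (simp add: k_def)
  qed (simp add: M(2))
  ultimately show "\<exists>k. M k \<le> i \<and> i < M (Suc k)" by blast
qed (use strict_mono_block_unique[OF M(1)] in blast)

lemma inj_on_finite_extends_to_bij:
  assumes "finite A" "J \<subseteq> A" "s ` J \<subseteq> A" "inj_on s J"
  shows "\<exists>p. bij_betw p A A \<and> (\<forall>i\<in>J. p i = s i)"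
proof -
  have fin: "finite J" "finite (s ` J)" using assms finite_subset by blast+
  have "card (A - J) = card (A - s ` J)"
    using assms fin by (simp add: card_Diff_subset card_image)
  then obtain h where h: "bij_betw h (A - J) (A - s ` J)"
    using finite_same_card_bij[of "A - J" "A - s ` J"] assms(1) by blast
  define p where "p i = (if i \<in> J then s i else h i)" for i
  have "bij_betw p (J \<union> (A - J)) (s ` J \<union> (A - s ` J))"
  proof (rule bij_betw_combine)
    show "bij_betw p J (s ` J)"
      using assms(4) by (auto simp: bij_betw_def p_def inj_on_def)
    show "bij_betw p (A - J) (A - s ` J)"
      using h by (rule bij_betw_cong[THEN iffD1, rotated]) (simp add: p_def)
  qed auto
  moreover have "J \<union> (A - J) = A" "s ` J \<union> (A - s ` J) = A" using assms by auto
  ultimately show ?thesis by (intro exI[of _ p]) (simp add: p_def)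
qed

text \<open>
  The permutations that defeat an equivalence are built one finite interval at a time.
\<close>

lemma bij_from_blocks:
  fixes M :: "nat \<Rightarrow> nat"
  assumes M: "strict_mono M" "M 0 = 0"
    and q: "\<And>k. bij_betw (q k) {M k..<M (Suc k)} {M k..<M (Suc k)}"
  shows "\<exists>p. bij p \<and> (\<forall>k. \<forall>i\<in>{M k..<M (Suc k)}. p i = q k i)"
proof -
  define blk where "blk i = (THE k. M k \<le> i \<and> i < M (Suc k))" for i
  have blk: "blk i = k" if "i \<in> {M k..<M (Suc k)}" for i k
    unfolding blk_def using that by (intro the1_equality strict_mono_block_ex1 M) auto
  have inblk: "i \<in> {M (blk i)..<M (Suc (blk i))}" for i
    using theI'[OF strict_mono_block_ex1[OF M, of i]] by (simp add: blk_def)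
  define p where "p i = q (blk i) i" for i
  have p: "p i = q k i" if "i \<in> {M k..<M (Suc k)}" for i k
    using blk[OF that] by (simp add: p_def)
  have stay: "p i \<in> {M (blk i)..<M (Suc (blk i))}" for i
    using inblk[of i] q[of "blk i"] bij_betwE unfolding p_def by blast
  have "inj p"
  proof (rule injI)
    fix i j assume eq: "p i = p j"
    have "blk i = blk j" using blk[OF stay[of i]] blk[OF stay[of j]] eq by simp
    then show "i = j"
      using inblk[of i] inblk[of j] q[of "blk i"] eq unfolding p_def bij_betw_def inj_on_def by metis
  qed
  moreover have "surj p"
  proof (unfold surj_def, intro allI)
    fix j
    have "j \<in> q (blk j) ` {M (blk j)..<M (Suc (blk j))}"
      using inblk[of j] bij_betw_imp_surj_on[OF q[of "blk j"]] by simp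
    then obtain i where "i \<in> {M (blk j)..<M (Suc (blk j))}" "j = q (blk j) i"
      by (elim imageE)
    then show "\<exists>i. j = p i" using p[of i "blk j"] by auto
  qed
  ultimately show ?thesis using p by (intro exI[of _ p]) (simp add: bij_def)
qed

text \<open>
  The basis constant controls the partial sums that end inside a block, so smallness of the whole
  blocks is enough.
\<close>

lemma summable_geometric_blocks:
  fixes x :: "nat \<Rightarrow> 'a::banach"
  assumes C: "\<And>a m n. m \<le> n \<Longrightarrow> norm (\<Sum>j<m. a j *\<^sub>R x j) \<le> C * norm (\<Sum>j<n. a j *\<^sub>R x j)"
    and M: "strict_mono M" "M 0 = 0"
    and small: "\<And>k. norm (\<Sum>j\<in>{M k..<M (Suc k)}. b j *\<^sub>R x j) \<le> (1/2) ^ k"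
  shows "summable (\<lambda>j. b j *\<^sub>R x j)"
proof -
  define S where "S n = (\<Sum>j<n. b j *\<^sub>R x j)" for n
  have diff: "S n - S m = (\<Sum>j\<in>{m..<n}. b j *\<^sub>R x j)" if "m \<le> n" for m n
    using sum_diff_nat_ivl[of 0 m n "\<lambda>j. b j *\<^sub>R x j"] that by (simp add: S_def atLeast0LessThan)
  define C' where "C' = max C 0"
  have within: "norm (S n - S (M k)) \<le> C' * (1/2) ^ k" if "M k \<le> n" "n \<le> M (Suc k)" for n k
  proof -
    \<comment> \<open>The coefficients before the block are set to 0, so that the basis constant applies to the block alone.\<close>
    define a where "a j = (if j < M k then 0 else b j)" for j
    have eq: "(\<Sum>j<n'. a j *\<^sub>R x j) = (\<Sum>j\<in>{M k..<n'}. b j *\<^sub>R x j)" for n'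
      by (rule sum.mono_neutral_cong_right) (auto simp: a_def)
    have "norm (S n - S (M k)) \<le> C * norm (\<Sum>j\<in>{M k..<M (Suc k)}. b j *\<^sub>R x j)"
      using C[OF that(2), of a] that(1) unfolding eq by (simp add: diff)
    also have "\<dots> \<le> C' * norm (\<Sum>j\<in>{M k..<M (Suc k)}. b j *\<^sub>R x j)"
      by (intro mult_right_mono) (auto simp: C'_def)
    also have "\<dots> \<le> C' * (1/2) ^ k"
      by (intro mult_left_mono small) (simp add: C'_def)
    finally show ?thesis .
  qed
  have ends: "norm (S (M (k + l)) - S (M k)) \<le> 2 * (1/2) ^ k - 2 * (1/2) ^ (k + l)" for k l
  proof (induction l)
    case (Suc l)
    have "M (k + l) \<le> M (Suc (k + l))" using M(1) by (simp add: strict_mono_less_eq)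
    then have "norm (S (M (Suc (k + l))) - S (M (k + l))) \<le> (1/2) ^ (k + l)"
      using small[of "k + l"] by (simp add: diff)
    then show ?case
      using Suc norm_triangle_ineq[of "S (M (Suc (k + l))) - S (M (k + l))" "S (M (k + l)) - S (M k)"]
      by simp
  qed simp
  have tail: "norm (S n - S (M k)) \<le> (2 + C') * (1/2) ^ k" if "M k \<le> n" for n k
  proof -
    obtain j where j: "M j \<le> n" "n < M (Suc j)" using strict_mono_block_ex1[OF M, of n] by blast
    have "M k < M (Suc j)" using that j by simp
    then have "k \<le> j" using strict_mono_less[OF M(1), of k "Suc j"] by simp
    then obtain l where l: "j = k + l" by (metis le_add_diff_inverse)
    have "norm (S n - S (M j)) \<le> C' * (1/2) ^ j" using j by (intro within) auto
    also have "\<dots> \<le> C' * (1/2) ^ k"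
      using \<open>k \<le> j\<close> by (intro mult_left_mono power_decreasing) (auto simp: C'_def)
    finally have "norm (S n - S (M j)) \<le> C' * (1/2) ^ k" .
    moreover have "norm (S (M j) - S (M k)) \<le> 2 * (1/2) ^ k"
      using ends[of k l] l by (smt (verit) zero_le_power divide_nonneg_nonneg)
    ultimately show ?thesis
      using norm_triangle_ineq[of "S n - S (M j)" "S (M j) - S (M k)"] by (simp add: algebra_simps)
  qed
  have "Cauchy S"
  proof (rule CauchyI)
    fix e :: real assume "e > 0"
    then have "e / (2 * (2 + C')) > 0" by (simp add: C'_def)
    then obtain k where k: "(1/2::real) ^ k < e / (2 * (2 + C'))"
      using real_arch_pow_inv[of "e / (2 * (2 + C'))" "1/2"] by auto
    have *: "(2 + C') * (1/2) ^ k < e / 2"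
      using k by (simp add: C'_def field_simps)
    have "norm (S m - S n) < e" if "m \<ge> M k" "n \<ge> M k" for m n
      using tail[OF that(1)] tail[OF that(2)] * norm_triangle_ineq4[of "S m - S (M k)" "S n - S (M k)"]
      by simp
    then show "\<exists>N. \<forall>m\<ge>N. \<forall>n\<ge>N. norm (S m - S n) < e" by blast
  qed
  then show ?thesis unfolding summable_iff_convergent S_def[abs_def] by (rule Cauchy_convergent)
qed

text \<open>
  If no constant worked beyond any \<open>m\<close>, there would be combinations in disjoint successive intervals
  whose norms are at most \<open>(1/2) ^ k\<close>, and which some permutation of the interval makes at least 1.  These
  permutations together form one permutation of the natural numbers for which the series converges on
  one side only.  Dropping the first \<open>m\<close> terms is what allows the intervals to be disjoint.
\<close>

theorem symmetric_basic_sequence_uniform: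
  fixes x :: "nat \<Rightarrow> 'a::banach"
  assumes x: "symmetric_basic_sequence x"
  shows "\<exists>m K. \<forall>J s b. finite J \<and> J \<subseteq> {m..} \<and> inj_on s J \<and> s ` J \<subseteq> {m..} \<longrightarrow>
           norm (\<Sum>i\<in>J. b i *\<^sub>R x (s i)) \<le> K * norm (\<Sum>i\<in>J. b i *\<^sub>R x i)"
proof (rule ccontr)
  define Pr where "Pr m K \<longleftrightarrow> (\<forall>J s b. finite J \<and> J \<subseteq> {m..} \<and> inj_on s J \<and> s ` J \<subseteq> {m..} \<longrightarrow>
      norm (\<Sum>i\<in>J. b i *\<^sub>R x (s i)) \<le> K * norm (\<Sum>i\<in>J. b i *\<^sub>R x i))" for m K
  assume "\<not> ?thesis"
  then have neg: "\<not> (\<exists>m K. Pr m K)" unfolding Pr_def .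
  have basic: "basic_sequence x" using x by (simp add: symmetric_basic_sequence_def)
  obtain C where C: "\<And>a m n. m \<le> n \<Longrightarrow> norm (\<Sum>j<m. a j *\<^sub>R x j) \<le> C * norm (\<Sum>j<n. a j *\<^sub>R x j)"
    using basic_sequence_basis_constant[OF basic] by blast
  define G where "G m k m1 q b \<longleftrightarrow> m < m1 \<and> bij_betw q {m..<m1} {m..<m1} \<and>
      1 \<le> norm (\<Sum>i\<in>{m..<m1}. b i *\<^sub>R x (q i)) \<and>
      norm (\<Sum>i\<in>{m..<m1}. b i *\<^sub>R x i) \<le> (1/2) ^ k" for m k m1 q b
  have "\<exists>m' q b. G m k m' q b" for m k
  proof -
    obtain J s b where J: "finite J" "J \<subseteq> {m..}" "inj_on s J" "s ` J \<subseteq> {m..}"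
      "norm (\<Sum>i\<in>J. b i *\<^sub>R x (s i)) > 2 ^ k * norm (\<Sum>i\<in>J. b i *\<^sub>R x i)"
    proof -
      have "\<not> Pr m (2 ^ k)" using neg by blast
      then show ?thesis unfolding Pr_def not_all not_imp not_le by (elim exE conjE) (rule that)
    qed
    define t where "t = norm (\<Sum>i\<in>J. b i *\<^sub>R x (s i))"
    have t: "t > 0"
    proof -
      have "0 \<le> 2 ^ k * norm (\<Sum>i\<in>J. b i *\<^sub>R x i)" by simp
      then show ?thesis using J(5) unfolding t_def by linarith
    qed
    obtain m' where m': "\<And>i. i \<in> insert m (J \<union> s ` J) \<Longrightarrow> i < m'"
      using finite_nat_set_iff_bounded[of "insert m (J \<union> s ` J)"] J(1) by auto
    have sub: "J \<subseteq> {m..<m'}" "s ` J \<subseteq> {m..<m'}" using J(2,4) m' by auto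
    obtain q where q: "bij_betw q {m..<m'} {m..<m'}" "\<And>i. i \<in> J \<Longrightarrow> q i = s i"
      using inj_on_finite_extends_to_bij[OF _ sub J(3)] by auto
    define a where "a i = (if i \<in> J then b i / t else 0)" for i
    have eq: "(\<Sum>i\<in>{m..<m'}. a i *\<^sub>R x (q i)) = (1 / t) *\<^sub>R (\<Sum>i\<in>J. b i *\<^sub>R x (s i))"
      "(\<Sum>i\<in>{m..<m'}. a i *\<^sub>R x i) = (1 / t) *\<^sub>R (\<Sum>i\<in>J. b i *\<^sub>R x i)"
      unfolding scaleR_sum_right
      by (rule sum.mono_neutral_cong_right; use sub q(2) in \<open>auto simp: a_def\<close>)+
    have "norm (\<Sum>i\<in>{m..<m'}. a i *\<^sub>R x (q i)) = 1"
      unfolding eq using t by (simp add: t_def)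
    moreover have "norm (\<Sum>i\<in>{m..<m'}. a i *\<^sub>R x i) \<le> (1/2) ^ k"
      unfolding eq using t J(5) by (simp add: t_def[symmetric] field_simps power_one_over)
    ultimately have "G m k m' q a" using q(1) m'[of m] by (simp add: G_def)
    then show ?thesis by blast
  qed
  then obtain nx q b where G: "\<And>m k. G m k (nx m k) (q m k) (b m k)" by metis
  have step: "m < nx m k"
      "bij_betw (q m k) {m..<nx m k} {m..<nx m k}"
      "1 \<le> norm (\<Sum>i\<in>{m..<nx m k}. b m k i *\<^sub>R x (q m k i))"
      "norm (\<Sum>i\<in>{m..<nx m k}. b m k i *\<^sub>R x i) \<le> (1/2) ^ k" for m k
    using G[of m k] by (simp_all add: G_def)
  define M where "M = rec_nat 0 (\<lambda>k m. nx m k)"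
  have MS: "M (Suc k) = nx (M k) k" for k by (simp add: M_def)
  have M: "strict_mono M" "M 0 = 0"
    using step(1) by (auto simp: strict_mono_Suc_iff MS) (simp add: M_def)
  have "bij_betw (q (M k) k) {M k..<M (Suc k)} {M k..<M (Suc k)}" for k
    unfolding MS by (rule step(2))
  from bij_from_blocks[OF M this] obtain p where p: "bij p"
    "\<And>k i. i \<in> {M k..<M (Suc k)} \<Longrightarrow> p i = q (M k) k i" by blast
  define blk where "blk i = (THE k. M k \<le> i \<and> i < M (Suc k))" for i
  have blk: "blk i = k" if "i \<in> {M k..<M (Suc k)}" for i k
    unfolding blk_def using that by (intro the1_equality strict_mono_block_ex1 M) auto
  define a where "a i = b (M (blk i)) (blk i) i" for i
  have a: "a i = b (M k) k i" if "i \<in> {M k..<M (Suc k)}" for i k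
    using blk[OF that] by (simp add: a_def)
  have "norm (\<Sum>j\<in>{M k..<M (Suc k)}. a j *\<^sub>R x j) \<le> (1/2) ^ k" for k
    using step(4)[of "M k" k] a[of _ k] by (simp add: MS)
  then have "summable (\<lambda>j. a j *\<^sub>R x j)" using summable_geometric_blocks[of x C M a] C M by blast
  then have sum_p: "summable (\<lambda>j. a j *\<^sub>R x (p j))"
    using x p(1) unfolding symmetric_basic_sequence_def equivalent_basic_sequences_def by blast
  obtain N where N: "\<And>m n. m \<ge> N \<Longrightarrow> norm (\<Sum>j\<in>{m..<n}. a j *\<^sub>R x (p j)) < 1"
    using sum_p unfolding summable_Cauchy by (meson zero_less_one)
  have "N \<le> M N" using M(1) by (rule strict_mono_imp_increasing)
  then have "norm (\<Sum>j\<in>{M N..<M (Suc N)}. a j *\<^sub>R x (p j)) < 1" by (rule N)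
  moreover have "(\<Sum>j\<in>{M N..<M (Suc N)}. a j *\<^sub>R x (p j)) =
      (\<Sum>j\<in>{M N..<M (Suc N)}. b (M N) N j *\<^sub>R x (q (M N) N j))"
    using a[of _ N] p(2)[of _ N] by simp
  ultimately show False using step(3)[of "M N" N] by (simp add: MS)
qed

section \<open>The Tsirelson norm on successive blocks\<close>

abbreviation coef :: "(nat \<Rightarrow>\<^sub>0 real) \<Rightarrow> nat \<Rightarrow> real" where
  "coef \<equiv> Poly_Mapping.lookup"

abbreviation supp :: "(nat \<Rightarrow>\<^sub>0 real) \<Rightarrow> nat set" where
  "supp \<equiv> Poly_Mapping.keys"

lemma tsirelson_norm_max_sup:
  "tsirelson_norm x = max (max_c00 x) (1/2 * sup_admissible tsirelson_norm x)"
  unfolding max_c00_def sup_admissible_def by (rule tsirelson_norm_eq)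

lemma tsirelson_norm_0: "tsirelson_norm 0 = 0"
  by (rule is_norm_0[OF is_norm_tsirelson])

lemma tsirelson_norm_nonneg: "0 \<le> tsirelson_norm x"
  by (rule is_norm_nonneg[OF is_norm_tsirelson])

lemma tsirelson_norm_scaleR: "tsirelson_norm (c *\<^sub>R x) = \<bar>c\<bar> * tsirelson_norm x"
  using is_norm_tsirelson unfolding is_norm_def by blast

lemma tsirelson_norm_sum_le: "tsirelson_norm (sum f A) \<le> (\<Sum>i\<in>A. tsirelson_norm (f i))"
  by (rule is_norm_sum[OF is_norm_tsirelson])

lemma admissible_sum_le:
  assumes "admissible Es"
  shows "(\<Sum>E\<leftarrow>Es. tsirelson_norm (restrict_c00 E x)) \<le> 2 * tsirelson_norm x"
  using sup_admissible_upper[OF is_norm_tsirelson assms, of x] tsirelson_norm_max_sup[of x] by simp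

lemma tsirelson_norm_leI:
  assumes "\<And>n. \<bar>coef x n\<bar> \<le> c"
    and "\<And>Es. admissible Es \<Longrightarrow> (\<Sum>E\<leftarrow>Es. tsirelson_norm (restrict_c00 E x)) \<le> 2 * c"
  shows "tsirelson_norm x \<le> c"
  using sup_admissible_least[of tsirelson_norm x "2 * c"] max_c00_leI[of x c] assms
  by (subst tsirelson_norm_max_sup) simp

lemma admissible_sum_supp_subset:
  assumes Es: "admissible Es" and E: "E \<in> set Es" "supp x \<subseteq> E"
  shows "(\<Sum>F\<leftarrow>Es. tsirelson_norm (restrict_c00 F x)) = tsirelson_norm x"
proof -
  obtain As Bs where Es_eq: "Es = As @ E # Bs" using E(1) by (meson split_list)
  have "F \<inter> E = {}" if "F \<in> set As \<union> set Bs" for F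
    using admissible_disjoint[OF Es] that unfolding Es_eq by (auto simp: sorted_wrt_append)
  then have "supp x \<inter> F = {}" if "F \<in> set As \<union> set Bs" for F
    using that E(2) by blast
  then have "tsirelson_norm (restrict_c00 F x) = 0" if "F \<in> set As \<union> set Bs" for F
    using that by (simp add: restrict_c00_empty tsirelson_norm_0)
  then have "(\<Sum>F\<leftarrow>As. tsirelson_norm (restrict_c00 F x)) = 0"
    "(\<Sum>F\<leftarrow>Bs. tsirelson_norm (restrict_c00 F x)) = 0"
    by (simp_all cong: map_cong)
  then show ?thesis using E(2) by (simp add: Es_eq restrict_c00_id)
qed

lemma admissible_image:
  assumes s: "strict_mono (s :: nat \<Rightarrow> nat)" and Es: "admissible Es"
  shows "admissible (map ((`) s) Es)"
proof -
  have mono: "mono s" using s by (rule strict_mono_mono)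
  have E: "finite E" "E \<noteq> {}" if "E \<in> set Es" for E using Es that by (auto simp: admissible_def)
  have Max: "Max (s ` E) = s (Max E)" and Min: "Min (s ` E) = s (Min E)" if "E \<in> set Es" for E
    using mono_Max_commute[OF mono E[OF that]] mono_Min_commute[OF mono E[OF that]] by simp_all
  have "sorted_wrt (\<lambda>E F. Max (s ` E) < Min (s ` F)) Es"
    by (rule sorted_wrt_mono_rel[rotated, of "\<lambda>E F. Max E < Min F"])
      (use Es s in \<open>auto simp: admissible_def Max Min strict_mono_less\<close>)
  moreover have "hd Es \<in> set Es" using Es by (simp add: admissible_def)
  moreover have "Min (hd Es) \<le> s (Min (hd Es))" using s by (rule strict_mono_imp_increasing)
  ultimately show ?thesis
    using Es by (auto simp: admissible_def sorted_wrt_map hd_map Min)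
qed

text \<open>
  An increasing map sends admissible families to admissible families, since it moves the minimum of
  the first set to the right; so shifting to the right can only increase the Tsirelson norm.
  The induction on the support breaks down only for a family with one set that contains the
  whole support, and such a family contributes just half the norm itself.
\<close>

lemma tsirelson_norm_spread_mono:
  assumes s: "strict_mono s" and le: "\<And>i. \<bar>coef x i\<bar> \<le> \<bar>coef z (s i)\<bar>"
  shows "tsirelson_norm x \<le> tsirelson_norm z"
  using le
proof (induction "card (supp x)" arbitrary: x z rule: less_induct)
  case less
  have "(\<Sum>E\<leftarrow>Es. tsirelson_norm (restrict_c00 E x)) \<le> max (tsirelson_norm x) (2 * tsirelson_norm z)"
    if Es: "admissible Es" for Es
  proof (cases "\<exists>E\<in>set Es. supp x \<subseteq> E")
    case True
    then show ?thesis using admissible_sum_supp_subset[OF Es] by auto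
  next
    case False
    have "(\<Sum>E\<leftarrow>Es. tsirelson_norm (restrict_c00 E x))
        \<le> (\<Sum>E\<leftarrow>Es. tsirelson_norm (restrict_c00 (s ` E) z))"
    proof (rule sum_list_mono)
      fix E assume "E \<in> set Es"
      then have "supp (restrict_c00 E x) \<subset> supp x"
        using False by (auto simp: keys_restrict_c00)
      then have "card (supp (restrict_c00 E x)) < card (supp x)"
        by (intro psubset_card_mono) auto
      then show "tsirelson_norm (restrict_c00 E x) \<le> tsirelson_norm (restrict_c00 (s ` E) z)"
        by (rule less(1)) (use less(2) in \<open>auto simp: lookup_restrict_c00\<close>)
    qed
    also have "\<dots> = (\<Sum>F\<leftarrow>map ((`) s) Es. tsirelson_norm (restrict_c00 F z))"
      by (simp add: comp_def)
    also have "\<dots> \<le> 2 * tsirelson_norm z" by (rule admissible_sum_le[OF admissible_image[OF s Es]])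
    finally show ?thesis by simp
  qed
  then have "sup_admissible tsirelson_norm x \<le> max (tsirelson_norm x) (2 * tsirelson_norm z)"
    by (rule sup_admissible_least)
  moreover have "max_c00 x \<le> tsirelson_norm z"
    by (rule max_c00_leI) (meson less(2) lookup_le_tsirelson_norm order_trans)
  ultimately show ?case
    using tsirelson_norm_max_sup[of x] tsirelson_norm_nonneg[of z] by (auto simp: max_def split: if_splits)
qed

lemma tsirelson_norm_restrict_le: "tsirelson_norm (restrict_c00 E x) \<le> tsirelson_norm x"
  by (rule tsirelson_norm_spread_mono[of "\<lambda>n. n"]) (simp_all add: strict_mono_def lookup_restrict_c00)

text \<open>
  Some of the sets may be empty, which an admissible family excludes; they contribute nothing.
\<close>

lemma successive_sum_le:
  fixes K :: "nat \<Rightarrow> nat set"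
  assumes less: "\<And>i j a b. i < j \<Longrightarrow> j < n \<Longrightarrow> a \<in> K i \<Longrightarrow> b \<in> K j \<Longrightarrow> a < b"
    and fin: "\<And>i. i < n \<Longrightarrow> finite (K i)"
    and ge: "\<And>i a. i < n \<Longrightarrow> a \<in> K i \<Longrightarrow> n \<le> Suc a"
  shows "(\<Sum>i<n. tsirelson_norm (restrict_c00 (K i) y)) \<le> 2 * tsirelson_norm y"
proof -
  define Es where "Es = filter (\<lambda>E. E \<noteq> {}) (map K [0..<n])"
  have "(\<Sum>i<n. tsirelson_norm (restrict_c00 (K i) y))
      = (\<Sum>E\<leftarrow>map K [0..<n]. tsirelson_norm (restrict_c00 E y))"
    by (simp add: comp_def interv_sum_list_conv_sum_set_nat atLeast0LessThan)
  also have "\<dots> = (\<Sum>E\<leftarrow>Es. tsirelson_norm (restrict_c00 E y))"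
    unfolding Es_def by (rule sum_list_map_filter[symmetric]) (auto simp: restrict_c00_empty tsirelson_norm_0)
  also have "\<dots> \<le> 2 * tsirelson_norm y"
  proof (cases "Es = []")
    case False
    have mem: "\<exists>i<n. E = K i" "finite E" "E \<noteq> {}" if "E \<in> set Es" for E
      using that fin by (auto simp: Es_def)
    have "sorted_wrt (\<lambda>i j. i < j) [0..<n]" by simp
    then have "sorted_wrt (\<lambda>i j. K i \<noteq> {} \<longrightarrow> K j \<noteq> {} \<longrightarrow> Max (K i) < Min (K j)) [0..<n]"
    proof (rule sorted_wrt_mono_rel[rotated], intro impI)
      fix i j assume "i \<in> set [0..<n]" "j \<in> set [0..<n]" "i < j" "K i \<noteq> {}" "K j \<noteq> {}"
      then show "Max (K i) < Min (K j)"
        using less[of i j "Max (K i)" "Min (K j)"] fin[of i] fin[of j] by simp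
    qed
    then have "sorted_wrt (\<lambda>E F. E \<noteq> {} \<longrightarrow> F \<noteq> {} \<longrightarrow> Max E < Min F) Es"
      unfolding Es_def by (intro sorted_wrt_filter) (simp add: sorted_wrt_map)
    then have "sorted_wrt (\<lambda>E F. Max E < Min F) Es"
      by (rule sorted_wrt_mono_rel[rotated]) (simp add: mem(3))
    moreover have "length Es \<le> Suc (Min (hd Es))"
    proof -
      have "length Es \<le> n" unfolding Es_def by (metis diff_zero length_filter_le length_map length_upt)
      moreover have hd: "hd Es \<in> set Es" using False by simp
      moreover have "Min (hd Es) \<in> hd Es" using mem[OF hd] by simp
      ultimately show ?thesis using mem(1)[OF hd] ge by (metis order_trans)
    qed
    ultimately have "admissible Es" using False mem by (auto simp: admissible_def)
    then show ?thesis by (rule admissible_sum_le)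
  qed (simp add: tsirelson_norm_nonneg)
  finally show ?thesis .
qed

lemma coef_disjoint_sum_le:
  assumes "finite A" "0 \<le> C"
    and disj: "\<And>i j. i \<in> A \<Longrightarrow> j \<in> A \<Longrightarrow> i \<noteq> j \<Longrightarrow> supp (z i) \<inter> supp (z j) = {}"
    and le: "\<And>i. i \<in> A \<Longrightarrow> \<bar>coef (z i) n\<bar> \<le> C"
  shows "\<bar>coef (\<Sum>i\<in>A. z i) n\<bar> \<le> C"
proof (cases "\<exists>i\<in>A. n \<in> supp (z i)")
  case True
  then obtain i where i: "i \<in> A" "n \<in> supp (z i)" by blast
  have other: "coef (z j) n = 0" if "j \<in> A - {i}" for j
    using disj[of i j] i that by (metis DiffE IntI empty_iff in_keys_iff singletonI)
  have "(\<Sum>j\<in>A. coef (z j) n) = (\<Sum>j\<in>{i}. coef (z j) n)"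
    using i(1) assms(1) by (intro sum.mono_neutral_right ballI other) auto
  then show ?thesis using le[OF i(1)] by (simp add: lookup_sum)
next
  case False
  then have "(\<Sum>j\<in>A. coef (z j) n) = 0" by (intro sum.neutral) (auto simp: in_keys_iff)
  then show ?thesis using assms(2) by (simp add: lookup_sum)
qed

definition tsirelson_blocks :: "(nat \<Rightarrow> nat) \<Rightarrow> (nat \<Rightarrow> (nat \<Rightarrow>\<^sub>0 real)) \<Rightarrow> bool" where
  "tsirelson_blocks h U \<longleftrightarrow> (\<forall>l. supp (U l) \<subseteq> {h l..<h (Suc l)} \<and> tsirelson_norm (U l) \<le> 1)"

lemma tsirelson_blocksD:
  assumes "tsirelson_blocks h U"
  shows "tsirelson_norm (U l) \<le> 1" "a \<in> supp (U l) \<Longrightarrow> h l \<le> a \<and> a < h (Suc l)"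
proof -
  have "supp (U l) \<subseteq> {h l..<h (Suc l)}" "tsirelson_norm (U l) \<le> 1"
    using assms unfolding tsirelson_blocks_def by blast+
  then show "tsirelson_norm (U l) \<le> 1" "a \<in> supp (U l) \<Longrightarrow> h l \<le> a \<and> a < h (Suc l)"
    by (auto dest!: subsetD)
qed

definition convex_weights :: "nat \<Rightarrow> (nat \<Rightarrow> real) \<Rightarrow> bool" where
  "convex_weights n b \<longleftrightarrow> (\<forall>l<n. 0 \<le> b l) \<and> (\<Sum>l<n. b l) = 1"

lemma admissible_nth:
  assumes Es: "admissible Es" and ij: "i < j" "j < length Es" and "a \<in> Es ! i" "b \<in> Es ! j"
  shows "a < b"
proof -
  have "Max (Es ! i) < Min (Es ! j)"
    using Es ij sorted_wrt_nth_less[of "\<lambda>E F. Max E < Min F" Es i j] by (simp add: admissible_def)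
  moreover have "finite (Es ! i)" "finite (Es ! j)" using Es ij by (auto simp: admissible_def)
  then have "a \<le> Max (Es ! i)" "Min (Es ! j) \<le> b" using assms by simp_all
  ultimately show ?thesis by linarith
qed

lemma admissible_ge_Min_hd:
  assumes Es: "admissible Es" and "E \<in> set Es" "a \<in> E"
  shows "Min (hd Es) \<le> a"
proof -
  have ne: "Es \<noteq> []" "finite (hd Es)" "hd Es \<noteq> {}" using Es by (auto simp: admissible_def)
  obtain j where j: "j < length Es" "E = Es ! j" using assms by (metis in_set_conv_nth)
  have hd: "hd Es = Es ! 0" "Min (hd Es) \<in> hd Es" using ne by (simp_all add: hd_conv_nth)
  show ?thesis
  proof (cases j)
    case 0
    then show ?thesis using hd j ne assms by simp
  next
    case (Suc i)
    then show ?thesis using admissible_nth[OF Es, of 0 j "Min (hd Es)" a] hd j assms by simp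
  qed
qed

text \<open>
  A block that meets at most one of the sets contributes at most its norm.  The others contribute at most
  2, and there are at most as many of them as there are sets: for each one choose the first of two sets
  that it meets, which determines the block because the second set cuts off the later blocks.
\<close>

lemma card_split_blocks_le:
  assumes Es: "admissible Es" and h: "strict_mono h" and U: "tsirelson_blocks h U" and L: "finite L"
  shows "(\<Sum>l\<in>L. \<Sum>E\<leftarrow>Es. tsirelson_norm (restrict_c00 E (U l))) \<le> real (card L) + real (length Es)"
proof -
  let ?S = "\<lambda>l. \<Sum>E\<leftarrow>Es. tsirelson_norm (restrict_c00 E (U l))"
  \<comment> \<open>Block \<open>l\<close> is split by the \<open>i\<close>-th and the \<open>j\<close>-th set.\<close>
  define Q where "Q l i j \<longleftrightarrow> i < j \<and> j < length Es \<and> Es ! i \<inter> supp (U l) \<noteq> {} \<and> Es ! j \<inter> supp (U l) \<noteq> {}"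
    for l i j
  define D where "D = {l \<in> L. \<exists>i j. Q l i j}"
  have "\<forall>l. \<exists>i j. l \<in> D \<longrightarrow> Q l i j" unfolding D_def by blast
  then obtain f g where fg: "\<And>l. l \<in> D \<Longrightarrow> Q l (f l) (g l)" by metis
  note U1 = tsirelson_blocksD(1)[OF U] and Us = tsirelson_blocksD(2)[OF U]
  have "inj_on f D"
  proof (rule linorder_inj_onI)
    fix l l' assume l: "l < l'" "l \<in> D" "l' \<in> D"
    show "f l \<noteq> f l'"
    proof
      assume eq: "f l = f l'"
      obtain b where b: "b \<in> Es ! g l" "b \<in> supp (U l)" using fg[OF l(2)] unfolding Q_def by blast
      obtain a where a: "a \<in> Es ! f l" "a \<in> supp (U l')" using fg[OF l(3)] unfolding Q_def eq by blast
      have "a < b" using admissible_nth[OF Es, of "f l" "g l" a b] a b fg[OF l(2)] by (simp add: Q_def)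
      moreover have "h (Suc l) \<le> h l'" using h l(1) by (simp add: strict_mono_less_eq)
      ultimately show False using Us[OF b(2)] Us[OF a(2)] by linarith
    qed
  qed auto
  moreover have "f ` D \<subseteq> {..<length Es}" using fg unfolding Q_def by fastforce
  ultimately have card_D: "card D \<le> length Es" using card_inj_on_le[of f D "{..<length Es}"] by simp
  have S2: "?S l \<le> 2" for l using admissible_sum_le[OF Es, of "U l"] U1[of l] by linarith
  have S1: "?S l \<le> 1" if l: "l \<in> L - D" for l
  proof (cases "\<exists>i<length Es. Es ! i \<inter> supp (U l) \<noteq> {}")
    case True
    then obtain i where i: "i < length Es" "Es ! i \<inter> supp (U l) \<noteq> {}" by blast
    have other: "restrict_c00 (Es ! j) (U l) = 0" if "j < length Es" "j \<noteq> i" for j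
    proof (rule restrict_c00_empty, rule ccontr)
      assume "supp (U l) \<inter> Es ! j \<noteq> {}"
      then have "Q l i j \<or> Q l j i" using i that by (auto simp: Q_def)
      then show False using l unfolding D_def by blast
    qed
    have "?S l = (\<Sum>j<length Es. tsirelson_norm (restrict_c00 (Es ! j) (U l)))"
      by (simp add: sum_list_sum_nth atLeast0LessThan)
    also have "\<dots> = (\<Sum>j\<in>{i}. tsirelson_norm (restrict_c00 (Es ! j) (U l)))"
      using i(1) by (intro sum.mono_neutral_right) (auto simp: other tsirelson_norm_0)
    also have "\<dots> \<le> 1" using tsirelson_norm_restrict_le[of "Es ! i" "U l"] U1[of l] by simp
    finally show ?thesis .
  next
    case False
    have "restrict_c00 E (U l) = 0" if "E \<in> set Es" for E
      using False that by (intro restrict_c00_empty) (metis in_set_conv_nth inf_commute)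
    then show ?thesis by (simp add: tsirelson_norm_0 cong: map_cong)
  qed
  have "(\<Sum>l\<in>L. ?S l) \<le> (\<Sum>l\<in>L. 1 + (if l \<in> D then 1 else 0))"
    using S1 S2 by (intro sum_mono) auto
  also have "\<dots> = real (card L) + real (card D)"
    using L by (simp add: sum.distrib sum.If_cases D_def Collect_conj_eq)
  finally show ?thesis using card_D by simp
qed

text \<open>
  James' argument.  The combination gives weight one half to the first block and spreads the other half over
  so many blocks that few of them are split by an admissible family which starts in the
  first block, because such a family has at most \<open>h 1\<close> sets.  A family that starts later misses the first block.
\<close>

lemma tsirelson_blocks_average:
  assumes h: "strict_mono h"
  shows "\<exists>n b. convex_weights n b \<and>
     (\<forall>U. tsirelson_blocks h U \<longrightarrow> tsirelson_norm (\<Sum>l<n. b l *\<^sub>R U l) \<le> 7/8)"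
proof -
  \<comment> \<open>The number of blocks that share the second half of the weight.\<close>
  define r where "r = 2 * h 1"
  have "0 < h 1" using strict_monoD[OF h, of 0 1] by simp
  then have r: "0 < r" by (simp add: r_def)
  define b where "b l = (if l = 0 then 1/2 else 1 / (2 * real r))" for l :: nat
  have b0: "0 \<le> b l" "b l \<le> 1/2" for l using r by (auto simp: b_def field_simps)
  have split: "(\<Sum>l<Suc r. b l * f l) = f 0 / 2 + (\<Sum>l\<in>{1..r}. f l) / (2 * real r)" for f
  proof -
    have "(\<Sum>l<Suc r. b l * f l) = b 0 * f 0 + (\<Sum>l\<in>{1..r}. b l * f l)"
      by (subst lessThan_Suc_atMost, subst atMost_atLeast0, subst sum.atLeast_Suc_atMost) simp_all
    also have "(\<Sum>l\<in>{1..r}. b l * f l) = (\<Sum>l\<in>{1..r}. f l / (2 * real r))"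
      by (intro sum.cong) (auto simp: b_def)
    finally show ?thesis by (simp add: b_def sum_divide_distrib)
  qed
  have "tsirelson_norm (\<Sum>l<Suc r. b l *\<^sub>R U l) \<le> 7/8" if U: "tsirelson_blocks h U" for U
  proof (rule tsirelson_norm_leI)
    note U1 = tsirelson_blocksD(1)[OF U] and Us = tsirelson_blocksD(2)[OF U]
    fix n
    show "\<bar>coef (\<Sum>l<Suc r. b l *\<^sub>R U l) n\<bar> \<le> 7/8"
    proof (rule coef_disjoint_sum_le)
      fix l l' :: nat assume "l \<noteq> l'"
      have "coef (U l) a = 0 \<or> coef (U l') a = 0" for a
      proof (rule ccontr)
        assume "\<not> ?thesis"
        then have "a \<in> supp (U l)" "a \<in> supp (U l')" by (simp_all add: in_keys_iff)
        then have "h l' < h (Suc l)" "h l < h (Suc l')" using Us[of a l] Us[of a l'] by force+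
        then show False using \<open>l \<noteq> l'\<close> by (simp add: strict_mono_less[OF h])
      qed
      then show "supp (b l *\<^sub>R U l) \<inter> supp (b l' *\<^sub>R U l') = {}"
        by (simp add: disjoint_iff in_keys_iff lookup_scaleR_c00) blast
    next
      fix l
      have "b l * \<bar>coef (U l) n\<bar> \<le> 1/2 * 1"
        using b0[of l] lookup_le_tsirelson_norm[of "U l" n] U1[of l] by (intro mult_mono) auto
      then show "\<bar>coef (b l *\<^sub>R U l) n\<bar> \<le> 7/8" using b0(1)[of l] by (simp add: lookup_scaleR_c00 abs_mult)
    qed auto
  next
    note U1 = tsirelson_blocksD(1)[OF U] and Us = tsirelson_blocksD(2)[OF U]
    fix Es assume Es: "admissible Es"
    let ?S = "\<lambda>l. \<Sum>E\<leftarrow>Es. tsirelson_norm (restrict_c00 E (U l))"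
    have S2: "?S l \<le> 2" for l using admissible_sum_le[OF Es, of "U l"] U1[of l] by linarith
    have "restrict_c00 E (\<Sum>l<Suc r. b l *\<^sub>R U l) = (\<Sum>l<Suc r. b l *\<^sub>R restrict_c00 E (U l))" for E
      by (rule poly_mapping_eqI) (simp add: lookup_restrict_c00 lookup_sum lookup_scaleR_c00 del: sum.lessThan_Suc)
    then have "tsirelson_norm (restrict_c00 E (\<Sum>l<Suc r. b l *\<^sub>R U l))
        \<le> (\<Sum>l<Suc r. b l * tsirelson_norm (restrict_c00 E (U l)))" for E
      using tsirelson_norm_sum_le[of "\<lambda>l. b l *\<^sub>R restrict_c00 E (U l)" "{..<Suc r}"] b0
      by (simp add: tsirelson_norm_scaleR del: sum.lessThan_Suc)
    then have "(\<Sum>E\<leftarrow>Es. tsirelson_norm (restrict_c00 E (\<Sum>l<Suc r. b l *\<^sub>R U l)))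
        \<le> (\<Sum>E\<leftarrow>Es. \<Sum>l<Suc r. b l * tsirelson_norm (restrict_c00 E (U l)))"
      by (intro sum_list_mono)
    also have "\<dots> = (\<Sum>l<Suc r. b l * ?S l)"
      by (induction Es) (simp_all add: sum.distrib distrib_left del: sum.lessThan_Suc)
    also have "\<dots> = ?S 0 / 2 + (\<Sum>l\<in>{1..r}. ?S l) / (2 * real r)" by (rule split)
    also have "\<dots> \<le> 7/4"
    proof (cases "Min (hd Es) < h 1")
      case True
      then have "length Es \<le> h 1" using Es by (simp add: admissible_def)
      then have "(\<Sum>l\<in>{1..r}. ?S l) \<le> real r + real (h 1)"
        using card_split_blocks_le[OF Es h U, of "{1..r}"] by simp
      then have "(\<Sum>l\<in>{1..r}. ?S l) / (2 * real r) \<le> (real r + real (h 1)) / (2 * real r)"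
        by (intro divide_right_mono) auto
      also have "\<dots> = 3/4" using r by (simp add: r_def field_simps)
      finally show ?thesis using S2[of 0] by linarith
    next
      case False
      have "restrict_c00 E (U 0) = 0" if "E \<in> set Es" for E
      proof (rule restrict_c00_empty, rule ccontr)
        assume "supp (U 0) \<inter> E \<noteq> {}"
        then obtain a where "a \<in> supp (U 0)" "a \<in> E" by blast
        then show False using admissible_ge_Min_hd[OF Es that, of a] Us[of a 0] False by simp
      qed
      then have "?S 0 = 0" by (simp add: tsirelson_norm_0 cong: map_cong)
      moreover have "(\<Sum>l\<in>{1..r}. ?S l) \<le> (\<Sum>l\<in>{1..r}. 2)" by (rule sum_mono) (rule S2)
      then have "(\<Sum>l\<in>{1..r}. ?S l) / (2 * real r) \<le> (2 * real r) / (2 * real r)"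
        by (intro divide_right_mono) auto
      moreover have "(2 * real r) / (2 * real r) = 1" using r by simp
      ultimately show ?thesis by linarith
    qed
    finally show "(\<Sum>E\<leftarrow>Es. tsirelson_norm (restrict_c00 E (\<Sum>l<Suc r. b l *\<^sub>R U l))) \<le> 2 * (7/8)" by simp
  qed
  moreover have "convex_weights (Suc r) b"
    using b0 split[of "\<lambda>_. 1"] r by (simp add: convex_weights_def del: sum.lessThan_Suc)
  ultimately show ?thesis by blast
qed


lemma sum_lessThan_blocks:
  fixes f :: "nat \<Rightarrow> 'a::comm_monoid_add"
  assumes "strict_mono M" "M 0 = 0"
  shows "(\<Sum>k<M n. f k) = (\<Sum>l<n. \<Sum>i<M (Suc l) - M l. f (M l + i))"
proof (induction n)
  case (Suc n)
  have "M n \<le> M (Suc n)" using assms(1) by (simp add: strict_mono_less_eq)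
  then have "(\<Sum>k<M (Suc n). f k) = (\<Sum>k<M n. f k) + (\<Sum>k\<in>{M n..<M (Suc n)}. f k)"
    by (metis atLeast0LessThan le0 sum.atLeastLessThan_concat)
  also have "(\<Sum>k\<in>{M n..<M (Suc n)}. f k) = (\<Sum>i<M (Suc n) - M n. f (M n + i))"
    using sum.shift_bounds_nat_ivl[of f 0 "M n" "M (Suc n) - M n"] \<open>M n \<le> M (Suc n)\<close>
    by (simp add: atLeast0LessThan add.commute)
  finally show ?case using Suc by simp
qed (simp add: assms(2))

text \<open>
  Apply \<open>tsirelson_blocks_average\<close> to blocks that are themselves combinations of norm at most \<open>c\<close>.  The
  intervals \<open>M l\<close> are found one after another since the number of terms in each combination depends
  on where it starts.
\<close>

lemma tsirelson_blocks_average_step: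
  assumes c: "0 < c"
    and IH: "\<And>h. strict_mono h \<Longrightarrow> \<exists>n b. convex_weights n b \<and>
       (\<forall>U. tsirelson_blocks h U \<longrightarrow> tsirelson_norm (\<Sum>l<n. b l *\<^sub>R U l) \<le> c)"
    and h: "strict_mono h"
  shows "\<exists>n b. convex_weights n b \<and>
     (\<forall>U. tsirelson_blocks h U \<longrightarrow> tsirelson_norm (\<Sum>l<n. b l *\<^sub>R U l) \<le> 7/8 * c)"
proof -
  define G where "G M n b \<longleftrightarrow> convex_weights n b \<and>
       (\<forall>U. tsirelson_blocks (\<lambda>l. h (M + l)) U \<longrightarrow> tsirelson_norm (\<Sum>l<n. b l *\<^sub>R U l) \<le> c)" for M n b
  have "\<exists>n b. G M n b" for M
    unfolding G_def by (rule IH) (use h in \<open>simp add: strict_mono_def\<close>)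
  then obtain n b where G: "\<And>M. G M (n M) (b M)" by metis
  have w: "convex_weights (n M) (b M)" for M using G[of M] by (simp add: G_def)
  have npos: "0 < n M" for M using w[of M] by (cases "n M") (auto simp: convex_weights_def)
  define M where "M = rec_nat 0 (\<lambda>l m. m + n m)"
  have MS: "M (Suc l) = M l + n (M l)" for l by (simp add: M_def)
  have M: "strict_mono M" "M 0 = 0"
    using npos by (auto simp: strict_mono_Suc_iff MS) (simp add: M_def)
  have "strict_mono (\<lambda>l. h (M l))" using h M(1) by (simp add: strict_mono_def)
  from tsirelson_blocks_average[OF this] obtain n' b' where w': "convex_weights n' b'"
    and b': "\<And>V. tsirelson_blocks (\<lambda>l. h (M l)) V \<Longrightarrow> tsirelson_norm (\<Sum>l<n'. b' l *\<^sub>R V l) \<le> 7/8"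
    by blast
  define blk where "blk i = (THE k. M k \<le> i \<and> i < M (Suc k))" for i
  define \<beta> where "\<beta> k = b' (blk k) * b (M (blk k)) (k - M (blk k))" for k
  have \<beta>: "\<beta> (M l + i) = b' l * b (M l) i" if "i < n (M l)" for l i
  proof -
    have "blk (M l + i) = l"
      unfolding blk_def using that by (intro the1_equality strict_mono_block_ex1 M) (auto simp: MS)
    then show ?thesis by (simp add: \<beta>_def)
  qed
  have reindex: "(\<Sum>k<M n'. \<beta> k *\<^sub>R U k) = (\<Sum>l<n'. b' l *\<^sub>R (\<Sum>i<n (M l). b (M l) i *\<^sub>R U (M l + i)))"
    for U :: "nat \<Rightarrow> 'a::real_vector"
    by (simp add: sum_lessThan_blocks[OF M] MS \<beta> scaleR_sum_right)
  have "convex_weights (M n') \<beta>"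
    unfolding convex_weights_def
  proof (intro conjI allI impI)
    fix k assume "k < M n'"
    obtain l where l: "M l \<le> k" "k < M (Suc l)" using strict_mono_block_ex1[OF M] by blast
    then have "M l < M n'" using \<open>k < M n'\<close> by simp
    then have "l < n'" using strict_mono_less[OF M(1)] by blast
    then show "0 \<le> \<beta> k"
      using \<beta>[of "k - M l" l] l w[of "M l"] w' by (simp add: MS convex_weights_def)
  next
    have "(\<Sum>k<M n'. \<beta> k) = (\<Sum>l<n'. b' l * (\<Sum>i<n (M l). b (M l) i))"
      using reindex[of "\<lambda>_. 1::real"] by simp
    then show "(\<Sum>k<M n'. \<beta> k) = 1" using w w' by (simp add: convex_weights_def)
  qed
  moreover have "tsirelson_norm (\<Sum>k<M n'. \<beta> k *\<^sub>R U k) \<le> 7/8 * c" if U: "tsirelson_blocks h U" for U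
  proof -
    define V where "V l = (1 / c) *\<^sub>R (\<Sum>i<n (M l). b (M l) i *\<^sub>R U (M l + i))" for l
    have "tsirelson_blocks (\<lambda>l. h (M l)) V"
      unfolding tsirelson_blocks_def
    proof (intro allI conjI subsetI)
      fix l a assume "a \<in> supp (V l)"
      then have "coef (V l) a \<noteq> 0" by (simp add: in_keys_iff)
      then have "(\<Sum>i<n (M l). b (M l) i * coef (U (M l + i)) a) \<noteq> 0"
        by (simp add: V_def lookup_scaleR_c00 lookup_sum)
      then obtain i where i: "i < n (M l)" "coef (U (M l + i)) a \<noteq> 0"
        by (metis (no_types, lifting) lessThan_iff mult_zero_right sum.neutral)
      then have "h (M l + i) \<le> a \<and> a < h (Suc (M l + i))"
        using tsirelson_blocksD(2)[OF U] by (simp add: in_keys_iff)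
      moreover have "h (M l) \<le> h (M l + i)" "h (Suc (M l + i)) \<le> h (M (Suc l))"
        using h i(1) by (simp_all add: strict_mono_less_eq MS)
      ultimately show "a \<in> {h (M l)..<h (M (Suc l))}" by simp
    next
      fix l
      have "tsirelson_blocks (\<lambda>i. h (M l + i)) (\<lambda>i. U (M l + i))"
        using U by (simp add: tsirelson_blocks_def)
      then have "tsirelson_norm (\<Sum>i<n (M l). b (M l) i *\<^sub>R U (M l + i)) \<le> c"
        using G[of "M l"] unfolding G_def by blast
      then show "tsirelson_norm (V l) \<le> 1" using c by (simp add: V_def tsirelson_norm_scaleR field_simps)
    qed
    then have "tsirelson_norm (\<Sum>l<n'. b' l *\<^sub>R V l) \<le> 7/8" by (rule b')
    moreover have "(\<Sum>k<M n'. \<beta> k *\<^sub>R U k) = c *\<^sub>R (\<Sum>l<n'. b' l *\<^sub>R V l)"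
      using c by (simp add: reindex V_def scaleR_sum_right)
    ultimately show ?thesis using c by (simp add: tsirelson_norm_scaleR)
  qed
  ultimately show ?thesis by blast
qed

text \<open>
  The weights depend on the intervals only, not on the blocks: a uniform way to say that no blocks in $T$
  behave like the unit vectors of $\ell_1$.
\<close>

theorem tsirelson_blocks_average_small:
  assumes "0 < \<epsilon>" "strict_mono h"
  shows "\<exists>n b. convex_weights n b \<and>
     (\<forall>U. tsirelson_blocks h U \<longrightarrow> tsirelson_norm (\<Sum>l<n. b l *\<^sub>R U l) \<le> \<epsilon>)"
proof -
  have pow: "\<exists>n b. convex_weights n b \<and>
     (\<forall>U. tsirelson_blocks h U \<longrightarrow> tsirelson_norm (\<Sum>l<n. b l *\<^sub>R U l) \<le> (7/8) ^ k)"
    if "strict_mono h" for h k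
    using that
  proof (induction k arbitrary: h)
    case 0
    then show ?case
      by (intro exI[of _ 1] exI[of _ "\<lambda>_. 1"]) (simp add: convex_weights_def tsirelson_blocksD(1))
  next
    case (Suc k)
    show ?case using tsirelson_blocks_average_step[of "(7/8) ^ k" h] Suc by simp
  qed
  obtain k where "(7/8) ^ k < \<epsilon>" using real_arch_pow_inv[of \<epsilon> "7/8"] assms(1) by auto
  then show ?thesis using pow[OF assms(2), of k] by (meson less_imp_le order_trans)
qed

section \<open>The norm of the subsymmetrization\<close>

lemma norm_blinfun_completion_le:
  fixes f :: "'a::real_normed_vector completion \<Rightarrow>\<^sub>L real"
  assumes "0 \<le> C" "\<And>x. blinfun_apply f (completion_of x) \<le> C * norm x"
  shows "norm f \<le> C"
proof (rule norm_blinfun_bound[OF assms(1)])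
  fix c :: "'a completion"
  obtain X where X: "(\<lambda>m. completion_of (X m)) \<longlonglongrightarrow> c"
    using completion_limit_ex by blast
  have "norm (f (completion_of x)) \<le> C * norm x" for x
    using assms(2)[of x] assms(2)[of "- x"]
    by (simp add: linear_neg[OF linear_completion_of] blinfun.minus_right abs_le_iff)
  then have le: "norm (f (completion_of (X m))) \<le> C * norm (completion_of (X m))" for m by simp
  show "norm (blinfun_apply f c) \<le> C * norm c"
    by (rule LIMSEQ_le[OF tendsto_norm[OF blinfun.tendsto[OF tendsto_const X]]
          tendsto_mult_left[OF tendsto_norm[OF X]]]) (use le in auto)
qed

lemma tsirelson_coord_sum_apply:
  "blinfun_apply (\<Sum>i\<in>A. c i *\<^sub>R tsirelson_coord i) (completion_of (Abs_tsirelson_c00 y)) =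
     (\<Sum>i\<in>A. c i * coef y i)"
  by (simp add: blinfun.sum_left blinfun.scaleR_left tsirelson_coord Abs_tsirelson_c00_inverse)

lemma su_pairing_le_strict_mono:
  assumes s: "strict_mono (s :: nat \<Rightarrow> nat)"
  shows "(\<Sum>i | s i \<in> supp a. coef a (s i) * coef y i) \<le> su_norm a * tsirelson_norm y"
proof -
  let ?f = "\<Sum>i\<in>{i. s i \<in> supp a}. coef a (s i) *\<^sub>R tsirelson_coord i"
  have "(\<Sum>i | s i \<in> supp a. coef a (s i) * coef y i) = ?f (completion_of (Abs_tsirelson_c00 y))"
    by (simp add: tsirelson_coord_sum_apply)
  also have "\<dots> \<le> norm (?f (completion_of (Abs_tsirelson_c00 y)))" by simp
  also have "\<dots> \<le> norm ?f * norm (completion_of (Abs_tsirelson_c00 y))" by (rule norm_blinfun)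
  also have "\<dots> = norm ?f * tsirelson_norm y"
    by (simp add: norm_tsirelson_c00.rep_eq Abs_tsirelson_c00_inverse)
  also have "\<dots> \<le> su_norm a * tsirelson_norm y"
    by (intro mult_right_mono su_sum_le_su_norm s tsirelson_norm_nonneg)
  finally show ?thesis .
qed

text \<open>
  Converse to \<open>su_pairing_le_strict_mono\<close>: together they describe the norm of the subsymmetrization by
  pairings with vectors of $T$, so that the space $T^*$ itself no longer appears.
\<close>

lemma su_norm_leI:
  assumes "\<And>s y. strict_mono (s :: nat \<Rightarrow> nat) \<Longrightarrow> tsirelson_norm y \<le> 1 \<Longrightarrow>
      (\<Sum>i\<in>supp y. coef a (s i) * coef y i) \<le> C"
  shows "su_norm a \<le> C"
proof (rule su_norm_least)
  fix s :: "nat \<Rightarrow> nat" assume s: "strict_mono s"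
  have C: "0 \<le> C" using assms[OF s, of 0] by (simp add: tsirelson_norm_0)
  let ?f = "\<Sum>i\<in>{i. s i \<in> supp a}. coef a (s i) *\<^sub>R tsirelson_coord i"
  show "norm ?f \<le> C"
  proof (rule norm_blinfun_completion_le[OF C])
    fix x
    define y where "y = Rep_tsirelson_c00 x"
    define t where "t = tsirelson_norm y"
    have x: "x = Abs_tsirelson_c00 y" "norm x = t"
      by (simp_all add: y_def t_def Rep_tsirelson_c00_inverse norm_tsirelson_c00.rep_eq)
    have "?f (completion_of x) = (\<Sum>i | s i \<in> supp a. coef a (s i) * coef y i)"
      by (simp add: x(1) tsirelson_coord_sum_apply)
    also have "\<dots> = (\<Sum>i\<in>supp y. coef a (s i) * coef y i)"
      by (rule sum.mono_neutral_cong) (auto simp: in_keys_iff finite_vimage_keys[OF s, of a, unfolded in_keys_iff])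
    also have "\<dots> \<le> C * t"
    proof (cases "t = 0")
      case True
      then have "y = 0" using is_norm_tsirelson unfolding t_def is_norm_def by blast
      then show ?thesis using True by simp
    next
      case False
      then have t: "t > 0" using tsirelson_norm_nonneg[of y] by (simp add: t_def)
      have "supp ((1 / t) *\<^sub>R y) = supp y" using t by (auto simp: in_keys_iff lookup_scaleR_c00)
      moreover have "tsirelson_norm ((1 / t) *\<^sub>R y) \<le> 1" using t by (simp add: tsirelson_norm_scaleR t_def)
      ultimately have "(\<Sum>i\<in>supp y. coef a (s i) * coef ((1 / t) *\<^sub>R y) i) \<le> C" using assms[OF s] by metis
      then have "(\<Sum>i\<in>supp y. coef a (s i) * coef y i) / t \<le> C"
        by (simp add: lookup_scaleR_c00 sum_divide_distrib)
      then show ?thesis using t by (simp add: field_simps)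
    qed
    finally show "?f (completion_of x) \<le> C * norm x" by (simp add: x(2))
  qed
qed

lemma su_norm_nonneg: "0 \<le> su_norm a"
  by (rule is_norm_nonneg[OF is_norm_su_norm])

lemma su_norm_scaleR: "su_norm (c *\<^sub>R a) = \<bar>c\<bar> * su_norm a"
  using is_norm_su_norm unfolding is_norm_def by blast

lemma su_norm_sum_le: "su_norm (sum f A) \<le> (\<Sum>i\<in>A. su_norm (f i))"
  by (rule is_norm_sum[OF is_norm_su_norm])

text \<open>
  Here \<open>s\<close> is increasing on the finite set \<open>K\<close> only, and it may leave gaps between the points of \<open>K\<close> that no
  increasing map on all natural numbers could fill.  Numbering \<open>K\<close> increasingly removes these gaps, and
  it moves the coordinates of \<open>y\<close> to the left, which does not increase the Tsirelson norm.
\<close>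

lemma su_pairing_le:
  fixes s :: "nat \<Rightarrow> nat"
  assumes K: "finite K" and s: "\<And>i j. i \<in> K \<Longrightarrow> j \<in> K \<Longrightarrow> i < j \<Longrightarrow> s i < s j"
  shows "(\<Sum>i\<in>K. coef a (s i) * coef y i) \<le> su_norm a * tsirelson_norm y"
proof -
  obtain m where m: "\<And>i. i \<in> K \<Longrightarrow> i < m"
    using finite_nat_set_iff_bounded[of K] K by auto
  obtain M where M: "\<And>i. i \<in> K \<Longrightarrow> s i < M"
    using finite_nat_set_iff_bounded[of "s ` K"] K by auto
  \<comment> \<open>Numbering an infinite set avoids a special treatment beyond the last point of \<open>K\<close>; there \<open>y'\<close> vanishes.\<close>
  define K' where "K' = K \<union> {m..}"
  have inf: "infinite K'" using infinite_Ici[of m] by (simp add: K'_def)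
  define e where "e = enumerate K'"
  have e: "strict_mono e" unfolding e_def by (rule strict_mono_enumerate[OF inf])
  have eK: "e i \<in> K \<or> m \<le> e i" for i
    using enumerate_in_set[OF inf, of i] by (auto simp: e_def K'_def)
  have surj: "\<exists>i. e i = k" if "k \<in> K" for k
    using range_enumerate[OF inf] that unfolding e_def K'_def by (metis UnI1 imageE)
  define s' where "s' i = (if i \<in> K then s i else M + i)" for i
  have s': "strict_mono (\<lambda>i. s' (e i))"
  proof (rule strict_monoI)
    fix i j :: nat assume "i < j"
    then have lt: "e i < e j" using e by (simp add: strict_mono_less)
    then show "s' (e i) < s' (e j)"
      using s[of "e i" "e j"] m[of "e j"] M[of "e i"] eK[of i] eK[of j] by (force simp: s'_def)
  qed
  have inj: "inj e" using e by (rule strict_mono_imp_inj_on)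
  define y' where "y' = Poly_Mapping.map_key e (restrict_c00 K y)"
  have y': "coef y' i = (if e i \<in> K then coef y (e i) else 0)" for i
    by (simp add: y'_def map_key.rep_eq[OF inj] lookup_restrict_c00)
  have "(\<Sum>i\<in>K. coef a (s i) * coef y i) = (\<Sum>i | e i \<in> K. coef a (s' (e i)) * coef y' i)"
  proof (rule sum.reindex_cong[where l = e])
    show "inj_on e {i. e i \<in> K}" using inj by (rule inj_on_subset) simp
    show "K = e ` {i. e i \<in> K}" using surj by blast
  qed (simp add: y' s'_def)
  also have "\<dots> = (\<Sum>i | s' (e i) \<in> supp a. coef a (s' (e i)) * coef y' i)"
  proof (rule sum.mono_neutral_cong)
    show "finite {i. e i \<in> K}" using finite_vimageI[OF K inj] by (simp add: vimage_def)
    show "finite {i. s' (e i) \<in> supp a}" using finite_vimage_keys[OF s'] .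
  qed (auto simp: y' in_keys_iff)
  also have "\<dots> \<le> su_norm a * tsirelson_norm y'" by (rule su_pairing_le_strict_mono[OF s'])
  also have "\<dots> \<le> su_norm a * tsirelson_norm y"
    by (intro mult_left_mono su_norm_nonneg tsirelson_norm_spread_mono[OF e]) (simp add: y')
  finally show ?thesis .
qed

lemma su_norm_restrict_le: "su_norm (restrict_c00 E a) \<le> su_norm a"
proof (rule su_norm_leI)
  fix s :: "nat \<Rightarrow> nat" and y assume s: "strict_mono s" and y: "tsirelson_norm y \<le> 1"
  have "(\<Sum>i\<in>supp y. coef (restrict_c00 E a) (s i) * coef y i) =
      (\<Sum>i\<in>{i \<in> supp y. s i \<in> E}. coef a (s i) * coef y i)"
    by (rule sum.mono_neutral_cong_right) (auto simp: lookup_restrict_c00)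
  also have "\<dots> \<le> su_norm a * tsirelson_norm y"
    by (rule su_pairing_le) (use s in \<open>auto simp: strict_mono_less\<close>)
  also have "\<dots> \<le> su_norm a" using y su_norm_nonneg by (rule mult_left_le)
  finally show "(\<Sum>i\<in>supp y. coef (restrict_c00 E a) (s i) * coef y i) \<le> su_norm a" .
qed

text \<open>
  Fix a move to the left and let \<open>m\<close> be the first index for which at least \<open>n - m\<close> coordinates of
  \<open>z m\<close> survive.  The vectors before \<open>m\<close> contribute a convergent geometric sum, \<open>z m\<close> contributes at most 1, and
  the \<open>n - m - 1\<close> vectors after it have been moved to places that are admissible for
  as many sets, so they contribute at most 2.
\<close>

lemma su_norm_flat_sum_le:
  assumes succ: "\<And>i j a b. i < j \<Longrightarrow> j < n \<Longrightarrow> a \<in> supp (z i) \<Longrightarrow> b \<in> supp (z j) \<Longrightarrow> a < b"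
    and z: "\<And>i. i < n \<Longrightarrow> su_norm (z i) \<le> 1"
    and flat: "\<And>i l. i < n \<Longrightarrow> \<bar>coef (z i) l\<bar> \<le> (1/4) ^ (n - i)"
  shows "su_norm (\<Sum>i<n. z i) \<le> 4"
proof (rule su_norm_leI)
  fix s :: "nat \<Rightarrow> nat" and y assume s: "strict_mono s" and y: "tsirelson_norm y \<le> 1"
  define K where "K i = {l \<in> supp y. s l \<in> supp (z i)}" for i
  define P where "P i = (\<Sum>l\<in>K i. coef (z i) (s l) * coef y l)" for i
  have fin: "finite (K i)" for i by (simp add: K_def)
  have y1: "\<bar>coef y l\<bar> \<le> 1" for l using lookup_le_tsirelson_norm[of y l] y by linarith
  have Ksucc: "a < b" if "i < j" "j < n" "a \<in> K i" "b \<in> K j" for i j a b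
    using succ[OF that(1,2), of "s a" "s b"] that(3,4) strict_mono_less[OF s] by (simp add: K_def)
  have total: "(\<Sum>l\<in>supp y. coef (\<Sum>i<n. z i) (s l) * coef y l) = (\<Sum>i<n. P i)"
  proof -
    have "(\<Sum>l\<in>supp y. coef (\<Sum>i<n. z i) (s l) * coef y l) =
        (\<Sum>i<n. \<Sum>l\<in>supp y. coef (z i) (s l) * coef y l)"
      by (simp add: lookup_sum sum_distrib_right) (rule sum.swap)
    also have "\<dots> = (\<Sum>i<n. P i)"
      unfolding P_def by (intro sum.cong refl sum.mono_neutral_right) (auto simp: K_def in_keys_iff)
    finally show ?thesis .
  qed
  have P_N: "P i \<le> tsirelson_norm (restrict_c00 (K i) y)" if "i < n" for i
  proof -
    have "P i = (\<Sum>l\<in>K i. coef (z i) (s l) * coef (restrict_c00 (K i) y) l)"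
      unfolding P_def by (rule sum.cong) (simp_all add: lookup_restrict_c00)
    also have "\<dots> \<le> su_norm (z i) * tsirelson_norm (restrict_c00 (K i) y)"
      by (rule su_pairing_le[OF fin]) (use s in \<open>simp add: strict_mono_less\<close>)
    also have "\<dots> \<le> tsirelson_norm (restrict_c00 (K i) y)"
      by (rule mult_left_le_one_le[OF tsirelson_norm_nonneg su_norm_nonneg z[OF that]])
    finally show ?thesis .
  qed
  have P_card: "P i \<le> real (card (K i)) * (1/4) ^ (n - i)" if "i < n" for i
  proof -
    have "coef (z i) (s l) * coef y l \<le> (1/4) ^ (n - i)" for l
    proof -
      have "coef (z i) (s l) * coef y l \<le> \<bar>coef (z i) (s l)\<bar> * \<bar>coef y l\<bar>"
        by (metis abs_ge_self abs_mult)
      also have "\<dots> \<le> (1/4) ^ (n - i) * 1" using flat[OF that] y1 by (intro mult_mono) auto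
      finally show ?thesis by simp
    qed
    then show ?thesis
      unfolding P_def using sum_bounded_above[of "K i" "\<lambda>l. coef (z i) (s l) * coef y l" "(1/4) ^ (n - i)"] by simp
  qed
  have P_small: "P i \<le> (1/2) ^ (n - i)" if "i < n" "card (K i) < n - i" for i
  proof -
    have "card (K i) \<le> 2 ^ (n - i)" using that(2) less_exp[of "n - i"] by linarith
    then have "real (card (K i)) \<le> real (2 ^ (n - i))" by (simp only: of_nat_le_iff)
    then have "real (card (K i)) * (1/4) ^ (n - i) \<le> 2 ^ (n - i) * (1/4) ^ (n - i)"
      by (intro mult_right_mono) simp_all
    also have "\<dots> = (1/2) ^ (n - i)" by (simp flip: power_mult_distrib)
    finally show ?thesis using P_card[OF that(1)] by linarith
  qed
  have geo: "(\<Sum>i<m. (1/2::real) ^ (n - i)) \<le> 1" if "m \<le> n" for m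
  proof -
    have "(\<Sum>i<m. (1/2::real) ^ (n - i)) \<le> (\<Sum>i<n. (1/2) ^ (n - i))"
      using that by (intro sum_mono2) auto
    also have "\<dots> = (\<Sum>i<n. (1/2) ^ Suc i)"
      by (subst sum.nat_diff_reindex[symmetric]) (auto intro!: sum.cong simp: Suc_diff_Suc)
    also have "\<dots> = 1 - (1/2) ^ n" by (induction n) simp_all
    also have "\<dots> \<le> 1" by simp
    finally show ?thesis .
  qed
  show "(\<Sum>l\<in>supp y. coef (\<Sum>i<n. z i) (s l) * coef y l) \<le> 4"
  proof (cases "\<exists>i<n. n - i \<le> card (K i)")
    case False
    then have "(\<Sum>i<n. P i) \<le> (\<Sum>i<n. (1/2) ^ (n - i))"
      by (intro sum_mono P_small) (auto simp: not_le)
    then show ?thesis using total geo[of n] by simp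
  next
    case True
    define m where "m = (LEAST i. i < n \<and> n - i \<le> card (K i))"
    have m: "m < n" "n - m \<le> card (K m)" using LeastI_ex[OF True] by (simp_all add: m_def)
    have before: "card (K i) < n - i" if "i < m" for i
      using not_less_Least[OF that[unfolded m_def]] that m(1) by (simp add: not_le)
    define n' where "n' = n - Suc m"
    have "(\<Sum>i<n. P i) = (\<Sum>i<m. P i) + (P m + (\<Sum>i\<in>{Suc m..<n}. P i))"
      using m(1) sum.atLeastLessThan_concat[of 0 m n P] sum.atLeast_Suc_lessThan[of m n P]
      by (simp add: atLeast0LessThan)
    moreover have "(\<Sum>i<m. P i) \<le> 1"
    proof -
      have "(\<Sum>i<m. P i) \<le> (\<Sum>i<m. (1/2) ^ (n - i))"
        using m(1) before by (intro sum_mono P_small) auto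
      then show ?thesis using geo[of m] m(1) by simp
    qed
    moreover have "P m \<le> 1"
      using P_N[OF m(1)] tsirelson_norm_restrict_le[of "K m" y] y by linarith
    moreover have "(\<Sum>i\<in>{Suc m..<n}. P i) \<le> 2"
    proof -
      have "(\<Sum>i\<in>{Suc m..<n}. P i) \<le> (\<Sum>i\<in>{Suc m..<n}. tsirelson_norm (restrict_c00 (K i) y))"
        by (intro sum_mono P_N) simp
      also have "\<dots> = (\<Sum>j<n'. tsirelson_norm (restrict_c00 (K (Suc m + j)) y))"
        using sum.shift_bounds_nat_ivl[of "\<lambda>i. tsirelson_norm (restrict_c00 (K i) y)" 0 "Suc m" n'] m(1)
        by (simp add: n'_def atLeast0LessThan add.commute)
      also have "\<dots> \<le> 2 * tsirelson_norm y"
      proof (rule successive_sum_le)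
        fix j b assume j: "j < n'" "b \<in> K (Suc m + j)"
        have "K m \<subseteq> {..<b}" using Ksucc[of m "Suc m + j" _ b] j by (auto simp: n'_def)
        then have "card (K m) \<le> b" using card_mono[of "{..<b}" "K m"] by simp
        then show "n' \<le> Suc b" using m(2) by (simp add: n'_def)
      next
        fix i j a b assume "i < j" "j < n'" "a \<in> K (Suc m + i)" "b \<in> K (Suc m + j)"
        then show "a < b" using Ksucc[of "Suc m + i" "Suc m + j" a b] by (simp add: n'_def)
      qed (rule fin)
      finally show ?thesis using y by simp
    qed
    ultimately show ?thesis using total by simp
  qed
qed


text \<open>
  Norms of sums of unit vectors in \<open>X\<close> tend to infinity: move the large coordinates to the
  first places and pair them with convex weights of small norm in $T$.
\<close>

lemma su_norm_card_large_coef: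
  assumes \<eta>: "0 < \<eta>"
  shows "\<exists>M::nat. \<forall>v. su_norm v \<le> 1 \<longrightarrow> card {i. \<eta> < \<bar>coef v i\<bar>} \<le> M"
proof -
  have "strict_mono (\<lambda>l::nat. l)" by (simp add: strict_mono_def)
  from tsirelson_blocks_average_small[OF _ this, of "\<eta> / 2"] \<eta> obtain n b where
    w: "convex_weights n b" and
    b: "\<And>U. tsirelson_blocks (\<lambda>l. l) U \<Longrightarrow> tsirelson_norm (\<Sum>l<n. b l *\<^sub>R U l) \<le> \<eta> / 2" by auto
  have "card {i. \<eta> < \<bar>coef v i\<bar>} \<le> n" if v: "su_norm v \<le> 1" for v
  proof (rule ccontr)
    define A where "A = {i. \<eta> < \<bar>coef v i\<bar>}"
    assume "\<not> ?thesis"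
    then have card: "n < card A" by (simp add: A_def)
    then have fin: "finite A" by (metis card.infinite not_less0)
    define s where "s l = sorted_list_of_set A ! l" for l
    have sA: "s l \<in> A" if "l < n" for l
      using nth_mem[of l "sorted_list_of_set A"] that card fin by (simp add: s_def)
    have smono: "s i < s j" if "i < j" "j < n" for i j
      using sorted_wrt_nth_less[OF strict_sorted_list_of_set[of A] that(1)] that(2) card fin
      by (simp add: s_def)
    define U where "U l = Poly_Mapping.single l (sgn (coef v (s l)))" for l
    have "tsirelson_norm (U l) \<le> 1" for l
    proof -
      have "U l = sgn (coef v (s l)) *\<^sub>R Poly_Mapping.single l 1"
        by (rule poly_mapping_eqI) (simp add: U_def lookup_scaleR_c00 lookup_single when_def)
      then show ?thesis
        using tsirelson_norm_single_le[of l] tsirelson_norm_nonneg[of "Poly_Mapping.single l 1"]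
        by (simp add: tsirelson_norm_scaleR abs_sgn_eq)
    qed
    then have "tsirelson_blocks (\<lambda>l. l) U" by (auto simp: tsirelson_blocks_def U_def in_keys_iff lookup_single when_def)
    then have small: "tsirelson_norm (\<Sum>l<n. b l *\<^sub>R U l) \<le> \<eta> / 2" by (rule b)
    have U: "coef (\<Sum>l<n. b l *\<^sub>R U l) i = b i * sgn (coef v (s i))" if "i < n" for i
      using that by (simp add: lookup_sum lookup_scaleR_c00 U_def lookup_single when_def if_distrib sum.delta cong: if_cong)
    have "\<eta> = (\<Sum>l<n. b l * \<eta>)" using w by (simp add: convex_weights_def flip: sum_distrib_right)
    also have "\<dots> \<le> (\<Sum>l<n. b l * \<bar>coef v (s l)\<bar>)"
      using w sA by (intro sum_mono mult_left_mono) (auto simp: convex_weights_def A_def less_imp_le)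
    also have "\<dots> = (\<Sum>l<n. coef v (s l) * coef (\<Sum>l<n. b l *\<^sub>R U l) l)"
      by (intro sum.cong) (auto simp: U abs_sgn)
    also have "\<dots> \<le> su_norm v * tsirelson_norm (\<Sum>l<n. b l *\<^sub>R U l)"
      by (rule su_pairing_le) (use smono in auto)
    also have "\<dots> \<le> 1 * (\<eta> / 2)"
      using v small by (intro mult_mono tsirelson_norm_nonneg) auto
    finally show False using \<eta> by simp
  qed
  then show ?thesis by blast
qed

section \<open>Functionals on the subsymmetrization\<close>

definition act :: "(su_tsirelson_dual \<Rightarrow>\<^sub>L real) \<Rightarrow> (nat \<Rightarrow>\<^sub>0 real) \<Rightarrow> real" where
  "act f a = blinfun_apply f (completion_of (Abs_su_tsirelson_dual_c00 a))"

lemma linear_act: "linear (act f)"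
proof -
  have "linear Abs_su_tsirelson_dual_c00"
    by (rule linearI) (simp_all add: plus_su_tsirelson_dual_c00.abs_eq scaleR_su_tsirelson_dual_c00.abs_eq)
  then have "linear (completion_of \<circ> Abs_su_tsirelson_dual_c00)"
    by (rule linear_compose[OF _ linear_completion_of])
  moreover have "linear (blinfun_apply f)" by (simp add: blinfun.bounded_linear_right bounded_linear.linear)
  ultimately have "linear (blinfun_apply f \<circ> (completion_of \<circ> Abs_su_tsirelson_dual_c00))"
    by (rule linear_compose)
  then show ?thesis by (simp add: act_def[abs_def] comp_def)
qed

lemmas act_add = linear_add[OF linear_act]
  and act_scaleR = linear_scale[OF linear_act]
  and act_sum = linear_sum[OF linear_act]
  and act_0 = linear_0[OF linear_act]

lemma act_left:
  "act (f + g) a = act f a + act g a"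
  "act (f - g) a = act f a - act g a"
  "act (c *\<^sub>R f) a = c * act f a"
  "act (\<Sum>i\<in>A. F i) a = (\<Sum>i\<in>A. act (F i) a)"
  by (simp_all add: act_def blinfun.add_left blinfun.diff_left blinfun.scaleR_left blinfun.sum_left)

lemma norm_su_completion: "norm (completion_of (Abs_su_tsirelson_dual_c00 a)) = su_norm a"
  by (simp add: norm_su_tsirelson_dual_c00.rep_eq Abs_su_tsirelson_dual_c00_inverse)

lemma act_le: "\<bar>act f a\<bar> \<le> norm f * su_norm a"
  using norm_blinfun[of f "completion_of (Abs_su_tsirelson_dual_c00 a)"]
  by (simp add: act_def norm_su_completion del: norm_completion_of)

lemma act_le_norm: "su_norm a \<le> 1 \<Longrightarrow> \<bar>act f a\<bar> \<le> norm f"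
  using act_le[of f a] mult_left_le[of "su_norm a" "norm f"] by simp

lemma norm_functional_le:
  assumes "0 \<le> C" "\<And>a. act f a \<le> C * su_norm a"
  shows "norm f \<le> C"
proof (rule norm_blinfun_completion_le[OF assms(1)])
  fix x :: su_tsirelson_dual_c00
  have "x = Abs_su_tsirelson_dual_c00 (Rep_su_tsirelson_dual_c00 x)"
    by (simp add: Rep_su_tsirelson_dual_c00_inverse)
  then show "blinfun_apply f (completion_of x) \<le> C * norm x"
    using assms(2)[of "Rep_su_tsirelson_dual_c00 x"]
    by (simp add: act_def norm_su_tsirelson_dual_c00.rep_eq)
qed

lemma functional_almost_attains_norm:
  assumes "0 \<le> C" "C < norm f"
  obtains a where "su_norm a \<le> 1" "C < act f a"
proof -
  have "\<not> (\<forall>a. act f a \<le> C * su_norm a)" using norm_functional_le[OF assms(1)] assms(2) by (metis not_le)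
  then obtain a where a: "C * su_norm a < act f a" by (auto simp: not_le)
  have "su_norm a \<noteq> 0"
  proof
    assume "su_norm a = 0"
    then have "a = 0" using is_norm_su_norm unfolding is_norm_def by blast
    then show False using a \<open>su_norm a = 0\<close> by (simp add: act_0)
  qed
  then have pos: "0 < su_norm a" using su_norm_nonneg[of a] by simp
  show ?thesis
  proof (rule that[of "(1 / su_norm a) *\<^sub>R a"])
    show "su_norm ((1 / su_norm a) *\<^sub>R a) \<le> 1" using pos by (simp add: su_norm_scaleR)
    show "C < act f ((1 / su_norm a) *\<^sub>R a)" using a pos by (simp add: act_scaleR field_simps)
  qed
qed

definition entry :: "(su_tsirelson_dual \<Rightarrow>\<^sub>L real) \<Rightarrow> nat \<Rightarrow> real" where
  "entry f i = act f (Poly_Mapping.single i 1)"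

lemma act_expansion:
  assumes "finite A" "supp a \<subseteq> A"
  shows "act f a = (\<Sum>i\<in>A. coef a i * entry f i)"
proof -
  have "act f a = (\<Sum>i\<in>supp a. coef a i * entry f i)"
    by (subst c00_expansion) (simp add: act_sum act_scaleR entry_def)
  also have "\<dots> = (\<Sum>i\<in>A. coef a i * entry f i)"
    using assms by (intro sum.mono_neutral_left) (auto simp: in_keys_iff)
  finally show ?thesis .
qed

lemma su_norm_single_le: "su_norm (Poly_Mapping.single i 1) \<le> 1"
proof (rule su_norm_least)
  fix s :: "nat \<Rightarrow> nat" assume "strict_mono s"
  from su_sum_le_norm[OF this, of "Poly_Mapping.single i 1"]
  show "norm (\<Sum>j | s j \<in> supp (Poly_Mapping.single i 1).
      coef (Poly_Mapping.single i 1) (s j) *\<^sub>R tsirelson_coord j) \<le> 1"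
    by (simp add: norm_c00)
qed

lemma entry_le: "\<bar>entry f i\<bar> \<le> norm f"
  unfolding entry_def by (rule act_le_norm[OF su_norm_single_le])

lemma entry_left:
  "entry (f + g) i = entry f i + entry g i"
  "entry (f - g) i = entry f i - entry g i"
  "entry (c *\<^sub>R f) i = c * entry f i"
  "entry (\<Sum>j\<in>A. F j) i = (\<Sum>j\<in>A. entry (F j) i)"
  by (simp_all add: entry_def act_left)

text \<open>
  Restriction to \<open>E\<close> is a contraction of \<open>X\<close>, so its composition with \<open>f\<close> extends to the completion.
\<close>

lemma functional_restriction_ex:
  "\<exists>g. \<forall>a. act g a = act f (restrict_c00 E a)"
proof -
  have lin: "linear (\<lambda>x. act f (restrict_c00 E (Rep_su_tsirelson_dual_c00 x)))"
    by (rule linearI) (simp_all add: plus_su_tsirelson_dual_c00.rep_eq scaleR_su_tsirelson_dual_c00.rep_eq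
        restrict_c00_add restrict_c00_scaleR act_add act_scaleR)
  have bd: "norm (act f (restrict_c00 E (Rep_su_tsirelson_dual_c00 x))) \<le> norm f * norm x" for x
    using act_le[of f "restrict_c00 E (Rep_su_tsirelson_dual_c00 x)"]
      mult_left_mono[OF su_norm_restrict_le[of E "Rep_su_tsirelson_dual_c00 x"] norm_ge_zero[of f]]
    by (simp add: norm_su_tsirelson_dual_c00.rep_eq)
  obtain g :: "su_tsirelson_dual \<Rightarrow>\<^sub>L real" where
    "\<And>x. blinfun_apply g (completion_of x) = act f (restrict_c00 E (Rep_su_tsirelson_dual_c00 x))"
    using bounded_linear_completion_extension[OF lin bd] by blast
  then show ?thesis
    by (intro exI[of _ g]) (simp add: act_def Abs_su_tsirelson_dual_c00_inverse)
qed

definition proj :: "nat set \<Rightarrow> (su_tsirelson_dual \<Rightarrow>\<^sub>L real) \<Rightarrow> (su_tsirelson_dual \<Rightarrow>\<^sub>L real)" where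
  "proj E f = (SOME g. \<forall>a. act g a = act f (restrict_c00 E a))"

lemma act_proj: "act (proj E f) a = act f (restrict_c00 E a)"
  using someI_ex[OF functional_restriction_ex[of f E]] by (simp add: proj_def)

lemma entry_proj: "entry (proj E f) i = (if i \<in> E then entry f i else 0)"
proof -
  have "restrict_c00 E (Poly_Mapping.single i 1) = (if i \<in> E then Poly_Mapping.single i 1 else 0)"
    by (rule poly_mapping_eqI) (simp add: lookup_restrict_c00 lookup_single when_def)
  then show ?thesis by (simp add: entry_def act_proj act_0)
qed

lemma functional_eqI:
  assumes "\<And>a. act f a = act g a"
  shows "f = g"
proof (rule blinfun_completion_eqI)
  fix x
  show "blinfun_apply f (completion_of x) = blinfun_apply g (completion_of x)"
    using assms[of "Rep_su_tsirelson_dual_c00 x"] by (simp add: act_def Rep_su_tsirelson_dual_c00_inverse)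
qed

lemma norm_proj_le: "norm (proj E f) \<le> norm f"
proof (rule norm_functional_le)
  fix a
  have "act (proj E f) a \<le> norm f * su_norm (restrict_c00 E a)"
    using act_le[of f "restrict_c00 E a"] by (simp add: act_proj)
  also have "\<dots> \<le> norm f * su_norm a" by (intro mult_left_mono su_norm_restrict_le) simp
  finally show "act (proj E f) a \<le> norm f * su_norm a" .
qed simp

text \<open>
  Averages of \<open>4 ^ n\<close> of the vectors are flat enough for the sum of \<open>n\<close> averages to have norm at most
  4, and on each average the functional is still at least \<open>\<delta>\<close>.
\<close>

lemma act_successive_le_norm:
  assumes succ: "\<And>i j a b. i < j \<Longrightarrow> j < n * 4 ^ n \<Longrightarrow> a \<in> supp (z i) \<Longrightarrow> b \<in> supp (z j) \<Longrightarrow> a < b"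
    and z: "\<And>i. i < n * 4 ^ n \<Longrightarrow> su_norm (z i) \<le> 1"
    and \<delta>: "\<And>i. i < n * 4 ^ n \<Longrightarrow> \<delta> \<le> act f (z i)"
  shows "real n * \<delta> \<le> 4 * norm f"
proof -
  define B where "B = (4::nat) ^ n"
  have B: "0 < B" by (simp add: B_def)
  have idx: "i * B + j < n * B" if "i < n" "j < B" for i j
  proof -
    have "i * B + j < Suc i * B" using that by simp
    also have "\<dots> \<le> n * B" using that by (intro mult_right_mono) auto
    finally show ?thesis .
  qed
  define g where "g i = (\<Sum>j<B. (1 / real B) *\<^sub>R z (i * B + j))" for i
  have supp_g: "\<exists>j<B. a \<in> supp (z (i * B + j))" if "a \<in> supp (g i)" for a i
  proof (rule ccontr)
    assume "\<not> ?thesis"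
    then have "coef (g i) a = 0"
      unfolding g_def lookup_sum by (intro sum.neutral) (auto simp: lookup_scaleR_c00 in_keys_iff)
    then show False using that by (simp add: in_keys_iff)
  qed
  have "su_norm (\<Sum>i<n. g i) \<le> 4"
  proof (rule su_norm_flat_sum_le)
    fix i j a b assume ij: "i < j" "j < n" and a: "a \<in> supp (g i)" and b: "b \<in> supp (g j)"
    obtain i' j' where ij': "i' < B" "a \<in> supp (z (i * B + i'))" "j' < B" "b \<in> supp (z (j * B + j'))"
      using supp_g[OF a] supp_g[OF b] by blast
    have "i * B + i' < Suc i * B" using ij' by simp
    also have "\<dots> \<le> j * B" using ij by (intro mult_right_mono) auto
    finally have "i * B + i' < j * B + j'" by simp
    then show "a < b" using succ[of "i * B + i'" "j * B + j'" a b] idx[OF ij(2) ij'(3)] ij'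
      by (simp add: B_def)
  next
    fix i assume i: "i < n"
    have "su_norm (g i) \<le> (\<Sum>j<B. su_norm ((1 / real B) *\<^sub>R z (i * B + j)))"
      unfolding g_def by (rule su_norm_sum_le)
    also have "\<dots> \<le> (\<Sum>j<B. 1 / real B)"
      using z idx[OF i] B by (intro sum_mono) (auto simp: su_norm_scaleR B_def divide_right_mono)
    also have "\<dots> = 1" using B by simp
    finally show "su_norm (g i) \<le> 1" .
    fix l
    have "\<bar>coef (g i) l\<bar> \<le> 1 / real B"
      unfolding g_def
    proof (rule coef_disjoint_sum_le)
      fix j j' assume j: "j \<in> {..<B}" "j' \<in> {..<B}" "j \<noteq> j'"
      show "supp ((1 / real B) *\<^sub>R z (i * B + j)) \<inter> supp ((1 / real B) *\<^sub>R z (i * B + j')) = {}"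
      proof (rule ccontr)
        assume "\<not> ?thesis"
        then obtain a where a: "a \<in> supp (z (i * B + j))" "a \<in> supp (z (i * B + j'))"
          by (auto simp: in_keys_iff lookup_scaleR_c00)
        show False
          using succ[of "i * B + j" "i * B + j'" a a] succ[of "i * B + j'" "i * B + j" a a] a j
            idx[OF i, of j] idx[OF i, of j'] by (auto simp: B_def neq_iff)
      qed
    next
      fix j assume j: "j \<in> {..<B}"
      have "\<bar>coef (z (i * B + j)) l\<bar> \<le> 1"
        using lookup_le_su_norm[of "z (i * B + j)" l] z[of "i * B + j"] idx[OF i, of j] j
        by (simp add: B_def)
      then show "\<bar>coef ((1 / real B) *\<^sub>R z (i * B + j)) l\<bar> \<le> 1 / real B"
        using B by (simp add: lookup_scaleR_c00 abs_mult field_simps)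
    qed (use B in auto)
    also have "1 / real B = (1/4) ^ n" by (simp add: B_def power_one_over)
    also have "\<dots> \<le> (1/4) ^ (n - i)" by (rule power_decreasing) auto
    finally show "\<bar>coef (g i) l\<bar> \<le> (1/4) ^ (n - i)" .
  qed
  then have upper: "act f (\<Sum>i<n. g i) \<le> norm f * 4"
    using act_le[of f "\<Sum>i<n. g i"] mult_left_mono[of "su_norm (\<Sum>i<n. g i)" 4 "norm f"] by simp
  have "\<delta> \<le> act f (g i)" if i: "i < n" for i
  proof -
    have "\<delta> = (\<Sum>j<B. (1 / real B) * \<delta>)" using B by simp
    also have "\<dots> \<le> (\<Sum>j<B. (1 / real B) * act f (z (i * B + j)))"
      using \<delta> idx[OF i] B by (intro sum_mono mult_left_mono) (auto simp: B_def)
    finally show ?thesis by (simp add: g_def act_sum act_scaleR)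
  qed
  then have "(\<Sum>i<n. \<delta>) \<le> (\<Sum>i<n. act f (g i))" by (intro sum_mono) simp
  then show ?thesis using upper by (simp add: act_sum)
qed

text \<open>
  The unit vectors form a shrinking basis of \<open>X\<close>: otherwise a functional would be bounded below on infinitely
  many successive vectors of norm at most 1, which \<open>act_successive_le_norm\<close> excludes.
\<close>

lemma functional_tail_small:
  assumes \<epsilon>: "0 < \<epsilon>"
  shows "\<exists>m. norm (proj {m..} f) \<le> \<epsilon>"
proof (rule ccontr)
  assume "\<not> ?thesis"
  then have large: "\<epsilon> < norm (proj {m..} f)" for m by (simp add: not_le)
  have "\<exists>a m'. su_norm a \<le> 1 \<and> \<epsilon> < act f a \<and> supp a \<subseteq> {m..<m'} \<and> m < m'" for m
  proof -
    obtain a where a: "su_norm a \<le> 1" "\<epsilon> < act (proj {m..} f) a"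
      using functional_almost_attains_norm[OF less_imp_le[OF \<epsilon>] large] by blast
    obtain m' where m': "\<And>i. i \<in> insert m (supp a) \<Longrightarrow> i < m'"
      using finite_nat_set_iff_bounded[of "insert m (supp a)"] by auto
    have "supp (restrict_c00 {m..} a) \<subseteq> {m..<m'}" using m' by (auto simp: keys_restrict_c00)
    moreover have "su_norm (restrict_c00 {m..} a) \<le> 1" using su_norm_restrict_le[of "{m..}" a] a(1) by simp
    ultimately show ?thesis using a(2) m'[of m] unfolding act_proj by blast
  qed
  then obtain a m' where step: "\<And>m. su_norm (a m) \<le> 1 \<and> \<epsilon> < act f (a m) \<and> supp (a m) \<subseteq> {m..<m' m} \<and> m < m' m"
    by metis
  define M where "M = rec_nat 0 (\<lambda>_. m')"
  have MS: "M (Suc k) = m' (M k)" for k by (simp add: M_def)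
  have M: "strict_mono M" using step by (auto simp: strict_mono_Suc_iff MS)
  define z where "z k = a (M k)" for k
  have z: "su_norm (z k) \<le> 1" "\<epsilon> < act f (z k)" "supp (z k) \<subseteq> {M k..<M (Suc k)}" for k
    using step[of "M k"] by (auto simp: z_def MS)
  have "real n * \<epsilon> \<le> 4 * norm f" for n
  proof (rule act_successive_le_norm)
    fix i j a b assume "i < j" and a: "a \<in> supp (z i)" and b: "b \<in> supp (z j)"
    then have "M (Suc i) \<le> M j" using M by (simp add: strict_mono_less_eq)
    moreover have "a < M (Suc i)" "M j \<le> b" using z(3)[of i] z(3)[of j] a b by auto
    ultimately show "a < b" by linarith
  qed (use z(1) less_imp_le[OF z(2)] in simp_all)
  moreover obtain n :: nat where "4 * norm f / \<epsilon> < real n" using reals_Archimedean2 by blast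
  ultimately show False using \<epsilon> by (metis not_le pos_divide_less_eq)
qed

section \<open>Symmetric sequences of block functionals\<close>

lemma act_restrict_eq:
  assumes "\<And>i. i \<in> supp a \<Longrightarrow> entry f i \<noteq> 0 \<Longrightarrow> i \<in> E"
  shows "act f (restrict_c00 E a) = act f a"
proof -
  have "act f (restrict_c00 E a) = (\<Sum>i\<in>supp a. coef (restrict_c00 E a) i * entry f i)"
    by (rule act_expansion) (auto simp: keys_restrict_c00)
  also have "\<dots> = (\<Sum>i\<in>supp a. coef a i * entry f i)"
    using assms by (intro sum.cong) (auto simp: lookup_restrict_c00)
  also have "\<dots> = act f a" by (rule act_expansion[symmetric]) auto
  finally show ?thesis .
qed

lemma act_eq_0:
  assumes "\<And>i. i \<in> supp a \<Longrightarrow> entry f i = 0"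
  shows "act f a = 0"
  using assms by (subst act_expansion[of "supp a"]) auto

text \<open>
  A vector of norm at most 1 has boundedly many coefficients above \<open>\<eta>\<close>, and a sufficiently flat functional does not
  see boundedly many coordinates.
\<close>

lemma act_drop_large_coefs:
  assumes "0 < \<eta>" "0 < \<delta>"
  shows "\<exists>\<omega>>0. \<forall>f v. (\<forall>i. \<bar>entry f i\<bar> \<le> \<omega>) \<longrightarrow> su_norm v \<le> 1 \<longrightarrow>
           act f v - \<delta> \<le> act f (restrict_c00 {i. \<bar>coef v i\<bar> \<le> \<eta>} v)"
proof -
  obtain M :: nat where M: "\<And>v. su_norm v \<le> 1 \<Longrightarrow> card {i. \<eta> < \<bar>coef v i\<bar>} \<le> M"
    using su_norm_card_large_coef[OF assms(1)] by blast
  define \<omega> where "\<omega> = \<delta> / (real M + 1)"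
  have \<omega>: "0 < \<omega>" using assms(2) by (simp add: \<omega>_def)
  have "act f v - \<delta> \<le> act f (restrict_c00 {i. \<bar>coef v i\<bar> \<le> \<eta>} v)"
    if f: "\<And>i. \<bar>entry f i\<bar> \<le> \<omega>" and v: "su_norm v \<le> 1" for f v
  proof -
    let ?A = "{i. \<eta> < \<bar>coef v i\<bar>}"
    have fin: "finite ?A"
      by (rule finite_subset[of _ "supp v"]) (use assms(1) in \<open>auto simp: in_keys_iff\<close>)
    have "v = restrict_c00 {i. \<bar>coef v i\<bar> \<le> \<eta>} v + restrict_c00 ?A v"
      by (rule poly_mapping_eqI) (simp add: lookup_add lookup_restrict_c00)
    then have "act f v = act f (restrict_c00 {i. \<bar>coef v i\<bar> \<le> \<eta>} v) + act f (restrict_c00 ?A v)"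
      by (metis act_add)
    moreover have "act f (restrict_c00 ?A v) \<le> \<delta>"
    proof -
      have "act f (restrict_c00 ?A v) = (\<Sum>i\<in>?A. coef v i * entry f i)"
        by (subst act_expansion[OF fin]) (auto simp: keys_restrict_c00 lookup_restrict_c00)
      also have "\<dots> \<le> (\<Sum>i\<in>?A. \<omega>)"
      proof (rule sum_mono)
        fix i
        have "\<bar>coef v i\<bar> \<le> 1" using lookup_le_su_norm[of v i] v by linarith
        then have "\<bar>coef v i\<bar> * \<bar>entry f i\<bar> \<le> 1 * \<omega>" using f[of i] by (intro mult_mono) auto
        then show "coef v i * entry f i \<le> \<omega>" using abs_ge_self[of "coef v i * entry f i"] by (simp add: abs_mult)
      qed
      also have "\<dots> \<le> real M * \<omega>" using M[OF v] \<omega> by (simp add: mult_right_mono)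
      also have "\<dots> \<le> \<delta>" using assms(2) by (simp add: \<omega>_def field_simps)
      finally show ?thesis .
    qed
    ultimately show ?thesis by linarith
  qed
  then show ?thesis using \<omega> by blast
qed

lemma symmetric_sums_two_injections:
  fixes u :: "nat \<Rightarrow> 'a::real_normed_vector"
  assumes sym: "\<And>J s b. finite J \<Longrightarrow> inj_on s J \<Longrightarrow>
      norm (\<Sum>i\<in>J. b i *\<^sub>R u (s i)) \<le> K * norm (\<Sum>i\<in>J. b i *\<^sub>R u i)"
    and "finite J" "inj_on s J" "inj_on t J"
  shows "norm (\<Sum>i\<in>J. b i *\<^sub>R u (s i)) \<le> K * norm (\<Sum>i\<in>J. b i *\<^sub>R u (t i))"
proof -
  define r where "r = inv_into J t"
  have r: "r (t i) = i" if "i \<in> J" for i using assms(4) that by (simp add: r_def)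
  have "inj_on (\<lambda>k. s (r k)) (t ` J)"
    using assms(3) r by (auto simp: inj_on_def)
  then have "norm (\<Sum>k\<in>t ` J. b (r k) *\<^sub>R u (s (r k))) \<le> K * norm (\<Sum>k\<in>t ` J. b (r k) *\<^sub>R u k)"
    using sym[of "t ` J" "\<lambda>k. s (r k)" "\<lambda>k. b (r k)"] assms(2) by simp
  then show ?thesis by (simp add: sum.reindex[OF assms(4)] r)
qed

text \<open>
  The symmetry is stated for injections of finite sets, which all extend to permutations; the blocks are
  bounded below but a priori not above.
\<close>

locale symmetric_blocks =
  fixes u :: "nat \<Rightarrow> (su_tsirelson_dual \<Rightarrow>\<^sub>L real)" and p :: "nat \<Rightarrow> nat" and c K :: real
  assumes p: "strict_mono p"
    and u_block: "\<And>j i. entry (u j) i \<noteq> 0 \<Longrightarrow> p j \<le> i \<and> i < p (Suc j)"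
    and c: "0 < c" "\<And>j. c \<le> norm (u j)"
    and sym: "\<And>J s b. finite J \<Longrightarrow> inj_on s J \<Longrightarrow>
      norm (\<Sum>i\<in>J. b i *\<^sub>R u (s i)) \<le> K * norm (\<Sum>i\<in>J. b i *\<^sub>R u i)"
begin

lemmas sym2 = symmetric_sums_two_injections[OF sym]

lemma norm_u_le: "norm (u j) \<le> K * norm (u 0)"
  using sym[of "{0}" "\<lambda>_. j" "\<lambda>_. 1"] by simp

lemma K_ge_1: "1 \<le> K"
  using norm_u_le[of 0] c(1) c(2)[of 0] by (auto simp: mult_le_cancel_right1)

lemma act_u_other:
  assumes "supp a \<subseteq> {p k..<p (Suc k)}" "j \<noteq> k"
  shows "act (u j) a = 0"
proof (rule act_eq_0, rule ccontr)
  fix i assume i: "i \<in> supp a" "entry (u j) i \<noteq> 0"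
  have "j = k"
    by (rule strict_mono_block_unique[OF p, of j i k]) (use u_block[OF i(2)] i(1) assms(1) in auto)
  then show False using assms(2) by simp
qed

text \<open>
  The sum of the first \<open>N\<close> blocks acts on a vector supported in the \<open>j\<close>-th interval as \<open>u j\<close> does, so it is bounded
  below on as many successive vectors as there are blocks.
\<close>

lemma block_sums_unbounded: "\<exists>N. R < norm (\<Sum>j<N. u j)"
proof -
  have "\<exists>z. su_norm z \<le> 1 \<and> c / 2 < act (u j) z \<and> supp z \<subseteq> {p j..<p (Suc j)}" for j
  proof -
    obtain a where a: "su_norm a \<le> 1" "c / 2 < act (u j) a"
      using functional_almost_attains_norm[of "c / 2" "u j"] c(1) c(2)[of j] by force
    let ?z = "restrict_c00 {p j..<p (Suc j)} a"
    have "act (u j) ?z = act (u j) a" by (rule act_restrict_eq) (use u_block in force)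
    moreover have "su_norm ?z \<le> 1" using su_norm_restrict_le a(1) by (rule order_trans)
    ultimately show ?thesis using a(2) by (intro exI[of _ ?z]) (simp add: keys_restrict_c00)
  qed
  then obtain z where z: "\<And>j. su_norm (z j) \<le> 1 \<and> c / 2 < act (u j) (z j) \<and> supp (z j) \<subseteq> {p j..<p (Suc j)}"
    by metis
  obtain n :: nat where n: "8 * max R 0 / c < real n" using reals_Archimedean2 by blast
  define N where "N = n * 4 ^ n"
  have "real n * (c / 2) \<le> 4 * norm (\<Sum>j<N. u j)"
  proof (rule act_successive_le_norm)
    fix i j a b assume "i < j" and a: "a \<in> supp (z i)" and b: "b \<in> supp (z j)"
    then have "p (Suc i) \<le> p j" using p by (simp add: strict_mono_less_eq)
    moreover have "a < p (Suc i)" "p j \<le> b" using z[of i] z[of j] a b by auto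
    ultimately show "a < b" by linarith
  next
    fix k assume "k < n * 4 ^ n"
    then have k: "k < N" by (simp add: N_def)
    have "act (\<Sum>j<N. u j) (z k) = (\<Sum>j<N. act (u j) (z k))" by (simp add: act_left)
    also have "\<dots> = (\<Sum>j\<in>{k}. act (u j) (z k))"
      using k z[of k] by (intro sum.mono_neutral_right) (auto intro!: act_u_other)
    finally show "c / 2 \<le> act (\<Sum>j<N. u j) (z k)" using z[of k] by simp
  qed (use z in blast)
  moreover have "8 * max R 0 < real n * c" using n c(1) by (simp add: field_simps)
  ultimately have "R < norm (\<Sum>j<N. u j)" by linarith
  then show ?thesis by blast
qed

lemma entry_sum_le:
  assumes A: "finite A" "inj_on s A"
  shows "\<bar>entry (\<Sum>j\<in>A. u (s j)) i\<bar> \<le> K * norm (u 0)"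
proof (cases "\<exists>j\<in>A. entry (u (s j)) i \<noteq> 0")
  case True
  then obtain j where j: "j \<in> A" "entry (u (s j)) i \<noteq> 0" by blast
  have "entry (u (s k)) i = 0" if "k \<in> A - {j}" for k
  proof (rule ccontr)
    assume k: "entry (u (s k)) i \<noteq> 0"
    have "s j = s k"
      by (rule strict_mono_block_unique[OF p, of _ i]) (use u_block[OF k] u_block[OF j(2)] in auto)
    then show False using A(2) j(1) that by (auto simp: inj_on_def)
  qed
  then have "(\<Sum>k\<in>A. entry (u (s k)) i) = (\<Sum>k\<in>{j}. entry (u (s k)) i)"
    using A(1) j(1) by (intro sum.mono_neutral_right) auto
  then show ?thesis using entry_le[of "u (s j)" i] norm_u_le[of "s j"] by (simp add: entry_left)
next
  case False
  then have "(\<Sum>k\<in>A. entry (u (s k)) i) = 0" by (intro sum.neutral) auto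
  then show ?thesis using K_ge_1 by (simp add: entry_left)
qed

end


text \<open>
  The consecutive intervals \<open>{S k..<S (Suc k)}\<close> are so long that the normalized sums of the \<open>u j\<close> over them
  are as flat as both estimates require: flat compared with \<open>(1/4) ^ Suc k\<close> for the lower estimate, and flat
  compared with the position \<open>p (S k)\<close> where the \<open>k\<close>-th sum starts for the upper one.  The last
  assumption expresses flatness through its effect, that such functionals are normed by vectors with coefficients at
  most \<open>\<eta> k\<close>, up to the error \<open>\<delta>\<close>.
\<close>

locale flat_symmetric_blocks = symmetric_blocks +
  fixes S :: "nat \<Rightarrow> nat" and \<eta> :: "nat \<Rightarrow> real" and \<delta> \<tau> :: real
  assumes S: "strict_mono S" "S 0 = 0"
    and \<eta>: "\<And>k. 0 < \<eta> k" "\<And>k. \<eta> k \<le> (1/4) ^ Suc k" "\<And>k. real (p (S k)) * \<eta> k \<le> \<tau>"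
    and sum_pos: "\<And>k. 0 < norm (\<Sum>j<S (Suc k) - S k. u j)"
    and flat: "\<And>k f v. (\<And>i. \<bar>entry f i\<bar> \<le> K * norm (u 0) / norm (\<Sum>j<S (Suc k) - S k. u j)) \<Longrightarrow>
      su_norm v \<le> 1 \<Longrightarrow> act f v - \<delta> \<le> act f (restrict_c00 {i. \<bar>coef v i\<bar> \<le> \<eta> k} v)"
begin

definition \<phi> :: "nat \<Rightarrow> real" where "\<phi> k = norm (\<Sum>j<S (Suc k) - S k. u j)"

text \<open>
  The argument \<open>s\<close> rearranges the \<open>u j\<close>; the normalization \<open>\<phi> k\<close> does not depend on it.
\<close>

definition w :: "(nat \<Rightarrow> nat) \<Rightarrow> nat \<Rightarrow> (su_tsirelson_dual \<Rightarrow>\<^sub>L real)" where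
  "w s k = (1 / \<phi> k) *\<^sub>R (\<Sum>j\<in>{S k..<S (Suc k)}. u (s j))"

lemma \<phi>_pos: "0 < \<phi> k" unfolding \<phi>_def by (rule sum_pos)

lemma S_le: "S k \<le> S (Suc k)" using S(1) by (simp add: strict_mono_less_eq)

lemma sum_S_shift: "(\<Sum>j\<in>{S k..<S (Suc k)}. f j) = (\<Sum>j<S (Suc k) - S k. f (S k + j))"
  for f :: "nat \<Rightarrow> 'x::comm_monoid_add"
  using sum.shift_bounds_nat_ivl[of f 0 "S k" "S (Suc k) - S k"] S_le[of k]
  by (simp add: atLeast0LessThan add.commute)

lemma norm_w:
  assumes s: "inj_on s {S k..<S (Suc k)}"
  shows "1 / K \<le> norm (w s k)" "norm (w s k) \<le> K"
proof -
  define L where "L = S (Suc k) - S k"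
  define X where "X = norm (\<Sum>j<L. u (s (S k + j)))"
  have inj: "inj_on (\<lambda>j. s (S k + j)) {..<L}"
  proof (rule inj_onI)
    fix x y assume "x \<in> {..<L}" "y \<in> {..<L}" "s (S k + x) = s (S k + y)"
    then show "x = y" using inj_onD[OF s, of "S k + x" "S k + y"] by (simp add: L_def)
  qed
  have "X \<le> K * \<phi> k" "\<phi> k \<le> K * X"
    using sym2[of "{..<L}" "\<lambda>j. s (S k + j)" "\<lambda>j. j" "\<lambda>_. 1"]
      sym2[of "{..<L}" "\<lambda>j. j" "\<lambda>j. s (S k + j)" "\<lambda>_. 1"] inj
    by (simp_all add: X_def \<phi>_def L_def)
  then have "1 / K \<le> X / \<phi> k" "X / \<phi> k \<le> K"
    using \<phi>_pos[of k] K_ge_1 by (simp_all add: field_simps)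
  moreover have "norm (w s k) = X / \<phi> k"
    using \<phi>_pos[of k] by (simp add: w_def sum_S_shift X_def L_def)
  ultimately show "1 / K \<le> norm (w s k)" "norm (w s k) \<le> K" by simp_all
qed

lemma act_w_flat_part:
  assumes "inj_on s {S k..<S (Suc k)}" "su_norm v \<le> 1"
  shows "act (w s k) v - \<delta> \<le> act (w s k) (restrict_c00 {i. \<bar>coef v i\<bar> \<le> \<eta> k} v)"
proof (rule flat[OF _ assms(2)])
  fix i
  have "\<bar>entry (\<Sum>j\<in>{S k..<S (Suc k)}. u (s j)) i\<bar> \<le> K * norm (u 0)"
    by (rule entry_sum_le) (use assms in auto)
  then have "\<bar>entry (w s k) i\<bar> \<le> K * norm (u 0) / \<phi> k"
    using \<phi>_pos[of k] by (simp add: w_def entry_left(3) abs_mult divide_right_mono)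
  then show "\<bar>entry (w s k) i\<bar> \<le> K * norm (u 0) / norm (\<Sum>j<S (Suc k) - S k. u j)" by (simp add: \<phi>_def)
qed

lemma entry_w_nonzero:
  assumes "entry (w s k) i \<noteq> 0"
  shows "\<exists>j\<in>{S k..<S (Suc k)}. p (s j) \<le> i \<and> i < p (Suc (s j))"
proof (rule ccontr)
  assume "\<not> ?thesis"
  then have "(\<Sum>j\<in>{S k..<S (Suc k)}. entry (u (s j)) i) = 0"
    using u_block by (intro sum.neutral) blast
  then show False using assms by (simp add: w_def entry_left)
qed

text \<open>
  Reverse the order of all \<open>u j\<close> with \<open>j < S n\<close>.  The sums \<open>w s k\<close> then occur with the flattest one
  leftmost, so vectors that norm them and are as flat add up to a vector of norm at most 4.
  Symmetry carries the estimate back to the original order.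
\<close>

lemma lower_l1_estimate:
  assumes \<delta>: "\<delta> \<le> 1 / (4 * K)" and a: "\<And>k. k < n \<Longrightarrow> 0 \<le> a k"
  shows "(\<Sum>k<n. a k) \<le> 16 * K\<^sup>2 * norm (\<Sum>k<n. a k *\<^sub>R w (\<lambda>j. j) k)"
proof -
  \<comment> \<open>The order reversing permutation of \<open>{..<S n}\<close>.\<close>
  define s where "s j = S n - Suc j" for j
  have inj: "inj_on s {..<S n}" by (auto simp: inj_on_def s_def)
  have S_n: "S (Suc k) \<le> S n" if "k < n" for k using S(1) that by (simp add: strict_mono_less_eq)
  have injk: "inj_on s {S k..<S (Suc k)}" if "k < n" for k
    by (rule inj_on_subset[OF inj]) (use S_n[OF that] in auto)
  define E where "E k = {p (S n - S (Suc k))..<p (S n - S k)}" for k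
  have E: "i \<in> E k" if nz: "entry (w s k) i \<noteq> 0" and k: "k < n" for k i
  proof -
    obtain j where j: "S k \<le> j" "j < S (Suc k)" "p (s j) \<le> i" "i < p (Suc (s j))"
      using entry_w_nonzero[OF nz] by auto
    have "S n - S (Suc k) \<le> s j" "Suc (s j) \<le> S n - S k"
      using j(1,2) S_n[OF k] by (auto simp: s_def)
    then have "p (S n - S (Suc k)) \<le> p (s j)" "p (Suc (s j)) \<le> p (S n - S k)"
      using p by (simp_all add: strict_mono_less_eq)
    then show ?thesis using j(3,4) by (simp add: E_def)
  qed
  have E_less: "i < i'" if "k < k'" "k' < n" "i \<in> E k'" "i' \<in> E k" for k k' i i'
  proof -
    have "S (Suc k) \<le> S k'" using S(1) that(1) by (simp add: strict_mono_less_eq)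
    then have "p (S n - S k') \<le> p (S n - S (Suc k))" using p by (simp add: strict_mono_less_eq)
    then show ?thesis using that(3,4) by (simp add: E_def)
  qed
  have "\<exists>v. su_norm v \<le> 1 \<and> 1 / (4 * K) \<le> act (w s k) v \<and> supp v \<subseteq> E k \<and> (\<forall>l. \<bar>coef v l\<bar> \<le> \<eta> k)"
    if k: "k < n" for k
  proof -
    have "1 / (2 * K) < 1 / K" using K_ge_1 by (simp add: field_simps)
    then have "1 / (2 * K) < norm (w s k)" using norm_w(1)[OF injk[OF k]] by linarith
    then obtain v where v: "su_norm v \<le> 1" "1 / (2 * K) < act (w s k) v"
      using functional_almost_attains_norm[of "1 / (2 * K)" "w s k"] K_ge_1 by force
    define v' where "v' = restrict_c00 {i. \<bar>coef v i\<bar> \<le> \<eta> k} v"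
    have "act (w s k) v - \<delta> \<le> act (w s k) v'"
      unfolding v'_def by (rule act_w_flat_part[OF injk[OF k] v(1)])
    moreover have "1 / (2 * K) = 1 / (4 * K) + 1 / (4 * K)" by simp
    ultimately have "1 / (4 * K) \<le> act (w s k) v'" using v(2) \<delta> by linarith
    moreover have "act (w s k) (restrict_c00 (E k) v') = act (w s k) v'"
      by (rule act_restrict_eq) (use E k in blast)
    moreover have "su_norm (restrict_c00 (E k) v') \<le> 1"
      using su_norm_restrict_le[of "E k" v'] su_norm_restrict_le[of "{i. \<bar>coef v i\<bar> \<le> \<eta> k}" v] v(1)
      unfolding v'_def by linarith
    moreover have "\<bar>coef (restrict_c00 (E k) v') l\<bar> \<le> \<eta> k" for l
      using \<eta>(1)[of k] by (simp add: v'_def lookup_restrict_c00)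
    ultimately show ?thesis by (intro exI[of _ "restrict_c00 (E k) v'"]) (simp add: keys_restrict_c00)
  qed
  then obtain v where v: "\<And>k. k < n \<Longrightarrow> su_norm (v k) \<le> 1" "\<And>k. k < n \<Longrightarrow> 1 / (4 * K) \<le> act (w s k) (v k)"
    "\<And>k. k < n \<Longrightarrow> supp (v k) \<subseteq> E k" "\<And>k l. k < n \<Longrightarrow> \<bar>coef (v k) l\<bar> \<le> \<eta> k"
    by metis
  \<comment> \<open>From left to right the vectors are \<open>v (n - 1), \<dots>, v 0\<close>.\<close>
  have "su_norm (\<Sum>i<n. v (n - Suc i)) \<le> 4"
  proof (rule su_norm_flat_sum_le)
    fix i j a b assume "i < j" "j < n" "a \<in> supp (v (n - Suc i))" "b \<in> supp (v (n - Suc j))"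
    then show "a < b"
      using E_less[of "n - Suc j" "n - Suc i" a b] v(3)[of "n - Suc i"] v(3)[of "n - Suc j"] by force
  next
    fix i l assume i: "i < n"
    have "\<bar>coef (v (n - Suc i)) l\<bar> \<le> \<eta> (n - Suc i)" using v(4)[of "n - Suc i" l] i by simp
    also have "\<dots> \<le> (1/4) ^ Suc (n - Suc i)" by (rule \<eta>(2))
    also have "Suc (n - Suc i) = n - i" using i by simp
    finally show "\<bar>coef (v (n - Suc i)) l\<bar> \<le> (1/4) ^ (n - i)" .
  qed (use v(1) in simp)
  moreover have "(\<Sum>i<n. v (n - Suc i)) = (\<Sum>k<n. v k)" by (rule sum.nat_diff_reindex)
  ultimately have V: "su_norm (\<Sum>k<n. v k) \<le> 4" by simp
  have cross: "act (w s k) (v l) = 0" if "k < n" "l < n" "k \<noteq> l" for k l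
  proof (rule act_eq_0, rule ccontr)
    fix i assume "i \<in> supp (v l)" "entry (w s k) i \<noteq> 0"
    then have "i \<in> E l" "i \<in> E k" using v(3) E that by blast+
    then show False using E_less[of k l i i] E_less[of l k i i] that by (auto simp: neq_iff)
  qed
  define Y where "Y = (\<Sum>k<n. a k *\<^sub>R w s k)"
  have "(\<Sum>k<n. a k) / (4 * K) = (\<Sum>k<n. a k * (1 / (4 * K)))" by (simp add: sum_divide_distrib)
  also have "\<dots> \<le> (\<Sum>k<n. a k * act (w s k) (v k))"
    using a v(2) by (intro sum_mono mult_left_mono) auto
  also have "\<dots> = (\<Sum>k<n. \<Sum>l<n. a k * act (w s k) (v l))"
  proof (intro sum.cong refl)
    fix k assume "k \<in> {..<n}"
    then have "(\<Sum>l<n. a k * act (w s k) (v l)) = (\<Sum>l\<in>{k}. a k * act (w s k) (v l))"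
      by (intro sum.mono_neutral_right) (auto simp: cross)
    then show "a k * act (w s k) (v k) = (\<Sum>l<n. a k * act (w s k) (v l))" by simp
  qed
  also have "\<dots> = act Y (\<Sum>l<n. v l)"
    unfolding Y_def act_left(4) act_left(3) act_sum sum_distrib_left by (rule sum.swap)
  also have "\<dots> \<le> norm Y * su_norm (\<Sum>l<n. v l)" using act_le[of Y "\<Sum>l<n. v l"] by simp
  also have "\<dots> \<le> norm Y * 4" by (intro mult_left_mono V) simp
  finally have "(\<Sum>k<n. a k) \<le> 16 * K * norm Y" using K_ge_1 by (simp add: field_simps)
  moreover have "norm Y \<le> K * norm (\<Sum>k<n. a k *\<^sub>R w (\<lambda>j. j) k)"
  proof -
    define blk where "blk i = (THE k. S k \<le> i \<and> i < S (Suc k))" for i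
    have blk: "blk (S k + i) = k" if "i < S (Suc k) - S k" for i k
      unfolding blk_def using that by (intro the1_equality strict_mono_block_ex1 S) auto
    define b where "b j = a (blk j) / \<phi> (blk j)" for j
    have "(\<Sum>j<S n. b j *\<^sub>R u (t j)) = (\<Sum>k<n. a k *\<^sub>R w t k)" for t
      unfolding sum_lessThan_blocks[OF S] w_def sum_S_shift
      by (simp add: b_def blk scaleR_sum_right)
    then show ?thesis
      using sym[of "{..<S n}" s b] inj unfolding Y_def by simp
  qed
  ultimately have "(\<Sum>k<n. a k) \<le> 16 * K * (K * norm (\<Sum>k<n. a k *\<^sub>R w (\<lambda>j. j) k))"
    using K_ge_1 by (meson mult_left_mono order_trans zero_le_mult_iff zero_le_numeral zero_le_one)
  then show ?thesis by (simp add: power2_eq_square mult.assoc)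
qed


text \<open>
  A vector \<open>x\<close> that norms the combination of the \<open>w k\<close> with the weights \<open>a\<close> is flat on the \<open>k\<close>-th interval,
  up to an error.  A move to the left almost attains the norm of that part of \<open>x\<close>; deleting the places to
  the left of the interval loses little, by flatness, and afterwards the moves for different \<open>k\<close>
  use disjoint intervals and combine to a single one.  So the value at \<open>x\<close> is at most a multiple of the norm of a
  weighted sum of blocks in $T$, which the weights make small.
\<close>

lemma flat_symmetric_blocks_impossible:
  assumes \<delta>: "\<delta> = 1 / (128 * K\<^sup>2)" and \<tau>: "\<tau> = 1 / (256 * K ^ 3)"
  shows False
proof -
  \<comment> \<open>Half of the constant in the lower estimate.\<close>
  define \<theta> where "\<theta> = 1 / (32 * K\<^sup>2)"
  have K: "0 < K" "1 \<le> K" using K_ge_1 by auto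
  have \<theta>: "0 < \<theta>" "\<delta> = \<theta> / 4" "\<tau> = \<theta> / (8 * K)"
    using K by (simp_all add: \<theta>_def \<delta> \<tau> power2_eq_square power3_eq_cube)
  have "\<delta> \<le> 1 / (4 * K)"
    using K by (simp add: \<delta> power2_eq_square field_simps)
  note lower = lower_l1_estimate[OF this]
  define h where "h k = p (S k)" for k
  have h: "strict_mono h" using p S(1) by (simp add: h_def strict_mono_def)
  obtain n a where a: "convex_weights n a" and
    upper: "\<And>U. tsirelson_blocks h U \<Longrightarrow> tsirelson_norm (\<Sum>k<n. a k *\<^sub>R U k) \<le> \<theta> / (4 * K)"
    using tsirelson_blocks_average_small[of "\<theta> / (4 * K)" h] \<theta> K h by auto
  have a0: "\<And>k. k < n \<Longrightarrow> 0 \<le> a k" and a1: "(\<Sum>k<n. a k) = 1" using a by (auto simp: convex_weights_def)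
  let ?w = "w (\<lambda>j. j)"
  have "1 \<le> 16 * K\<^sup>2 * norm (\<Sum>k<n. a k *\<^sub>R ?w k)" using lower[of n a] a0 a1 by simp
  then have "2 * \<theta> \<le> norm (\<Sum>k<n. a k *\<^sub>R ?w k)"
    using K by (simp add: \<theta>_def field_simps)
  then obtain x where x: "su_norm x \<le> 1" "\<theta> < act (\<Sum>k<n. a k *\<^sub>R ?w k) x"
    using functional_almost_attains_norm[of \<theta> "\<Sum>k<n. a k *\<^sub>R ?w k"] \<theta>(1) by force
  define r where "r k = act (?w k) x" for k
  define A where "A k = {i. h k \<le> i \<and> i < h (Suc k) \<and> \<bar>coef x i\<bar> \<le> \<eta> k}" for k
  define C where "C k = (r k - \<delta>) / K - \<tau>" for k
  have "\<exists>s y. strict_mono s \<and> tsirelson_norm y \<le> 1 \<and>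
      C k < (\<Sum>l\<in>supp y. coef (restrict_c00 (A k) x) (s l) * coef y l)" for k
  proof -
    have "act (?w k) x - \<delta> \<le> act (?w k) (restrict_c00 {i. \<bar>coef x i\<bar> \<le> \<eta> k} x)"
      by (rule act_w_flat_part[OF _ x(1)]) simp
    also have "\<dots> = act (?w k) (restrict_c00 {h k..<h (Suc k)} (restrict_c00 {i. \<bar>coef x i\<bar> \<le> \<eta> k} x))"
    proof (rule act_restrict_eq[symmetric])
      fix i assume "entry (?w k) i \<noteq> 0"
      from entry_w_nonzero[OF this] obtain j where j: "S k \<le> j" "Suc j \<le> S (Suc k)" "p j \<le> i" "i < p (Suc j)"
        by auto
      then have "p (S k) \<le> p j" "p (Suc j) \<le> p (S (Suc k))"
        using strict_mono_less_eq[OF p] by blast+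
      then show "i \<in> {h k..<h (Suc k)}" using j(3,4) by (simp add: h_def)
    qed
    also have "restrict_c00 {h k..<h (Suc k)} (restrict_c00 {i. \<bar>coef x i\<bar> \<le> \<eta> k} x) = restrict_c00 (A k) x"
      by (rule poly_mapping_eqI) (simp add: lookup_restrict_c00 A_def)
    also have "act (?w k) (restrict_c00 (A k) x) \<le> norm (?w k) * su_norm (restrict_c00 (A k) x)"
      using act_le[of "?w k" "restrict_c00 (A k) x"] by simp
    also have "\<dots> \<le> K * su_norm (restrict_c00 (A k) x)"
      by (intro mult_right_mono norm_w(2) su_norm_nonneg) simp
    finally have "(r k - \<delta>) / K \<le> su_norm (restrict_c00 (A k) x)"
      using K by (simp add: r_def field_simps)
    moreover have "0 < \<tau>" using \<theta> K by simp
    ultimately have "\<not> su_norm (restrict_c00 (A k) x) \<le> C k" by (simp add: C_def)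
    then show ?thesis using su_norm_leI[of "restrict_c00 (A k) x" "C k"] by (meson not_le)
  qed
  then obtain s y where sy: "\<And>k. strict_mono (s k)" "\<And>k. tsirelson_norm (y k) \<le> 1"
    "\<And>k. C k < (\<Sum>l\<in>supp (y k). coef (restrict_c00 (A k) x) (s k l) * coef (y k) l)"
    by metis
  \<comment> \<open>The places of \<open>y k\<close> to the left of \<open>h k\<close> are deleted.  Since \<open>l \<le> s k l\<close>, the others lie in the interval that starts at \<open>h k\<close>.\<close>
  define L where "L k = {l \<in> supp (y k). h k \<le> l \<and> s k l \<in> A k}" for k
  define U where "U k = restrict_c00 (L k) (y k)" for k
  have fin: "finite (L k)" for k by (simp add: L_def)
  have L: "h k \<le> l \<and> l < h (Suc k)" if "l \<in> L k" for k l
  proof -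
    have "l \<le> s k l" using sy(1)[of k] by (rule strict_mono_imp_increasing)
    then show ?thesis using that by (simp add: L_def A_def)
  qed
  have U: "tsirelson_blocks h U"
    unfolding tsirelson_blocks_def
  proof (intro allI conjI subsetI)
    fix k l assume "l \<in> supp (U k)"
    then show "l \<in> {h k..<h (Suc k)}" using L[of l k] by (simp add: U_def keys_restrict_c00)
  next
    fix k show "tsirelson_norm (U k) \<le> 1"
      using tsirelson_norm_restrict_le[of "L k" "y k"] sy(2)[of k] by (simp add: U_def)
  qed
  define T where "T k = (\<Sum>l\<in>L k. coef x (s k l) * coef (U k) l)" for k
  have T: "C k - \<tau> \<le> T k" for k
  proof -
    let ?g = "\<lambda>l. coef (restrict_c00 (A k) x) (s k l) * coef (y k) l"
    have "(\<Sum>l\<in>supp (y k). ?g l) = (\<Sum>l\<in>supp (y k) \<inter> {..<h k}. ?g l) + (\<Sum>l\<in>supp (y k) - {..<h k}. ?g l)"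
      by (simp add: sum.Int_Diff)
    also have "(\<Sum>l\<in>supp (y k) - {..<h k}. ?g l) = T k"
      unfolding T_def by (rule sum.mono_neutral_cong_right) (auto simp: L_def U_def lookup_restrict_c00)
    also have "(\<Sum>l\<in>supp (y k) \<inter> {..<h k}. ?g l) \<le> \<tau>"
    proof -
      have "?g l \<le> \<eta> k" for l
      proof -
        have "\<bar>coef (restrict_c00 (A k) x) (s k l)\<bar> \<le> \<eta> k"
          using \<eta>(1)[of k] by (simp add: lookup_restrict_c00 A_def)
        moreover have "\<bar>coef (y k) l\<bar> \<le> 1"
          using lookup_le_tsirelson_norm[of "y k" l] sy(2)[of k] by linarith
        ultimately have "\<bar>?g l\<bar> \<le> \<eta> k * 1"
          unfolding abs_mult using \<eta>(1)[of k] by (intro mult_mono) auto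
        then show ?thesis by linarith
      qed
      then have "(\<Sum>l\<in>supp (y k) \<inter> {..<h k}. ?g l) \<le> real (card (supp (y k) \<inter> {..<h k})) * \<eta> k"
        using sum_bounded_above[of "supp (y k) \<inter> {..<h k}" ?g "\<eta> k"] by simp
      also have "\<dots> \<le> real (h k) * \<eta> k"
        using card_mono[of "{..<h k}" "supp (y k) \<inter> {..<h k}"] \<eta>(1)[of k]
        by (intro mult_right_mono) auto
      also have "\<dots> \<le> \<tau>" unfolding h_def by (rule \<eta>(3))
      finally show ?thesis .
    qed
    finally show ?thesis using sy(3)[of k] by linarith
  qed
  define blk where "blk l = (THE k. h k \<le> l \<and> l < h (Suc k))" for l
  have blk: "blk l = k" if "l \<in> L k" for l k
    unfolding blk_def using L[OF that] strict_mono_block_unique[OF h] by (intro the_equality) auto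
  \<comment> \<open>The combined move; it is increasing across the intervals because \<open>s k\<close> takes values in the \<open>k\<close>-th interval only.\<close>
  define S' where "S' l = s (blk l) l" for l
  have disj: "L k \<inter> L k' = {}" if "k \<noteq> k'" for k k' using blk that by blast
  have coefU: "coef (\<Sum>k<n. a k *\<^sub>R U k) l = a k * coef (U k) l" if "k < n" "l \<in> L k" for k l
  proof -
    have "coef (U k') l = 0" if "k' \<noteq> k" for k'
      using disj[OF that] \<open>l \<in> L k\<close> by (auto simp: U_def lookup_restrict_c00)
    then have "(\<Sum>k'<n. a k' * coef (U k') l) = (\<Sum>k'\<in>{k}. a k' * coef (U k') l)"
      using that(1) by (intro sum.mono_neutral_right) auto
    then show ?thesis by (simp add: lookup_sum lookup_scaleR_c00)
  qed
  have "(\<Sum>k<n. a k * T k) = (\<Sum>k<n. \<Sum>l\<in>L k. coef x (S' l) * coef (\<Sum>k<n. a k *\<^sub>R U k) l)"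
    by (intro sum.cong) (auto simp: T_def sum_distrib_left coefU S'_def blk mult_ac)
  also have "\<dots> = (\<Sum>l\<in>(\<Union>k<n. L k). coef x (S' l) * coef (\<Sum>k<n. a k *\<^sub>R U k) l)"
    by (rule sum.UNION_disjoint[symmetric]) (use fin disj in auto)
  also have "\<dots> \<le> su_norm x * tsirelson_norm (\<Sum>k<n. a k *\<^sub>R U k)"
  proof (rule su_pairing_le)
    fix i j assume "i \<in> (\<Union>k<n. L k)" "j \<in> (\<Union>k<n. L k)" and ij: "i < j"
    then obtain k k' where k: "i \<in> L k" "j \<in> L k'" by blast
    show "S' i < S' j"
    proof (cases "k = k'")
      case True
      then show ?thesis using k ij sy(1)[of k] by (simp add: S'_def blk strict_mono_less)
    next
      case False
      have "h k < h (Suc k')" using L[OF k(1)] L[OF k(2)] ij by linarith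
      then have "Suc k \<le> k'" using strict_mono_less[OF h] False by force
      then have "h (Suc k) \<le> h k'" using strict_mono_less_eq[OF h] by blast
      moreover have "S' i < h (Suc k)" "h k' \<le> S' j"
        using k by (simp_all add: S'_def blk) (simp_all add: L_def A_def)
      ultimately show ?thesis by linarith
    qed
  qed (use fin in auto)
  also have "\<dots> \<le> 1 * (\<theta> / (4 * K))"
    by (intro mult_mono x(1) upper U tsirelson_norm_nonneg) auto
  finally have small: "(\<Sum>k<n. a k * T k) \<le> \<theta> / (4 * K)" by simp
  have eq: "(\<Sum>k<n. a k * (C k - \<tau>)) = ((\<Sum>k<n. a k * r k) - \<delta>) / K - 2 * \<tau>"
  proof -
    have "a k * (C k - \<tau>) = a k * r k / K - (\<delta> / K + 2 * \<tau>) * a k" for k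
      by (simp add: C_def algebra_simps diff_divide_distrib)
    then have "(\<Sum>k<n. a k * (C k - \<tau>)) = (\<Sum>k<n. a k * r k) / K - (\<delta> / K + 2 * \<tau>) * (\<Sum>k<n. a k)"
      by (simp add: sum_subtractf sum_divide_distrib sum_distrib_left)
    then show ?thesis using a1 by (simp add: diff_divide_distrib)
  qed
  have "\<theta> < (\<Sum>k<n. a k * r k)"
    using x(2) by (simp add: r_def act_left)
  then have "(\<theta> - \<delta>) / K \<le> ((\<Sum>k<n. a k * r k) - \<delta>) / K"
    using K by (intro divide_right_mono) auto
  then have "(\<theta> - \<delta>) / K - 2 * \<tau> \<le> (\<Sum>k<n. a k * (C k - \<tau>))"
    unfolding eq by (rule diff_right_mono)
  also have "\<dots> \<le> (\<Sum>k<n. a k * T k)"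
    using a0 T by (intro sum_mono mult_left_mono) auto
  also note small
  also have "\<theta> / (4 * K) < (\<theta> - \<delta>) / K - 2 * \<tau>" using \<theta> K by (simp add: field_simps)
  finally show False by simp
qed

end

text \<open>
  The lengths of the intervals are chosen successively: how flat the \<open>k\<close>-th sum has to be depends on the place
  where it starts.
\<close>

theorem no_symmetric_blocks:
  assumes "symmetric_blocks u p c K"
  shows False
proof -
  interpret symmetric_blocks u p c K by (rule assms)
  define \<delta> \<tau> where "\<delta> = 1 / (128 * K\<^sup>2)" and "\<tau> = 1 / (256 * K ^ 3)"
  have pos: "0 < \<delta>" "0 < \<tau>" using K_ge_1 by (simp_all add: \<delta>_def \<tau>_def)
  \<comment> \<open>The first bound serves the lower estimate, the second one makes \<open>p m\<close> coefficients of this size negligible.\<close>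
  define \<eta> where "\<eta> m k = min ((1/4) ^ Suc k) (\<tau> / (real (p m) + 1))" for m k
  have \<eta>: "0 < \<eta> m k" "\<eta> m k \<le> (1/4) ^ Suc k" "real (p m) * \<eta> m k \<le> \<tau>" for m k
  proof -
    show "0 < \<eta> m k" using pos by (simp add: \<eta>_def)
    show "\<eta> m k \<le> (1/4) ^ Suc k" unfolding \<eta>_def by (rule min.cobounded1)
    have "real (p m) * \<eta> m k \<le> real (p m) * (\<tau> / (real (p m) + 1))"
      unfolding \<eta>_def by (intro mult_left_mono min.cobounded2) simp
    also have "\<dots> \<le> \<tau>" using pos by (simp add: field_simps)
    finally show "real (p m) * \<eta> m k \<le> \<tau>" .
  qed
  have "\<exists>N. 0 < norm (\<Sum>j<N. u j) \<and> (\<forall>f v. (\<forall>i. \<bar>entry f i\<bar> \<le> K * norm (u 0) / norm (\<Sum>j<N. u j)) \<longrightarrow>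
      su_norm v \<le> 1 \<longrightarrow> act f v - \<delta> \<le> act f (restrict_c00 {i. \<bar>coef v i\<bar> \<le> \<eta> m k} v))" for m k
  proof -
    obtain \<omega> where \<omega>: "0 < \<omega>" "\<And>f v. (\<And>i. \<bar>entry f i\<bar> \<le> \<omega>) \<Longrightarrow> su_norm v \<le> 1 \<Longrightarrow>
        act f v - \<delta> \<le> act f (restrict_c00 {i. \<bar>coef v i\<bar> \<le> \<eta> m k} v)"
      using act_drop_large_coefs[OF \<eta>(1)[of m k] pos(1)] by blast
    \<comment> \<open>The entries of a sum of blocks are bounded by \<open>K * norm (u 0)\<close>, so dividing by a large norm makes them small.\<close>
    obtain N where N: "K * norm (u 0) / \<omega> < norm (\<Sum>j<N. u j)" using block_sums_unbounded by blast
    have "0 \<le> K * norm (u 0) / \<omega>" using K_ge_1 \<omega>(1) by simp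
    then have N0: "0 < norm (\<Sum>j<N. u j)" using N by linarith
    then have "K * norm (u 0) / norm (\<Sum>j<N. u j) \<le> \<omega>" using N \<omega>(1) by (simp add: field_simps)
    then show ?thesis using N0 \<omega>(2) by (meson order_trans)
  qed
  then obtain N where N: "\<And>m k. 0 < norm (\<Sum>j<N m k. u j)"
    "\<And>m k f v. (\<And>i. \<bar>entry f i\<bar> \<le> K * norm (u 0) / norm (\<Sum>j<N m k. u j)) \<Longrightarrow>
      su_norm v \<le> 1 \<Longrightarrow> act f v - \<delta> \<le> act f (restrict_c00 {i. \<bar>coef v i\<bar> \<le> \<eta> m k} v)"
    by metis
  define S where "S = rec_nat 0 (\<lambda>k m. m + N m k)"
  have SS: "S (Suc k) = S k + N (S k) k" for k by (simp add: S_def)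
  have "0 < N m k" for m k using N(1)[of m k] by (cases "N m k") auto
  then have S: "strict_mono S" "S 0 = 0" by (auto simp: strict_mono_Suc_iff SS) (simp add: S_def)
  interpret flat_symmetric_blocks u p c K S "\<lambda>k. \<eta> (S k) k" \<delta> \<tau>
    by unfold_locales (use S \<eta> N in \<open>simp_all add: SS\<close>)
  show False by (rule flat_symmetric_blocks_impossible[OF \<delta>_def \<tau>_def])
qed

section \<open>From symmetric sequences to blocks\<close>

lemma bounded_double_sequence_diagonal:
  fixes g :: "nat \<Rightarrow> nat \<Rightarrow> real"
  assumes bound: "\<And>j i. \<bar>g j i\<bar> \<le> B"
  shows "\<exists>r. strict_mono r \<and> (\<forall>i. convergent (\<lambda>j. g (r j) i))"
proof -
  interpret subseqs "\<lambda>i r. convergent (\<lambda>j. g (r j) i)"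
  proof
    fix i and s :: "nat \<Rightarrow> nat"
    have "bounded (range (\<lambda>j. g (s j) i))"
      using bound by (intro boundedI[of _ B]) auto
    then obtain l r where "strict_mono r" "((\<lambda>j. g (s j) i) \<circ> r) \<longlonglongrightarrow> l"
      using bounded_imp_convergent_subsequence by blast
    then show "\<exists>r'. strict_mono r' \<and> convergent (\<lambda>j. g ((s \<circ> r') j) i)"
      by (intro exI[of _ r]) (auto simp: comp_def convergent_def)
  qed
  have "convergent (\<lambda>j. g (diagseq j) i)" for i
  proof -
    have "convergent (\<lambda>j. g ((diagseq \<circ> (+) (Suc i)) j) i)"
    proof (rule diagseq_holds)
      fix r s :: "nat \<Rightarrow> nat" and n assume "strict_mono r" "convergent (\<lambda>j. g (s j) n)"
      then show "convergent (\<lambda>j. g ((s \<circ> r) j) n)"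
        using convergent_subseq_convergent[of "\<lambda>j. g (s j) n" r] by (simp add: comp_def)
    qed
    then have "convergent (\<lambda>j. g (diagseq (j + Suc i)) i)" by (simp add: comp_def add.commute)
    then obtain l where "(\<lambda>j. g (diagseq (j + Suc i)) i) \<longlonglongrightarrow> l" by (blast dest: convergentD)
    then show ?thesis by (rule convergentI[OF LIMSEQ_offset])
  qed
  then show ?thesis using subseq_diagseq by blast
qed

text \<open>
  A combination of differences is a combination of the original sequence along the even and odd places.
\<close>

lemma symmetric_differences:
  fixes x :: "nat \<Rightarrow> 'a::real_normed_vector" and b :: "nat \<Rightarrow> real"
  assumes sym: "\<And>J s b. finite J \<Longrightarrow> inj_on s J \<Longrightarrow>
      norm (\<Sum>i\<in>J. b i *\<^sub>R x (s i)) \<le> K * norm (\<Sum>i\<in>J. b i *\<^sub>R x i)"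
    and r: "inj r" and J: "finite J" "inj_on s J"
  shows "norm (\<Sum>i\<in>J. b i *\<^sub>R (x (r (2 * s i)) - x (r (2 * s i + 1))))
       \<le> K * norm (\<Sum>i\<in>J. b i *\<^sub>R (x (r (2 * i)) - x (r (2 * i + 1))))"
proof -
  define J2 where "J2 = (\<lambda>i. 2 * i) ` J \<union> (\<lambda>i. 2 * i + 1) ` J"
  define b2 where "b2 k = (if even k then b (k div 2) else - b (k div 2))" for k
  define t where "t s k = r (2 * s (k div 2) + k mod 2)" for s :: "nat \<Rightarrow> nat" and k
  have sum: "(\<Sum>k\<in>J2. b2 k *\<^sub>R x (t s k)) = (\<Sum>i\<in>J. b i *\<^sub>R (x (r (2 * s i)) - x (r (2 * s i + 1))))"
    for s
  proof -
    have "(\<lambda>i. 2 * i) ` J \<inter> (\<lambda>i. 2 * i + 1) ` J = {}" by auto presburger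
    then have "(\<Sum>k\<in>J2. b2 k *\<^sub>R x (t s k)) =
        (\<Sum>k\<in>(\<lambda>i. 2 * i) ` J. b2 k *\<^sub>R x (t s k)) + (\<Sum>k\<in>(\<lambda>i. 2 * i + 1) ` J. b2 k *\<^sub>R x (t s k))"
      unfolding J2_def using J(1) by (intro sum.union_disjoint) auto
    also have "\<dots> = (\<Sum>i\<in>J. b i *\<^sub>R x (r (2 * s i))) + (\<Sum>i\<in>J. - b i *\<^sub>R x (r (2 * s i + 1)))"
      by (simp add: sum.reindex inj_on_def b2_def t_def)
    finally show ?thesis by (simp add: scaleR_diff_right sum_subtractf sum_negf)
  qed
  have inj: "inj_on (t s) J2" if s: "inj_on s J" for s
  proof (rule inj_onI)
    fix k l assume kl: "k \<in> J2" "l \<in> J2" "t s k = t s l"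
    then have eq: "2 * s (k div 2) + k mod 2 = 2 * s (l div 2) + l mod 2"
      using r unfolding t_def by (simp add: inj_eq)
    have "k mod 2 = (2 * s (k div 2) + k mod 2) mod 2" "l mod 2 = (2 * s (l div 2) + l mod 2) mod 2"
      by simp_all
    then have m: "k mod 2 = l mod 2" using eq by simp
    then have "s (k div 2) = s (l div 2)" using eq by simp
    moreover have "k div 2 \<in> J" "l div 2 \<in> J" using kl by (auto simp: J2_def)
    ultimately have "k div 2 = l div 2" using s by (simp add: inj_on_eq_iff)
    then show "k = l" using m by (metis div_mult_mod_eq)
  qed
  have fin: "finite J2" using J(1) by (simp add: J2_def)
  have "inj_on (\<lambda>i. i) J" by (simp add: inj_on_def)
  from symmetric_sums_two_injections[of x K J2 "t s" "t (\<lambda>i. i)" b2, OF sym fin inj[OF J(2)] inj[OF this]]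
  show ?thesis unfolding sum by simp
qed

lemma norm_proj_finite_le: "norm (proj {..<n} f) \<le> (\<Sum>i<n. \<bar>entry f i\<bar>)"
proof (rule norm_functional_le)
  fix a
  have "act (proj {..<n} f) a = (\<Sum>i<n. coef (restrict_c00 {..<n} a) i * entry f i)"
    unfolding act_proj by (rule act_expansion) (auto simp: keys_restrict_c00)
  also have "\<dots> \<le> (\<Sum>i<n. su_norm a * \<bar>entry f i\<bar>)"
  proof (rule sum_mono)
    fix i assume "i \<in> {..<n}"
    have "coef (restrict_c00 {..<n} a) i * entry f i \<le> \<bar>coef (restrict_c00 {..<n} a) i\<bar> * \<bar>entry f i\<bar>"
      by (metis abs_ge_self abs_mult)
    also have "\<dots> \<le> su_norm a * \<bar>entry f i\<bar>"
      using lookup_le_su_norm[of a i] su_norm_nonneg[of a]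
      by (intro mult_right_mono) (auto simp: lookup_restrict_c00)
    finally show "coef (restrict_c00 {..<n} a) i * entry f i \<le> su_norm a * \<bar>entry f i\<bar>" .
  qed
  finally show "act (proj {..<n} f) a \<le> (\<Sum>i<n. \<bar>entry f i\<bar>) * su_norm a"
    by (simp add: sum_distrib_left mult.commute)
qed (simp add: sum_nonneg)

lemma proj_split:
  assumes "m \<le> n"
  shows "f = proj {..<m} f + proj {m..<n} f + proj {n..} f"
proof (rule functional_eqI)
  fix a
  have "a = restrict_c00 {..<m} a + restrict_c00 {m..<n} a + restrict_c00 {n..} a"
    using assms by (intro poly_mapping_eqI) (auto simp: lookup_add lookup_restrict_c00)
  then have "act f a = act f (restrict_c00 {..<m} a + restrict_c00 {m..<n} a + restrict_c00 {n..} a)"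
    by simp
  then show "act f a = act (proj {..<m} f + proj {m..<n} f + proj {n..} f) a"
    by (simp add: act_left act_add act_proj)
qed

text \<open>
  A gliding hump: far out in the sequence the first coordinates are negligible, and tails always are.
\<close>

lemma null_sequence_block_approximation:
  fixes d :: "nat \<Rightarrow> (su_tsirelson_dual \<Rightarrow>\<^sub>L real)"
  assumes null: "\<And>i. (\<lambda>j. entry (d j) i) \<longlonglongrightarrow> 0" and \<epsilon>: "\<And>n. 0 < \<epsilon> n"
  shows "\<exists>r p u. strict_mono r \<and> strict_mono p \<and>
    (\<forall>n i. entry (u n) i \<noteq> 0 \<longrightarrow> p n \<le> i \<and> i < p (Suc n)) \<and> (\<forall>n. norm (d (r n) - u n) \<le> 2 * \<epsilon> n)"
proof -
  define G where "G n q j m \<longleftrightarrow> fst q < j \<and> snd q < m \<and>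
      norm (proj {..<snd q} (d j)) \<le> \<epsilon> n \<and> norm (proj {m..} (d j)) \<le> \<epsilon> n" for n q j m
  have "\<exists>j m. G n q j m" for n and q :: "nat \<times> nat"
  proof -
    have "(\<lambda>j. \<Sum>i<snd q. \<bar>entry (d j) i\<bar>) \<longlonglongrightarrow> (\<Sum>i<snd q. \<bar>0\<bar>)"
      by (intro tendsto_sum tendsto_rabs null)
    then have "(\<lambda>j. \<Sum>i<snd q. \<bar>entry (d j) i\<bar>) \<longlonglongrightarrow> 0" by simp
    from order_tendstoD(2)[OF this \<epsilon>[of n]] obtain N where
      N: "\<And>j. j \<ge> N \<Longrightarrow> (\<Sum>i<snd q. \<bar>entry (d j) i\<bar>) < \<epsilon> n"
      unfolding eventually_sequentially by blast
    define j where "j = max N (Suc (fst q))"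
    have "norm (proj {..<snd q} (d j)) \<le> \<epsilon> n"
      using norm_proj_finite_le[of "snd q" "d j"] N[of j] by (simp add: j_def)
    moreover obtain m where m: "norm (proj {m..} (d j)) \<le> \<epsilon> n" using functional_tail_small[OF \<epsilon>[of n]] by blast
    moreover have "norm (proj {max m (Suc (snd q))..} (d j)) \<le> \<epsilon> n"
    proof -
      have "proj {max m (Suc (snd q))..} (d j) = proj {max m (Suc (snd q))..} (proj {m..} (d j))"
        by (rule functional_eqI, simp add: act_proj, rule arg_cong[of _ _ "act (d j)"])
          (rule poly_mapping_eqI, simp add: lookup_restrict_c00)
      then show ?thesis using norm_proj_le m by (metis order_trans)
    qed
    ultimately have "G n q j (max m (Suc (snd q)))" by (simp add: G_def j_def less_max_iff_disj)
    then show ?thesis by blast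
  qed
  then obtain j m where G: "\<And>n q. G n q (j n q) (m n q)" by metis
  define st where "st = rec_nat (0, 0) (\<lambda>n q. (j n q, m n q))"
  have st: "st (Suc n) = (j n (st n), m n (st n))" for n by (simp add: st_def)
  define r where "r n = fst (st (Suc n))" for n
  define p where "p n = snd (st n)" for n
  define u where "u n = proj {p n..<p (Suc n)} (d (r n))" for n
  have G': "fst (st n) < r n" "p n < p (Suc n)" "norm (proj {..<p n} (d (r n))) \<le> \<epsilon> n"
    "norm (proj {p (Suc n)..} (d (r n))) \<le> \<epsilon> n" for n
    using G[of n "st n"] by (simp_all add: G_def r_def p_def st)
  have "r n < r (Suc n)" for n using G'(1)[of "Suc n"] by (simp add: r_def)
  then have "strict_mono r" "strict_mono p" using G'(2) by (simp_all add: strict_mono_Suc_iff)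
  moreover have "norm (d (r n) - u n) \<le> 2 * \<epsilon> n" for n
  proof -
    have "d (r n) - u n = proj {..<p n} (d (r n)) + proj {p (Suc n)..} (d (r n))"
      using proj_split[of "p n" "p (Suc n)" "d (r n)"] G'(2)[of n] by (simp add: u_def algebra_simps)
    then show ?thesis using norm_triangle_ineq[of "proj {..<p n} (d (r n))" "proj {p (Suc n)..} (d (r n))"]
      G'(3,4)[of n] by simp
  qed
  moreover have "p n \<le> i \<and> i < p (Suc n)" if "entry (u n) i \<noteq> 0" for n i
    using that by (simp add: u_def entry_proj split: if_splits)
  ultimately show ?thesis by blast
qed

lemma block_coefficient_le:
  assumes p: "strict_mono p"
    and u_block: "\<And>j i. entry (u j) i \<noteq> 0 \<Longrightarrow> p j \<le> i \<and> i < p (Suc j)"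
    and J: "finite J" "i \<in> J"
  shows "\<bar>b i\<bar> * norm (u i) \<le> norm (\<Sum>j\<in>J. b j *\<^sub>R u j)"
proof -
  have "proj {p i..<p (Suc i)} (\<Sum>j\<in>J. b j *\<^sub>R u j) = b i *\<^sub>R u i"
  proof (rule functional_eqI)
    fix a
    let ?a = "restrict_c00 {p i..<p (Suc i)} a"
    have other: "act (u j) ?a = 0" if "j \<noteq> i" for j
    proof (rule act_eq_0, rule ccontr)
      fix k assume k: "k \<in> supp ?a" "entry (u j) k \<noteq> 0"
      have "j = i"
        by (rule strict_mono_block_unique[OF p, of j k i]) (use u_block[OF k(2)] k(1) in \<open>auto simp: keys_restrict_c00\<close>)
      then show False using that by simp
    qed
    have "act (proj {p i..<p (Suc i)} (\<Sum>j\<in>J. b j *\<^sub>R u j)) a = (\<Sum>j\<in>J. b j * act (u j) ?a)"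
      by (simp add: act_proj act_left)
    also have "\<dots> = (\<Sum>j\<in>{i}. b j * act (u j) ?a)"
      using J other by (intro sum.mono_neutral_right) auto
    also have "\<dots> = act (b i *\<^sub>R u i) a"
      using act_restrict_eq[of a "u i" "{p i..<p (Suc i)}"] u_block by (force simp: act_left)
    finally show "act (proj {p i..<p (Suc i)} (\<Sum>j\<in>J. b j *\<^sub>R u j)) a = act (b i *\<^sub>R u i) a" .
  qed
  then show ?thesis using norm_proj_le[of "{p i..<p (Suc i)}" "\<Sum>j\<in>J. b j *\<^sub>R u j"] by simp
qed

lemma sum_half_powers_le:
  assumes "finite J" "inj_on s J"
  shows "(\<Sum>i\<in>J. (1/2::real) ^ s i) \<le> 2"
proof -
  have "(\<Sum>i\<in>J. (1/2::real) ^ s i) = (\<Sum>k\<in>s ` J. (1/2) ^ k)" using assms(2) by (simp add: sum.reindex)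
  also have "\<dots> \<le> suminf (\<lambda>k. (1/2::real) ^ k)"
    by (rule sum_le_suminf) (use assms(1) in \<open>auto intro: summable_geometric\<close>)
  also have "\<dots> = 2" using suminf_geometric[of "1/2::real"] by simp
  finally show ?thesis .
qed

text \<open>
  The blocks that approximate a subsequence inherit the symmetry with a larger constant.  In the sequence of
  blocks each coefficient is bounded by the norm of the whole combination, and the approximation
  errors are summable, so replacing \<open>d\<close> by blocks changes a combination by at most the norm of the
  corresponding combination of blocks.
\<close>

lemma no_symmetric_coordinatewise_null_sequence:
  fixes d :: "nat \<Rightarrow> (su_tsirelson_dual \<Rightarrow>\<^sub>L real)"
  assumes null: "\<And>i. (\<lambda>j. entry (d j) i) \<longlonglongrightarrow> 0"
    and c: "0 < c" "\<And>j. c \<le> norm (d j)"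
    and sym: "\<And>J s b. finite J \<Longrightarrow> inj_on s J \<Longrightarrow>
      norm (\<Sum>i\<in>J. b i *\<^sub>R d (s i)) \<le> K * norm (\<Sum>i\<in>J. b i *\<^sub>R d i)"
  shows False
proof -
  \<comment> \<open>Small enough for the errors \<open>2 * (e * (1/2) ^ n)\<close> to add up to at most \<open>c / 2\<close>, the lower bound of the blocks.\<close>
  define e where "e = c / 8"
  have e: "0 < e * (1/2) ^ n" for n using c(1) by (simp add: e_def)
  obtain r p u where r: "strict_mono r" and p: "strict_mono p"
    and u_block: "\<And>n i. entry (u n) i \<noteq> 0 \<Longrightarrow> p n \<le> i \<and> i < p (Suc n)"
    and close: "\<And>n. norm (d (r n) - u n) \<le> 2 * (e * (1/2) ^ n)"
    using null_sequence_block_approximation[of d "\<lambda>n. e * (1/2) ^ n", OF null e] by blast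
  have inj_r: "inj_on r A" for A using r strict_mono_imp_inj_on inj_on_subset by blast
  have u_c: "c / 2 \<le> norm (u n)" for n
  proof -
    have "e * (1/2) ^ n \<le> e * 1" using c(1) by (intro mult_left_mono power_le_one) (auto simp: e_def)
    then have "norm (d (r n) - u n) \<le> c / 4" using close[of n] by (simp add: e_def)
    then show ?thesis using c(1) c(2)[of "r n"] norm_triangle_ineq2[of "d (r n)" "u n"] by linarith
  qed
  have "0 \<le> norm (d 0)" "norm (d 0) \<le> K * norm (d 0)" using sym[of "{0}" "\<lambda>i. i" "\<lambda>_. 1"] by simp_all
  then have K: "0 \<le> K" using c(1) c(2)[of 0]
    by (smt (verit, best) mult_neg_pos)
  have perturb: "(\<Sum>i\<in>J. \<bar>b i\<bar> * norm (d (r (s i)) - u (s i))) \<le> norm (\<Sum>i\<in>J. b i *\<^sub>R u i)"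
    if J: "finite J" "inj_on s J" for J s b
  proof -
    define Z where "Z = norm (\<Sum>i\<in>J. b i *\<^sub>R u i)"
    have "\<bar>b i\<bar> * norm (d (r (s i)) - u (s i)) \<le> Z / 2 * (1/2) ^ s i" if i: "i \<in> J" for i
    proof -
      have "\<bar>b i\<bar> * (c / 2) \<le> \<bar>b i\<bar> * norm (u i)" by (intro mult_left_mono u_c) simp
      also have "\<dots> \<le> Z" unfolding Z_def by (rule block_coefficient_le[OF p u_block J(1) i])
      finally have "\<bar>b i\<bar> \<le> 2 * Z / c" using c(1) by (simp add: field_simps)
      then have "\<bar>b i\<bar> * norm (d (r (s i)) - u (s i)) \<le> 2 * Z / c * (2 * (e * (1/2) ^ s i))"
        by (intro mult_mono close) (auto simp: Z_def c(1) less_imp_le)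
      also have "\<dots> = Z / 2 * (1/2) ^ s i" using c(1) by (simp add: e_def)
      finally show ?thesis .
    qed
    then have "(\<Sum>i\<in>J. \<bar>b i\<bar> * norm (d (r (s i)) - u (s i))) \<le> (\<Sum>i\<in>J. Z / 2 * (1/2) ^ s i)"
      by (rule sum_mono)
    also have "\<dots> = Z / 2 * (\<Sum>i\<in>J. (1/2) ^ s i)" by (simp add: sum_distrib_left)
    also have "\<dots> \<le> Z / 2 * 2" by (intro mult_left_mono sum_half_powers_le J) (simp add: Z_def)
    finally show ?thesis by (simp add: Z_def)
  qed
  have diff: "norm ((\<Sum>i\<in>J. b i *\<^sub>R d (r (s i))) - (\<Sum>i\<in>J. b i *\<^sub>R u (s i))) \<le> norm (\<Sum>i\<in>J. b i *\<^sub>R u i)"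
    if J: "finite J" "inj_on s J" for J s b
  proof -
    have "(\<Sum>i\<in>J. b i *\<^sub>R d (r (s i))) - (\<Sum>i\<in>J. b i *\<^sub>R u (s i)) = (\<Sum>i\<in>J. b i *\<^sub>R (d (r (s i)) - u (s i)))"
      by (simp add: scaleR_diff_right sum_subtractf)
    also have "norm \<dots> \<le> (\<Sum>i\<in>J. \<bar>b i\<bar> * norm (d (r (s i)) - u (s i)))"
      by (rule order_trans[OF norm_sum]) simp
    also have "\<dots> \<le> norm (\<Sum>i\<in>J. b i *\<^sub>R u i)" by (rule perturb[OF J])
    finally show ?thesis .
  qed
  have "symmetric_blocks u p (c / 2) (2 * K + 1)"
  proof
    fix J and s :: "nat \<Rightarrow> nat" and b :: "nat \<Rightarrow> real" assume J: "finite J" "inj_on s J"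
    define Z where "Z = norm (\<Sum>i\<in>J. b i *\<^sub>R u i)"
    have "norm (\<Sum>i\<in>J. b i *\<^sub>R d (r i)) \<le> 2 * Z"
      using diff[OF J(1), of "\<lambda>i. i" b]
        norm_triangle_ineq2[of "\<Sum>i\<in>J. b i *\<^sub>R d (r i)" "\<Sum>i\<in>J. b i *\<^sub>R u i"] by (simp add: Z_def)
    then have "K * norm (\<Sum>i\<in>J. b i *\<^sub>R d (r i)) \<le> K * (2 * Z)" by (rule mult_left_mono[OF _ K])
    moreover have "norm (\<Sum>i\<in>J. b i *\<^sub>R d (r (s i))) \<le> K * norm (\<Sum>i\<in>J. b i *\<^sub>R d (r i))"
      by (rule symmetric_sums_two_injections[OF sym J(1) _ inj_r])
        (use comp_inj_on[OF J(2) inj_r] in \<open>simp_all add: comp_def\<close>)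
    moreover have "norm (\<Sum>i\<in>J. b i *\<^sub>R u (s i)) \<le> norm (\<Sum>i\<in>J. b i *\<^sub>R d (r (s i))) + Z"
      using diff[OF J, of b]
        norm_triangle_ineq2[of "\<Sum>i\<in>J. b i *\<^sub>R u (s i)" "\<Sum>i\<in>J. b i *\<^sub>R d (r (s i))"]
      by (simp add: Z_def norm_minus_commute)
    ultimately show "norm (\<Sum>i\<in>J. b i *\<^sub>R u (s i)) \<le> (2 * K + 1) * norm (\<Sum>i\<in>J. b i *\<^sub>R u i)"
      by (simp add: Z_def algebra_simps)
  qed (use p u_block c(1) u_c in auto)
  then show False by (rule no_symmetric_blocks)
qed

theorem theorem12:
  shows "\<not> (\<exists>x :: nat \<Rightarrow> (su_tsirelson_dual \<Rightarrow>\<^sub>L real). symmetric_basic_sequence x)"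
proof
  assume "\<exists>x :: nat \<Rightarrow> (su_tsirelson_dual \<Rightarrow>\<^sub>L real). symmetric_basic_sequence x"
  then obtain x :: "nat \<Rightarrow> (su_tsirelson_dual \<Rightarrow>\<^sub>L real)" where x: "symmetric_basic_sequence x" by blast
  from symmetric_basic_sequence_uniform[OF x] obtain m K where
    mK: "\<forall>J s b. finite J \<and> J \<subseteq> {m..} \<and> inj_on s J \<and> s ` J \<subseteq> {m..} \<longrightarrow>
      norm (\<Sum>i\<in>J. b i *\<^sub>R x (s i)) \<le> K * norm (\<Sum>i\<in>J. b i *\<^sub>R x i)"
    by (elim exE)
  \<comment> \<open>Beyond \<open>m\<close> the symmetry is uniform.\<close>
  define y where "y j = x (m + j)" for j
  have sym: "norm (\<Sum>i\<in>J. b i *\<^sub>R y (s i)) \<le> K * norm (\<Sum>i\<in>J. b i *\<^sub>R y i)"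
    if J: "finite J" "inj_on s J" for J s b
  proof -
    have "norm (\<Sum>k\<in>(+) m ` J. b (k - m) *\<^sub>R x (m + s (k - m)))
        \<le> K * norm (\<Sum>k\<in>(+) m ` J. b (k - m) *\<^sub>R x k)"
      by (rule mK[rule_format]) (use J in \<open>auto simp: inj_on_def\<close>)
    then show ?thesis by (simp add: sum.reindex y_def)
  qed
  have "x m \<noteq> x (m + 1)"
  proof
    assume eq: "x m = x (m + 1)"
    have basic: "basic_sequence x" using x by (simp add: symmetric_basic_sequence_def)
    have "(\<lambda>j. (if j = i then 1 else 0) *\<^sub>R x j) sums x i" for i
      using sums_single[of i x] by (simp add: if_distrib[of "\<lambda>c. c *\<^sub>R _"] cong: if_cong)
    from basic_sequence_expansion_unique[OF basic this[of m] this[of "m + 1", folded eq]]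
    have "(if m = m then 1 else 0 :: real) = (if m = m + 1 then 1 else 0)" by metis
    then show False by simp
  qed
  then have y01: "0 < norm (y 0 - y 1)" by (simp add: y_def)
  have y_le: "norm (y j) \<le> K * norm (y 0)" for j
    using sym[of "{0}" "\<lambda>_. j" "\<lambda>_. 1"] by simp
  obtain r where r: "strict_mono r" "\<And>i. convergent (\<lambda>j. entry (y (r j)) i)"
    using bounded_double_sequence_diagonal[of "\<lambda>j i. entry (y j) i" "K * norm (y 0)"]
      entry_le y_le order_trans by metis
  have inj_r: "inj r" using r(1) by (rule strict_mono_imp_inj_on)
  \<comment> \<open>The subsequence converges in every coordinate, so its differences tend to 0 there; symmetry bounds them from below.\<close>
  define d where "d j = y (r (2 * j)) - y (r (2 * j + 1))" for j
  have lower: "norm (y 0 - y 1) \<le> K * norm (d j)" for j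
  proof -
    have "inj_on (\<lambda>i. r (2 * j + i)) {0, 1}" by (simp add: inj_on_def inj_eq[OF inj_r])
    from symmetric_sums_two_injections[of y K "{0, 1}" "\<lambda>i. i" _ "\<lambda>i. if i = 0 then 1 else -1", OF sym _ _ this]
    show ?thesis by (simp add: d_def)
  qed
  have K: "0 < K" using lower[of 0] y01 by (smt (verit) norm_ge_zero mult_nonpos_nonneg)
  show False
  proof (rule no_symmetric_coordinatewise_null_sequence)
    show "0 < norm (y 0 - y 1) / K" using y01 K by simp
    show "norm (y 0 - y 1) / K \<le> norm (d j)" for j using lower[of j] K by (simp add: field_simps)
    show "norm (\<Sum>i\<in>J. b i *\<^sub>R d (s i)) \<le> K * norm (\<Sum>i\<in>J. b i *\<^sub>R d i)"
      if "finite J" "inj_on s J" for J s b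
      unfolding d_def by (rule symmetric_differences[OF sym inj_r that])
    show "(\<lambda>j. entry (d j) i) \<longlonglongrightarrow> 0" for i
    proof -
      obtain l where l: "(\<lambda>j. entry (y (r j)) i) \<longlonglongrightarrow> l" using r(2)[of i] by (auto simp: convergent_def)
      have "strict_mono (\<lambda>j::nat. 2 * j)" "strict_mono (\<lambda>j::nat. 2 * j + 1)" by (auto simp: strict_mono_def)
      from tendsto_diff[OF LIMSEQ_subseq_LIMSEQ[OF l this(1)] LIMSEQ_subseq_LIMSEQ[OF l this(2)]]
      show ?thesis by (simp add: d_def entry_left comp_def)
    qed
  qed
qed

end
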